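(* Let $\Omega \subset \mathbb{R}^n$ be an open, bounded, connected subset with $\mathcal{C}^1$ boundary. Let $C = \lambda_1^{-1/2}$ be the optimal Poincaré constant on $\Omega$, where $\lambda_1>0$ is the smallest eigenvalue of $-\Delta$ on $H_0^1(\Omega)$. Assume that $F_1:\mathbb{C}\to\mathbb{C}$ and $F_2:\mathbb{C}^n\to\mathbb{C}$ are globally Lipschitz functions with Lipschitz constants $C_1$ and $C_2$, respectively, such that $C_1C^2+C_2C<1$. Let $f\in L^2(\Omega)$ and let $g\in L^2(\partial\Omega)$ be the trace on $\partial\Omega$ of some $\tilde g\in H^1(\Omega)$. Then the problem $$-\Delta u + F_1(u)+F_2(\nabla u) = f \ \text{ in } \Omega, \qquad u|_{\partial\Omega}=g,$$ has a unique weak solution $u\in H^1(\Omega)$ (that is, with $u-\tilde g\in H_0^1(\Omega)$).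
   Context: All function spaces consist of complex-valued functions. $H^1(\Omega)$ is the Sobolev space with inner product $\langle f,h\rangle_{H^1}=\int_\Omega f\bar h\,dx+\int_\Omega\nabla f\cdot\nabla\bar h\,dx$, and $H^1_0(\Omega)$ is the closure of $\mathcal{C}_c^\infty(\Omega,\mathbb{C})$ in it. The sign convention is that $-\Delta$ has positive eigenvalues. $\mathbb{C}^n$ carries its Euclidean norm. A weak solution is a function $u\in H^1(\Omega)$ with $u-\tilde g\in H_0^1(\Omega)$ (equivalently, with trace $g$ on $\partial\Omega$) such that $\int_\Omega \nabla u\cdot\nabla v\,dx+\int_\Omega (F_1(u)+F_2(\nabla u))\,v\,dx=\int_\Omega f\,v\,dx$ for all $v\in H_0^1(\Omega)$. *)

theory Defs
  imports "HOL-Analysis.Analysis"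
begin

section \<open>Smooth functions and domains with continuously differentiable boundary\<close>

definition partial :: "'n::finite \<Rightarrow> (real^'n \<Rightarrow> complex) \<Rightarrow> real^'n \<Rightarrow> complex" where
  "partial i f x = frechet_derivative f (at x) (axis i 1)"

primrec Ck :: "nat \<Rightarrow> (real^'n::finite \<Rightarrow> complex) \<Rightarrow> bool" where
  "Ck 0 f \<longleftrightarrow> continuous_on UNIV f"
| "Ck (Suc k) f \<longleftrightarrow> (\<forall>x. f differentiable (at x)) \<and> (\<forall>i. Ck k (partial i f))"

definition smooth :: "(real^'n::finite \<Rightarrow> complex) \<Rightarrow> bool" where
  "smooth f \<longleftrightarrow> (\<forall>k. Ck k f)"

definition test_functions :: "(real^'n::finite) set \<Rightarrow> (real^'n \<Rightarrow> complex) set" where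
  "test_functions \<Omega> = {\<phi>. smooth \<phi> \<and> compact (closure {x. \<phi> x \<noteq> 0}) \<and>
     closure {x. \<phi> x \<noteq> 0} \<subseteq> \<Omega>}"

(* Near each boundary point, \<Omega> is the strict epigraph of a C^1 function over the hyperplane
   orthogonal to a unit vector e. To avoid a type for R^(n-1), the function is given on all of
   R^n and evaluated only at the orthogonal projection of x to that hyperplane (any C^1 function
   on the hyperplane extends in this way). *)
definition C1_boundary :: "(real^'n::finite) set \<Rightarrow> bool" where
  "C1_boundary \<Omega> \<longleftrightarrow> (\<forall>p \<in> frontier \<Omega>. \<exists>r>0. \<exists>e (\<gamma> :: real^'n \<Rightarrow> real) D.
     norm e = 1 \<and> (\<forall>y. GDERIV \<gamma> y :> D y) \<and> continuous_on UNIV D \<and>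
     \<Omega> \<inter> ball p r = {x \<in> ball p r. x \<bullet> e > \<gamma> (x - (x \<bullet> e) *\<^sub>R e)})"

section \<open>Square-integrable functions and Sobolev spaces\<close>

(* All function spaces below consist of functions, not of classes modulo null sets. *)
definition L2 :: "'a measure \<Rightarrow> ('a \<Rightarrow> 'b::{second_countable_topology, real_normed_vector}) set" where
  "L2 M = {u. u \<in> borel_measurable M \<and> integrable M (\<lambda>x. (norm (u x))\<^sup>2)}"

definition norm_L2 :: "'a measure \<Rightarrow> ('a \<Rightarrow> 'b::{second_countable_topology, real_normed_vector}) \<Rightarrow> real" where
  "norm_L2 M u = sqrt (LINT x|M. (norm (u x))\<^sup>2)"

definition has_weak_gradient ::
  "(real^'n::finite) set \<Rightarrow> (real^'n \<Rightarrow> complex) \<Rightarrow> (real^'n \<Rightarrow> complex^'n) \<Rightarrow> bool" where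
  "has_weak_gradient \<Omega> u G \<longleftrightarrow> u \<in> L2 (lebesgue_on \<Omega>) \<and> G \<in> L2 (lebesgue_on \<Omega>) \<and>
     (\<forall>\<phi> \<in> test_functions \<Omega>. \<forall>i.
        (LINT x|lebesgue_on \<Omega>. u x * partial i \<phi> x) = - (LINT x|lebesgue_on \<Omega>. G x $ i * \<phi> x))"

definition H1 :: "(real^'n::finite) set \<Rightarrow> (real^'n \<Rightarrow> complex) set" where
  "H1 \<Omega> = {u. \<exists>G. has_weak_gradient \<Omega> u G}"

(* A representative of the weak gradient, which is unique almost everywhere on \<Omega>. *)
definition wgrad :: "(real^'n::finite) set \<Rightarrow> (real^'n \<Rightarrow> complex) \<Rightarrow> real^'n \<Rightarrow> complex^'n" where
  "wgrad \<Omega> u = (SOME G. has_weak_gradient \<Omega> u G)"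

(* Bilinear: no complex conjugation. *)
definition cdot :: "complex^'n::finite \<Rightarrow> complex^'n \<Rightarrow> complex" where
  "cdot a b = (\<Sum>i\<in>UNIV. a $ i * b $ i)"

definition inner_H1 ::
  "(real^'n::finite) set \<Rightarrow> (real^'n \<Rightarrow> complex) \<Rightarrow> (real^'n \<Rightarrow> complex) \<Rightarrow> complex" where
  "inner_H1 \<Omega> f h = (LINT x|lebesgue_on \<Omega>. f x * cnj (h x)) +
     (LINT x|lebesgue_on \<Omega>. cdot (wgrad \<Omega> f x) (wgrad \<Omega> (\<lambda>y. cnj (h y)) x))"

definition norm_H1 :: "(real^'n::finite) set \<Rightarrow> (real^'n \<Rightarrow> complex) \<Rightarrow> real" where
  "norm_H1 \<Omega> u = sqrt (Re (inner_H1 \<Omega> u u))"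

definition H10 :: "(real^'n::finite) set \<Rightarrow> (real^'n \<Rightarrow> complex) set" where
  "H10 \<Omega> = {u \<in> H1 \<Omega>. \<forall>\<epsilon>>0. \<exists>\<phi> \<in> test_functions \<Omega>. norm_H1 \<Omega> (\<lambda>x. u x - \<phi> x) < \<epsilon>}"

section \<open>Boundary values\<close>

(* The m-dimensional Hausdorff measure, normalised to agree with Lebesgue measure on R^m.
   Nonempty sets of diameter 0 have weight 0^0 = 1 for m = 0, giving counting measure. *)
definition hausdorff_weight :: "nat \<Rightarrow> 'a::metric_space set \<Rightarrow> ennreal" where
  "hausdorff_weight m U =
     (if U = {} then 0 else ennreal (unit_ball_vol (real m) * (diameter U / 2) ^ m))"

definition hausdorff_outer :: "nat \<Rightarrow> 'a::metric_space set \<Rightarrow> ennreal" where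
  "hausdorff_outer m A = (SUP \<delta>\<in>{0<..}.
     INF U\<in>{U :: nat \<Rightarrow> 'a set. A \<subseteq> (\<Union>i. U i) \<and> (\<forall>i. bounded (U i) \<and> diameter (U i) \<le> \<delta>)}.
       \<Sum>i. hausdorff_weight m (U i))"

(* This is a metric outer measure, hence countably additive on Borel sets. *)
definition hausdorff_measure :: "nat \<Rightarrow> 'a::metric_space measure" where
  "hausdorff_measure m = measure_of UNIV (sets borel) (hausdorff_outer m)"

definition surface_measure :: "(real^'n::finite) set \<Rightarrow> (real^'n) measure" where
  "surface_measure \<Omega> =
     completion (restrict_space (hausdorff_measure (CARD('n) - 1)) (frontier \<Omega>))"

(* The graph of the trace operator, the continuous extension to H^1(\<Omega>) of the restriction to the
   boundary of functions that are smooth up to the boundary. For the bounded domains with C^1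
   boundary considered here these functions are dense in H^1(\<Omega>). *)
definition has_trace :: "(real^'n::finite) set \<Rightarrow> (real^'n \<Rightarrow> complex) \<Rightarrow> (real^'n \<Rightarrow> complex) \<Rightarrow> bool" where
  "has_trace \<Omega> u g \<longleftrightarrow> u \<in> H1 \<Omega> \<and> g \<in> L2 (surface_measure \<Omega>) \<and>
     (\<exists>\<phi> :: nat \<Rightarrow> real^'n \<Rightarrow> complex. (\<forall>k. smooth (\<phi> k)) \<and>
        (\<lambda>k. norm_H1 \<Omega> (\<lambda>x. \<phi> k x - u x)) \<longlonglongrightarrow> 0 \<and>
        (\<lambda>k. norm_L2 (surface_measure \<Omega>) (\<lambda>x. \<phi> k x - g x)) \<longlonglongrightarrow> 0)"

section \<open>Dirichlet eigenvalues and weak solutions\<close>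

definition dirichlet_eigenvalue :: "(real^'n::finite) set \<Rightarrow> real \<Rightarrow> bool" where
  "dirichlet_eigenvalue \<Omega> \<mu> \<longleftrightarrow> (\<exists>w \<in> H10 \<Omega>. \<not> (AE x in lebesgue_on \<Omega>. w x = 0) \<and>
     (\<forall>v \<in> H10 \<Omega>. (LINT x|lebesgue_on \<Omega>. cdot (wgrad \<Omega> w x) (wgrad \<Omega> v x)) =
        complex_of_real \<mu> * (LINT x|lebesgue_on \<Omega>. w x * v x)))"

definition smallest_dirichlet_eigenvalue :: "(real^'n::finite) set \<Rightarrow> real \<Rightarrow> bool" where
  "smallest_dirichlet_eigenvalue \<Omega> \<mu> \<longleftrightarrow>
     dirichlet_eigenvalue \<Omega> \<mu> \<and> (\<forall>\<nu>. dirichlet_eigenvalue \<Omega> \<nu> \<longrightarrow> \<mu> \<le> \<nu>)"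

(* The boundary condition is imposed through the H^1 extension gt of the boundary datum. *)
definition weak_solution ::
  "(real^'n::finite) set \<Rightarrow> (complex \<Rightarrow> complex) \<Rightarrow> (complex^'n \<Rightarrow> complex) \<Rightarrow>
   (real^'n \<Rightarrow> complex) \<Rightarrow> (real^'n \<Rightarrow> complex) \<Rightarrow> (real^'n \<Rightarrow> complex) \<Rightarrow> bool" where
  "weak_solution \<Omega> F1 F2 f gt u \<longleftrightarrow> u \<in> H1 \<Omega> \<and> (\<lambda>x. u x - gt x) \<in> H10 \<Omega> \<and>
     (\<forall>v \<in> H10 \<Omega>.
        (LINT x|lebesgue_on \<Omega>. cdot (wgrad \<Omega> u x) (wgrad \<Omega> v x)) +
        (LINT x|lebesgue_on \<Omega>. (F1 (u x) + F2 (wgrad \<Omega> u x)) * v x) =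
        (LINT x|lebesgue_on \<Omega>. f x * v x))"

end

theory Submission
  imports Defs "HOL-Complex_Analysis.Great_Picard"
begin

text \<open>
  Write \<open>u = gt + w\<close> with \<open>w \<in> H10 \<Omega>\<close>. For fixed \<open>w\<close> the linear problem with right-hand side
  \<open>f - F1 (gt + w) - F2 (\<nabla>gt + \<nabla>w)\<close> is solved by Riesz representation with respect to the form
  \<open>\<integral>\<nabla>u \<bullet> \<nabla>v\<close>; by the Poincare inequality the solution map has Lipschitz constant
  \<open>C1 * C\<^sup>2 + C2 * C < 1\<close> for the norm of the gradient, so it has exactly one fixed point.
  That \<open>lambda1 powr (- 1 / 2)\<close> is a Poincare constant is not a definition here: the infimum of the
  Rayleigh quotient is attained by Rellich's theorem, so it is an eigenvalue, hence at least
  \<open>lambda1\<close>. Compactness and traces are needed on \<open>H10 \<Omega>\<close> only, where no regularity of the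
  boundary is involved.
\<close>

section \<open>The Hilbert space of square-integrable functions\<close>

text \<open>The obstacle is that the Sobolev spaces of the statement consist of functions, while
  minimisation and fixed points need a complete inner product space. A function \<open>u\<close> is
  therefore represented by the pair \<open>sob u\<close> of the classes of \<open>u\<close> and of
  its weak gradient in \<open>l2\<close>, and \<open>H10\<close> corresponds to \<open>V\<close>,
  the closure of the pairs of test functions; \<open>V_representative\<close> leads back from
  \<open>V\<close> to functions. All Hilbert space arguments are real although the functions are
  complex: the forms in \<open>weak_solution\<close> are complex bilinear, not hermitian, and a
  Lipschitz map respects no complex structure. Real scalars suffice because \<open>H10\<close> is
  invariant under conjugation and under multiplication by \<open>\<i>\<close>. The constant
  \<open>C1 * C\<^sup>2 + C2 * C\<close> arises because the nonlinearity is paired with the function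
  part of an increment, which costs one factor \<open>C\<close>, and the \<open>F1\<close> term also
  measures the difference of its arguments by their function parts, which costs another.\<close>

lemma L2I: "u \<in> borel_measurable M \<Longrightarrow> integrable M (\<lambda>x. (norm (u x))\<^sup>2) \<Longrightarrow> u \<in> L2 M"
  by (simp add: L2_def)

lemma L2_measurable: "u \<in> L2 M \<Longrightarrow> u \<in> borel_measurable M"
  by (simp add: L2_def)

lemma L2_integrable: "u \<in> L2 M \<Longrightarrow> integrable M (\<lambda>x. (norm (u x))\<^sup>2)"
  by (simp add: L2_def)

lemma L2_dominated:
  assumes "f \<in> L2 M" "g \<in> borel_measurable M" "AE x in M. norm (g x) \<le> norm (f x)"
  shows "g \<in> L2 M"
proof (rule L2I)
  show "integrable M (\<lambda>x. (norm (g x))\<^sup>2)"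
  proof (rule Bochner_Integration.integrable_bound[OF L2_integrable[OF assms(1)]])
    show "(\<lambda>x. (norm (g x))\<^sup>2) \<in> borel_measurable M" using assms(2) by measurable
    show "AE x in M. norm ((norm (g x))\<^sup>2) \<le> norm ((norm (f x))\<^sup>2)"
      using assms(3) by eventually_elim (auto intro!: power_mono)
  qed
qed (fact assms)

lemma L2_norm: "f \<in> L2 M \<Longrightarrow> (\<lambda>x. norm (f x)) \<in> L2 M"
  by (rule L2_dominated) (auto dest: L2_measurable)

lemma L2_zero: "(\<lambda>x. 0) \<in> L2 M"
  by (simp add: L2_def)

lemma L2_scaleR: "f \<in> L2 M \<Longrightarrow> (\<lambda>x. c *\<^sub>R f x) \<in> L2 M"
  by (auto simp: L2_def power_mult_distrib)

lemma norm_add_squared_le: "(norm (x + y :: 'a::real_normed_vector))\<^sup>2 \<le> 2 * (norm x)\<^sup>2 + 2 * (norm y)\<^sup>2"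
proof -
  have "(norm (x + y))\<^sup>2 \<le> (norm x + norm y)\<^sup>2"
    by (intro power_mono norm_triangle_ineq) auto
  also have "\<dots> \<le> 2 * (norm x)\<^sup>2 + 2 * (norm y)\<^sup>2"
    using sum_squares_bound[of "norm x" "norm y"] by (simp add: power2_eq_square algebra_simps)
  finally show ?thesis .
qed

lemma L2_add:
  assumes "f \<in> L2 M" "g \<in> L2 M"
  shows "(\<lambda>x. f x + g x) \<in> L2 M"
proof (rule L2I)
  have [measurable]: "f \<in> borel_measurable M" "g \<in> borel_measurable M"
    using assms by (auto dest: L2_measurable)
  show "(\<lambda>x. f x + g x) \<in> borel_measurable M" by measurable
  show "integrable M (\<lambda>x. (norm (f x + g x))\<^sup>2)"
  proof (rule Bochner_Integration.integrable_bound)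
    show "integrable M (\<lambda>x. 2 * (norm (f x))\<^sup>2 + 2 * (norm (g x))\<^sup>2)"
      using assms by (intro Bochner_Integration.integrable_add Bochner_Integration.integrable_mult_right L2_integrable)
    show "AE x in M. norm ((norm (f x + g x))\<^sup>2) \<le> norm (2 * (norm (f x))\<^sup>2 + 2 * (norm (g x))\<^sup>2)"
      using norm_add_squared_le by (intro always_eventually allI) force
  qed simp
qed

lemma L2_diff:
  assumes "f \<in> L2 M" "g \<in> L2 M"
  shows "(\<lambda>x. f x - g x) \<in> L2 M"
  using L2_add[OF assms(1) L2_scaleR[OF assms(2), of "-1"]] by simp

lemma L2_uminus: "f \<in> L2 M \<Longrightarrow> (\<lambda>x. - f x) \<in> L2 M"
  using L2_scaleR[of f M "-1"] by simp

lemma L2_sum: "(\<And>i. i \<in> A \<Longrightarrow> f i \<in> L2 M) \<Longrightarrow> (\<lambda>x. \<Sum>i\<in>A. f i x) \<in> L2 M"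
  by (induction A rule: infinite_finite_induct) (auto intro: L2_zero L2_add)

lemma L2_mult_integrable:
  fixes f g :: "'a \<Rightarrow> 'b::{second_countable_topology, real_normed_algebra, banach}"
  assumes "f \<in> L2 M" "g \<in> L2 M"
  shows "integrable M (\<lambda>x. f x * g x)"
proof -
  have [measurable]: "f \<in> borel_measurable M" "g \<in> borel_measurable M"
    using assms by (auto dest: L2_measurable)
  have *: "norm (f x * g x) \<le> (norm (f x))\<^sup>2 + (norm (g x))\<^sup>2" for x
    using norm_mult_ineq[of "f x" "g x"] sum_squares_bound[of "norm (f x)" "norm (g x)"]
    zero_le_power2[of "norm (f x)"] zero_le_power2[of "norm (g x)"]  by linarith
  show ?thesis
    by (rule Bochner_Integration.integrable_bound[of _ "\<lambda>x. (norm (f x))\<^sup>2 + (norm (g x))\<^sup>2"])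
       (use assms * in \<open>auto dest: L2_integrable intro!: always_eventually order_trans[OF _ abs_ge_self]\<close>)
qed

lemma L2_inner_integrable:
  fixes f g :: "'a \<Rightarrow> 'b::{second_countable_topology, real_inner}"
  assumes "f \<in> L2 M" "g \<in> L2 M"
  shows "integrable M (\<lambda>x. f x \<bullet> g x)"
proof -
  have [measurable]: "f \<in> borel_measurable M" "g \<in> borel_measurable M"
    using assms by (auto dest: L2_measurable)
  show ?thesis
    by (rule Bochner_Integration.integrable_bound[OF L2_mult_integrable[OF L2_norm[OF assms(1)] L2_norm[OF assms(2)]]])
       (auto simp: Cauchy_Schwarz_ineq2)
qed

\<comment> \<open>Classes of square-integrable functions modulo equality almost everywhere\<close>
\<comment> \<open>The relation is partial, reflexive exactly on the square-integrable functions.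
  Hence all facts about \<open>to_l2\<close> carry membership in \<open>L2 lebesgue\<close> as a
  hypothesis, and each class has a representative in \<open>L2 lebesgue\<close>.\<close>
quotient_type (overloaded) ('a, 'b) l2 = "'a::euclidean_space \<Rightarrow> 'b::euclidean_space" /
  partial: "\<lambda>f g. f \<in> L2 lebesgue \<and> g \<in> L2 lebesgue \<and> (AE x in lebesgue. f x = g x)"
  morphisms rep_l2_class to_l2
proof (rule part_equivpI)
  show "\<exists>f :: 'a \<Rightarrow> 'b. f \<in> L2 lebesgue \<and> f \<in> L2 lebesgue \<and> (AE x in lebesgue. f x = f x)"
    by (rule exI[of _ "\<lambda>x. 0"]) (simp add: L2_zero)
  show "symp (\<lambda>f g :: 'a \<Rightarrow> 'b. f \<in> L2 lebesgue \<and> g \<in> L2 lebesgue \<and> (AE x in lebesgue. f x = g x))"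
    by (rule sympI) (simp add: eq_commute)
  show "transp (\<lambda>f g :: 'a \<Rightarrow> 'b. f \<in> L2 lebesgue \<and> g \<in> L2 lebesgue \<and> (AE x in lebesgue. f x = g x))"
  proof (rule transpI, elim conjE, intro conjI)
    fix f g h :: "'a \<Rightarrow> 'b" assume "AE x in lebesgue. f x = g x" "AE x in lebesgue. g x = h x"
    then show "AE x in lebesgue. f x = h x" by eventually_elim simp
  qed
qed

definition rep_l2 :: "('a::euclidean_space, 'b::euclidean_space) l2 \<Rightarrow> 'a \<Rightarrow> 'b" where
  "rep_l2 a = (SOME f. f \<in> L2 lebesgue \<and> to_l2 f = a)"

lemma l2_obtain:
  obtains f where "f \<in> L2 lebesgue" "a = to_l2 f"
proof -
  have "\<exists>f. f \<in> L2 lebesgue \<and> a = to_l2 f"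
    by (rule l2.abs_induct) blast
  then show ?thesis using that by blast
qed

lemma rep_l2: "rep_l2 a \<in> L2 lebesgue" "to_l2 (rep_l2 a) = a"
proof -
  have "\<exists>f. f \<in> L2 lebesgue \<and> to_l2 f = a" using l2_obtain[of a] by metis
  then have "rep_l2 a \<in> L2 lebesgue \<and> to_l2 (rep_l2 a) = a"
    unfolding rep_l2_def by (rule someI_ex)
  then show "rep_l2 a \<in> L2 lebesgue" "to_l2 (rep_l2 a) = a" by auto
qed

lemma to_l2_eq_iff:
  assumes "f \<in> L2 lebesgue" "g \<in> L2 lebesgue"
  shows "to_l2 f = to_l2 g \<longleftrightarrow> (AE x in lebesgue. f x = g x)"
  using Quotient3_rel[OF Quotient3_l2, of f g] assms by blast

lemma rep_to_l2: "f \<in> L2 lebesgue \<Longrightarrow> AE x in lebesgue. rep_l2 (to_l2 f) x = f x"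
  using to_l2_eq_iff[OF rep_l2(1), of f "to_l2 f"] rep_l2(2)[of "to_l2 f"] by simp

instantiation l2 :: (euclidean_space, euclidean_space) real_vector
begin

lift_definition zero_l2 :: "('a, 'b) l2" is "\<lambda>x. 0"
  by (simp add: L2_zero)

lift_definition plus_l2 :: "('a, 'b) l2 \<Rightarrow> ('a, 'b) l2 \<Rightarrow> ('a, 'b) l2" is "\<lambda>f g x. f x + g x"
  proof (elim conjE, intro conjI L2_add)
  fix f f' g g' :: "'a \<Rightarrow> 'b"
  assume "AE x in lebesgue. f x = f' x" "AE x in lebesgue. g x = g' x"
  then show "AE x in lebesgue. f x + g x = f' x + g' x" by eventually_elim simp
qed

lift_definition minus_l2 :: "('a, 'b) l2 \<Rightarrow> ('a, 'b) l2 \<Rightarrow> ('a, 'b) l2" is "\<lambda>f g x. f x - g x"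
  proof (elim conjE, intro conjI L2_diff)
  fix f f' g g' :: "'a \<Rightarrow> 'b"
  assume "AE x in lebesgue. f x = f' x" "AE x in lebesgue. g x = g' x"
  then show "AE x in lebesgue. f x - g x = f' x - g' x" by eventually_elim simp
qed

lift_definition uminus_l2 :: "('a, 'b) l2 \<Rightarrow> ('a, 'b) l2" is "\<lambda>f x. - f x"
  by (auto intro: L2_uminus)

lift_definition scaleR_l2 :: "real \<Rightarrow> ('a, 'b) l2 \<Rightarrow> ('a, 'b) l2" is "\<lambda>c f x. c *\<^sub>R f x"
  by (auto intro: L2_scaleR)

instance
proof
  fix a b c :: "('a, 'b) l2" and r s :: real
  show "a + b + c = a + (b + c)" by transfer (auto intro!: L2_add simp: algebra_simps)
  show "a + b = b + a" by transfer (auto intro!: L2_add simp: algebra_simps)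
  show "0 + a = a" by transfer (auto intro!: L2_add)
  show "- a + a = 0" by transfer (auto intro!: L2_add L2_uminus L2_zero)
  show "a - b = a + - b" by transfer (auto intro!: L2_add L2_uminus L2_diff)
  show "r *\<^sub>R (a + b) = r *\<^sub>R a + r *\<^sub>R b"
    by transfer (auto intro!: L2_add L2_scaleR simp: algebra_simps)
  show "(r + s) *\<^sub>R a = r *\<^sub>R a + s *\<^sub>R a"
    by transfer (auto intro!: L2_add L2_scaleR simp: algebra_simps)
  show "r *\<^sub>R s *\<^sub>R a = (r * s) *\<^sub>R a"
    by transfer (auto intro!: L2_scaleR simp: algebra_simps)
  show "1 *\<^sub>R a = a" by transfer (auto intro!: L2_scaleR)
qed

end

instantiation l2 :: (euclidean_space, euclidean_space) real_inner
begin

lift_definition inner_l2 :: "('a, 'b) l2 \<Rightarrow> ('a, 'b) l2 \<Rightarrow> real" is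
  "\<lambda>f g. LINT x|lebesgue. f x \<bullet> g x"
proof clarify
  fix f f' g g' :: "'a \<Rightarrow> 'b"
  assume L: "f \<in> L2 lebesgue" "f' \<in> L2 lebesgue" "g \<in> L2 lebesgue" "g' \<in> L2 lebesgue"
    and "AE x in lebesgue. f x = f' x" "AE x in lebesgue. g x = g' x"
  then show "(LINT x|lebesgue. f x \<bullet> g x) = (LINT x|lebesgue. f' x \<bullet> g' x)"
    by (intro integral_cong_AE borel_measurable_integrable L2_inner_integrable) auto
qed

definition norm_l2 :: "('a, 'b) l2 \<Rightarrow> real" where "norm_l2 a = sqrt (a \<bullet> a)"
definition sgn_l2 :: "('a, 'b) l2 \<Rightarrow> ('a, 'b) l2" where "sgn_l2 a = a /\<^sub>R norm a"
definition dist_l2 :: "('a, 'b) l2 \<Rightarrow> ('a, 'b) l2 \<Rightarrow> real" where "dist_l2 a b = norm (a - b)"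
definition uniformity_l2 :: "(('a, 'b) l2 \<times> ('a, 'b) l2) filter" where
  "uniformity_l2 = (INF e\<in>{0 <..}. principal {(x, y). dist x y < e})"
definition open_l2 :: "('a, 'b) l2 set \<Rightarrow> bool" where
  "open_l2 S = (\<forall>x\<in>S. \<forall>\<^sub>F (x', y) in uniformity. x' = x \<longrightarrow> y \<in> S)"

instance
proof
  fix a b c :: "('a, 'b) l2" and r :: real
  show "a \<bullet> b = b \<bullet> a" by transfer (simp add: inner_commute)
  show "(a + b) \<bullet> c = a \<bullet> c + b \<bullet> c"
    by transfer (simp add: inner_add_left L2_inner_integrable)
  show "(r *\<^sub>R a) \<bullet> b = r * (a \<bullet> b)" by transfer simp
  show "0 \<le> a \<bullet> a" by transfer simp
  show "(a \<bullet> a = 0) = (a = 0)"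
  proof transfer
    fix f :: "'a \<Rightarrow> 'b" assume "f \<in> L2 lebesgue \<and> f \<in> L2 lebesgue \<and> (AE x in lebesgue. f x = f x)"
    then have f: "f \<in> L2 lebesgue" by simp
    show "((LINT x|lebesgue. f x \<bullet> f x) = 0) =
      (f \<in> L2 lebesgue \<and> (\<lambda>x. 0) \<in> L2 lebesgue \<and> (AE x in lebesgue. f x = 0))"
      using f by (subst integral_nonneg_eq_0_iff_AE) (auto intro: L2_zero L2_inner_integrable)
  qed
qed (simp_all only: norm_l2_def sgn_l2_def dist_l2_def uniformity_l2_def open_l2_def)

end

lemma to_l2_arith:
  fixes f g :: "'a::euclidean_space \<Rightarrow> 'b::euclidean_space"
  assumes "f \<in> L2 lebesgue" "g \<in> L2 lebesgue"
  shows to_l2_add: "to_l2 f + to_l2 g = to_l2 (\<lambda>x. f x + g x)"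
    and to_l2_diff: "to_l2 f - to_l2 g = to_l2 (\<lambda>x. f x - g x)"
    and to_l2_inner: "to_l2 f \<bullet> to_l2 g = (LINT x|lebesgue. f x \<bullet> g x)"
  using assms by (auto simp: plus_l2.abs_eq minus_l2.abs_eq inner_l2.abs_eq)

lemma to_l2_scaleR:
  fixes f :: "'a::euclidean_space \<Rightarrow> 'b::euclidean_space"
  assumes "f \<in> L2 lebesgue"
  shows "r *\<^sub>R to_l2 f = to_l2 (\<lambda>x. r *\<^sub>R f x)"
  using assms by (simp add: scaleR_l2.abs_eq)

lemma to_l2_norm:
  fixes f :: "'a::euclidean_space \<Rightarrow> 'b::euclidean_space"
  assumes "f \<in> L2 lebesgue"
  shows "norm (to_l2 f) = norm_L2 lebesgue f"
  using assms by (simp add: norm_eq_sqrt_inner to_l2_inner norm_L2_def power2_norm_eq_inner)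

lemma to_l2_sum:
  fixes f :: "'i \<Rightarrow> 'a::euclidean_space \<Rightarrow> 'b::euclidean_space"
  assumes "\<And>i. i \<in> A \<Longrightarrow> f i \<in> L2 lebesgue"
  shows "(\<Sum>i\<in>A. to_l2 (f i)) = to_l2 (\<lambda>x. \<Sum>i\<in>A. f i x)"
  using assms
  by (induction A rule: infinite_finite_induct) (auto simp: zero_l2_def to_l2_add L2_sum)

lemma nn_integral_norm_l2:
  fixes f :: "'a::euclidean_space \<Rightarrow> 'b::euclidean_space"
  assumes "f \<in> L2 lebesgue"
  shows "(\<integral>\<^sup>+x. ennreal ((norm (f x))\<^sup>2) \<partial>lebesgue) = ennreal ((norm (to_l2 f))\<^sup>2)"
  using assms by (subst nn_integral_eq_integral) (auto simp: L2_integrable to_l2_norm norm_L2_def)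

lemma L2I_nn:
  assumes "f \<in> borel_measurable M" "(\<integral>\<^sup>+x. ennreal ((norm (f x))\<^sup>2) \<partial>M) < \<infinity>"
  shows "f \<in> L2 M"
  using assms by (intro L2I integrableI_bounded) auto

section \<open>Completeness (Riesz-Fischer)\<close>

text \<open>The indices are chosen recursively, each beyond its predecessor and beyond the Cauchy
  threshold for its own power of 1/2. The point is that the increments of the subsequence have
  summable norms.\<close>

lemma Cauchy_fast_subseq:
  fixes X :: "nat \<Rightarrow> 'a::metric_space"
  assumes "Cauchy X"
  obtains r where "strict_mono r" "\<And>k l. l \<ge> k \<Longrightarrow> dist (X (r l)) (X (r k)) < (1/2)^k"
proof -
  have "\<exists>N. \<forall>m\<ge>N. \<forall>n\<ge>N. dist (X m) (X n) < (1/2)^k" for k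
    using assms by (auto simp: Cauchy_def)
  then obtain N where N: "\<And>k m n. m \<ge> N k \<Longrightarrow> n \<ge> N k \<Longrightarrow> dist (X m) (X n) < (1/2)^k" by metis
  define r where "r = rec_nat (N 0) (\<lambda>k p. max (Suc p) (N (Suc k)))"
  have r: "r 0 = N 0" "r (Suc k) = max (Suc (r k)) (N (Suc k))" for k by (auto simp: r_def)
  have m: "strict_mono r" by (rule strict_monoI_Suc) (simp add: r)
  have g: "r k \<ge> N k" for k by (cases k) (auto simp: r)
  show ?thesis
  proof (rule that[OF m])
    fix k l :: nat assume "l \<ge> k"
    then have "r k \<le> r l" using m by (simp add: strict_mono_less_eq)
    then show "dist (X (r l)) (X (r k)) < (1/2)^k" using g[of k] by (intro N) auto
  qed
qed

text \<open>The increments along a fast subsequence have summable norms, so by monotone convergence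
  the pointwise sum of their absolute values is square integrable, hence finite almost everywhere,
  and the subsequence converges pointwise almost everywhere. Fatou's lemma turns this into
  convergence in norm, and a Cauchy sequence follows its convergent subsequence.\<close>

instance l2 :: (euclidean_space, euclidean_space) complete_space
proof
  fix X :: "nat \<Rightarrow> ('a, 'b) l2" assume C: "Cauchy X"
  obtain r where r: "strict_mono r" and fast: "\<And>k l. l \<ge> k \<Longrightarrow> dist (X (r l)) (X (r k)) < (1/2)^k"
    using Cauchy_fast_subseq[OF C] by metis
  define f where "f k = rep_l2 (X (r k))" for k
  have f: "f k \<in> L2 lebesgue" "X (r k) = to_l2 (f k)" for k by (auto simp: f_def rep_l2)
  note [measurable] = L2_measurable[OF f(1)]
  define g where "g k x = norm (f (Suc k) x - f k x)" for k x
  have g: "g k \<in> L2 lebesgue" for k unfolding g_def[abs_def] by (intro L2_norm L2_diff f)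
  note [measurable] = L2_measurable[OF g]
  have ng: "norm (to_l2 (g k)) < (1/2)^k" for k
  proof -
    have "norm (to_l2 (g k)) = dist (X (r (Suc k))) (X (r k))"
      by (simp add: f(2) dist_norm to_l2_diff f(1) L2_diff to_l2_norm g norm_L2_def) (simp add: g_def)
    then show ?thesis using fast[of k "Suc k"] by simp
  qed
  \<comment> \<open>The bound 4 is the square of the sum 2 of the geometric series of the
    norms.\<close>
  have part: "(\<integral>\<^sup>+x. ennreal ((\<Sum>k<n. g k x)\<^sup>2) \<partial>lebesgue) \<le> ennreal 4" for n
  proof -
    have "(\<integral>\<^sup>+x. ennreal ((\<Sum>k<n. g k x)\<^sup>2) \<partial>lebesgue)
      = (\<integral>\<^sup>+x. ennreal ((norm (\<Sum>k<n. g k x))\<^sup>2) \<partial>lebesgue)" by simp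
    also have "\<dots> = ennreal ((norm (\<Sum>k<n. to_l2 (g k)))\<^sup>2)"
      by (subst nn_integral_norm_l2) (auto intro: L2_sum g simp: to_l2_sum g)
    also have "\<dots> \<le> ennreal (2\<^sup>2)"
    proof (intro ennreal_leI power_mono)
      have "norm (\<Sum>k<n. to_l2 (g k)) \<le> (\<Sum>k<n. (1/2)^k)"
        using ng by (intro sum_norm_le) (auto intro: less_imp_le)
      also have "\<dots> \<le> (\<Sum>k. (1/2)^k)" by (intro sum_le_suminf) auto
      also have "\<dots> = (2::real)" by (subst suminf_geometric) auto
      finally show "norm (\<Sum>k<n. to_l2 (g k)) \<le> 2" .
    qed simp
    finally show ?thesis by simp
  qed
  have "(\<integral>\<^sup>+x. (SUP n. ennreal ((\<Sum>k<n. g k x)\<^sup>2)) \<partial>lebesgue) = 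
        (SUP n. \<integral>\<^sup>+x. ennreal ((\<Sum>k<n. g k x)\<^sup>2) \<partial>lebesgue)"
  proof (rule nn_integral_monotone_convergence_SUP)
    show "incseq (\<lambda>n x. ennreal ((\<Sum>k<n. g k x)\<^sup>2))"
      by (auto simp: incseq_def le_fun_def g_def intro!: ennreal_leI power_mono sum_mono2 sum_nonneg)
  qed measurable
  also have "\<dots> \<le> ennreal 4" by (rule SUP_least) (rule part)
  also have "\<dots> < \<infinity>" by simp
  finally have "AE x in lebesgue. (SUP n. ennreal ((\<Sum>k<n. g k x)\<^sup>2)) \<noteq> \<infinity>"
    by (intro nn_integral_PInf_AE) auto
  then have conv: "AE x in lebesgue. convergent (\<lambda>k. f k x)"
  proof eventually_elim
    fix x assume a: "(SUP n. ennreal ((\<Sum>k<n. g k x)\<^sup>2)) \<noteq> \<infinity>"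
    then obtain B where B: "B \<ge> 0" "(SUP n. ennreal ((\<Sum>k<n. g k x)\<^sup>2)) = ennreal B"
      by (cases "SUP n. ennreal ((\<Sum>k<n. g k x)\<^sup>2)") auto
    have bd: "(\<Sum>k<n. g k x) \<le> sqrt B" for n
    proof -
      have "ennreal ((\<Sum>k<n. g k x)\<^sup>2) \<le> ennreal B" unfolding B(2)[symmetric] by (rule SUP_upper) simp
      then show ?thesis using B(1) by (intro real_le_rsqrt) (simp add: ennreal_le_iff)
    qed
    have "summable (\<lambda>k. norm (f (Suc k) x - f k x))"
      using bd by (intro summableI_nonneg_bounded[of _ "sqrt B"]) (auto simp: g_def)
    then have "summable (\<lambda>k. f (Suc k) x - f k x)" by (rule summable_norm_cancel)
    then have "convergent (\<lambda>n. \<Sum>k<n. f (Suc k) x - f k x)" by (simp add: summable_iff_convergent)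
    then have "convergent (\<lambda>n. f n x - f 0 x)" unfolding sum_lessThan_telescope[of "\<lambda>k. f k x"] .
    then show "convergent (\<lambda>k. f k x)" by (simp add: convergent_diff_const_right_iff)
  qed
  \<comment> \<open>\<open>lim\<close> has some value at the points of divergence too; they form a
    null set, and \<open>F\<close> is measurable as it stands.\<close>
  define F where "F x = lim (\<lambda>k. f k x)" for x
  have F[measurable]: "F \<in> borel_measurable lebesgue" unfolding F_def[abs_def] by measurable
  have lim: "AE x in lebesgue. (\<lambda>k. f k x) \<longlonglongrightarrow> F x"
    using conv by eventually_elim (simp add: F_def convergent_LIMSEQ_iff)
  \<comment> \<open>Fatou's lemma in the index \<open>l\<close>, with \<open>k\<close>
    fixed.\<close>
  have bound: "(\<integral>\<^sup>+x. ennreal ((norm (F x - f k x))\<^sup>2) \<partial>lebesgue) \<le> ennreal (((1/2)^k)\<^sup>2)" for k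
  proof -
    have "(\<integral>\<^sup>+x. ennreal ((norm (F x - f k x))\<^sup>2) \<partial>lebesgue)
       = (\<integral>\<^sup>+x. liminf (\<lambda>l. ennreal ((norm (f l x - f k x))\<^sup>2)) \<partial>lebesgue)"
    proof (rule nn_integral_cong_AE)
      show "AE x in lebesgue. ennreal ((norm (F x - f k x))\<^sup>2)
        = liminf (\<lambda>l. ennreal ((norm (f l x - f k x))\<^sup>2))"
        using lim
      proof eventually_elim
        fix x assume "(\<lambda>k. f k x) \<longlonglongrightarrow> F x"
        then have "(\<lambda>l. ennreal ((norm (f l x - f k x))\<^sup>2)) \<longlonglongrightarrow> ennreal ((norm (F x - f k x))\<^sup>2)"
          by (intro tendsto_ennrealI tendsto_intros)
        then show "ennreal ((norm (F x - f k x))\<^sup>2) = liminf (\<lambda>l. ennreal ((norm (f l x - f k x))\<^sup>2))"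
          by (intro lim_imp_Liminf[symmetric]) auto
      qed
    qed
    also have "\<dots> \<le> liminf (\<lambda>l. \<integral>\<^sup>+x. ennreal ((norm (f l x - f k x))\<^sup>2) \<partial>lebesgue)"
      by (rule nn_integral_liminf) measurable
    also have "\<dots> \<le> ennreal (((1/2)^k)\<^sup>2)"
    proof (rule Liminf_le)
      show "\<forall>\<^sub>F l in sequentially. (\<integral>\<^sup>+x. ennreal ((norm (f l x - f k x))\<^sup>2) \<partial>lebesgue) \<le> ennreal (((1/2)^k)\<^sup>2)"
        using eventually_ge_at_top[of k]
      proof eventually_elim
        fix l assume "k \<le> l"
        then have "norm (to_l2 (\<lambda>x. f l x - f k x)) \<le> (1/2)^k"
          using fast[of k l] by (simp add: f(2) dist_norm to_l2_diff f(1))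
        then show "(\<integral>\<^sup>+x. ennreal ((norm (f l x - f k x))\<^sup>2) \<partial>lebesgue) \<le> ennreal (((1/2)^k)\<^sup>2)"
          by (subst nn_integral_norm_l2) (auto intro!: L2_diff f ennreal_leI power_mono)
      qed
    qed simp
    finally show ?thesis .
  qed
  have D: "(\<lambda>x. F x - f k x) \<in> L2 lebesgue" for k
    using bound[of k] by (intro L2I_nn order.strict_trans1[OF bound[of k]]) auto
  have FL: "F \<in> L2 lebesgue" using L2_add[OF D[of 0] f(1)[of 0]] by simp
  have dist_le: "dist (X (r k)) (to_l2 F) \<le> (1/2)^k" for k
  proof -
    have eq: "to_l2 F - X (r k) = to_l2 (\<lambda>x. F x - f k x)"
      unfolding f(2) by (rule to_l2_diff[OF FL f(1)])
    have "ennreal ((norm (to_l2 F - X (r k)))\<^sup>2) \<le> ennreal (((1/2)^k)\<^sup>2)"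
      unfolding eq nn_integral_norm_l2[OF D, symmetric] by (rule bound)
    then have "(norm (to_l2 F - X (r k)))\<^sup>2 \<le> ((1/2)^k)\<^sup>2"
      by (rule ennreal_le_iff[THEN iffD1, rotated]) (rule zero_le_power2)
    then have "norm (to_l2 F - X (r k)) \<le> (1/2)^k" by (rule power2_le_imp_le) simp
    then show ?thesis unfolding dist_norm norm_minus_commute[of "X (r k)"] .
  qed
  have "(\<lambda>k. dist (X (r k)) (to_l2 F)) \<longlonglongrightarrow> 0"
  proof (rule Lim_null_comparison)
    show "\<forall>\<^sub>F k in sequentially. norm (dist (X (r k)) (to_l2 F)) \<le> (1/2)^k"
      using dist_le by (intro always_eventually) simp
    show "(\<lambda>k. (1/2)^k) \<longlonglongrightarrow> (0::real)" by (rule LIMSEQ_power_zero) simp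
  qed
  then have "(\<lambda>k. X (r k)) \<longlonglongrightarrow> to_l2 F" by (rule tendsto_dist_iff[THEN iffD2])
  then have "(X \<circ> r) \<longlonglongrightarrow> to_l2 F" by (simp add: o_def)
  then have "X \<longlonglongrightarrow> to_l2 F" by (rule Cauchy_converges_subseq[OF C r])
  then show "convergent X" by (rule convergentI)
qed

section \<open>Variational problems in a product of Hilbert spaces\<close>

text \<open>Pairs stand for a function and its gradient: \<open>fst v\<close> is the function and \<open>snd v\<close> the gradient.\<close>

lemma linear_term_zero:
  fixes a b :: real
  assumes "\<And>t. 0 \<le> a * t\<^sup>2 + b * t"
  shows "b = 0"
proof (rule ccontr)
  assume "b \<noteq> 0"
  define s where "s = \<bar>a\<bar> + 1"
  have s: "s > 0" "a < s" by (auto simp: s_def)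
  have "0 \<le> a * (- b / s)\<^sup>2 + b * (- b / s)" by (rule assms)
  then have "0 \<le> s\<^sup>2 * (a * (- b / s)\<^sup>2 + b * (- b / s))" using s by (intro mult_nonneg_nonneg) auto
  also have "\<dots> = b\<^sup>2 * (a - s)" using s by (simp add: field_simps power2_eq_square)
  also have "\<dots> < 0" using \<open>b \<noteq> 0\<close> s by (intro mult_pos_neg) auto
  finally show False by simp
qed

lemma Cauchy_squareI:
  fixes x :: "nat \<Rightarrow> 'a::real_normed_vector"
  assumes "\<And>i j. (norm (x i - x j))\<^sup>2 \<le> e i + e j" "e \<longlonglongrightarrow> (0::real)"
  shows "Cauchy x"
proof (rule CauchyI)
  fix r :: real assume "r > 0"
  then have "\<forall>\<^sub>F n in sequentially. e n < r\<^sup>2 / 2"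
    by (intro order_tendstoD(2)[OF assms(2)]) simp
  then obtain M where M: "\<And>n. n \<ge> M \<Longrightarrow> e n < r\<^sup>2 / 2" by (auto simp: eventually_sequentially)
  show "\<exists>M. \<forall>m\<ge>M. \<forall>n\<ge>M. norm (x m - x n) < r"
  proof (intro exI[of _ M] allI impI)
    fix m n assume "M \<le> m" "M \<le> n"
    then have "(norm (x m - x n))\<^sup>2 < r\<^sup>2" using assms(1)[of m n] M[of m] M[of n] by simp
    then show "norm (x m - x n) < r" by (rule power_less_imp_less_base) (use \<open>r > 0\<close> in simp)
  qed
qed

lemma parallelogram:
  fixes x y :: "'a::real_inner"
  shows "(norm (x - y))\<^sup>2 = 2 * (norm x)\<^sup>2 + 2 * (norm y)\<^sup>2 - (norm (x + y))\<^sup>2"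
  by (simp add: power2_norm_eq_inner inner_diff_left inner_diff_right inner_add_left inner_add_right inner_commute)

lemma norm_prod_le_snd:
  assumes "norm (fst v) \<le> C * norm (snd v)"
  shows "norm v \<le> (C + 1) * norm (snd v)"
  using norm_Pair_le[of "fst v" "snd v"] assms by (simp add: algebra_simps)

text \<open>The Poincare inequality makes the norm of the second component equivalent to the full
  norm on \<open>V\<close>, so that only gradients need to be estimated.\<close>

lemma Cauchy_from_snd:
  fixes x :: "nat \<Rightarrow> 'a::real_normed_vector \<times> 'b::real_normed_vector"
  assumes V: "subspace V" "\<And>v. v \<in> V \<Longrightarrow> norm (fst v) \<le> C * norm (snd v)" "0 \<le> C"
    and x: "\<And>k. x k \<in> V" "Cauchy (\<lambda>k. snd (x k))"
  shows "Cauchy x"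
proof (rule CauchyI)
  fix e :: real assume "e > 0"
  then have "e / (C + 1) > 0" using V(3) by simp
  then obtain M where M: "\<And>m n. m \<ge> M \<Longrightarrow> n \<ge> M \<Longrightarrow> norm (snd (x m) - snd (x n)) < e / (C + 1)"
    using CauchyD[OF x(2)] by metis
  show "\<exists>M. \<forall>m\<ge>M. \<forall>n\<ge>M. norm (x m - x n) < e"
  proof (intro exI[of _ M] allI impI)
    fix m n assume "M \<le> m" "M \<le> n"
    then have "norm (snd (x m - x n)) < e / (C + 1)" using M by simp
    moreover have "norm (x m - x n) \<le> (C + 1) * norm (snd (x m - x n))"
      by (intro norm_prod_le_snd V subspace_diff x)
    ultimately show "norm (x m - x n) < e" using V(3) by (simp add: field_simps)
  qed
qed

lemma Inf_approx:
  fixes A :: "real set"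
  assumes "A \<noteq> {}" "bdd_below A" "0 < e"
  shows "\<exists>a\<in>A. a < Inf A + e"
  using cInf_less_iff[OF assms(1,2), of "Inf A + e"] assms(3) by auto

text \<open>The explicit factor \<open>c\<close> explains the products
  \<open>1 * inverse (real (Suc k))\<close> in later limits, which are written so as to match this
  form.\<close>

lemma inverse_Suc_LIMSEQ: "(\<lambda>k. c * inverse (real (Suc k))) \<longlonglongrightarrow> 0"
  by (intro tendsto_mult_right_zero LIMSEQ_inverse_real_of_nat)

text \<open>The form \<open>snd v \<bullet> snd z\<close> is degenerate on the product space and
  definite only on \<open>V\<close>, by the Poincare inequality. The solution minimises the energy
  \<open>J\<close>: the bound on \<open>l\<close> keeps \<open>J\<close> above
  \<open>- K\<^sup>2 / 2\<close>, the parallelogram law makes the gradients of a minimising sequence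
  Cauchy, and the vanishing first variation is the asserted equation.\<close>

lemma riesz_snd:
  fixes V :: "('a::{real_inner,complete_space} \<times> 'b::{real_inner,complete_space}) set"
    and l :: "'a \<times> 'b \<Rightarrow> real"
  assumes V: "subspace V" "closed V"
    and P: "\<And>v. v \<in> V \<Longrightarrow> norm (fst v) \<le> C * norm (snd v)" "0 \<le> C"
    and l: "linear l" "\<And>v. v \<in> V \<Longrightarrow> \<bar>l v\<bar> \<le> K * norm (snd v)"
  shows "\<exists>v\<in>V. \<forall>z\<in>V. snd v \<bullet> snd z = l z"
proof -
  define J where "J v = (norm (snd v))\<^sup>2 / 2 - l v" for v
  have lin: "l (v + w) = l v + l w" "l (c *\<^sub>R v) = c * l v" "l (v - w) = l v - l w" for v w c
    using l(1) by (auto simp: linear_add linear_scale linear_diff)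
  have Jb: "- K\<^sup>2 / 2 \<le> J v" if "v \<in> V" for v
  proof -
    have "2 * l v \<le> 2 * (K * norm (snd v))" using l(2)[OF that] by auto
    also have "\<dots> \<le> K\<^sup>2 + (norm (snd v))\<^sup>2" using sum_squares_bound[of K "norm (snd v)"] by simp
    finally show ?thesis by (simp add: J_def field_simps)
  qed
  define m where "m = Inf (J ` V)"
  have bdd: "bdd_below (J ` V)" using Jb by (intro bdd_belowI[of _ "- K\<^sup>2 / 2"]) auto
  have m: "m \<le> J v" if "v \<in> V" for v unfolding m_def using bdd that by (intro cInf_lower) auto
  have "\<exists>v\<in>V. J v < m + inverse (real (Suc k))" for k
    using Inf_approx[OF _ bdd, of "inverse (real (Suc k))"] subspace_0[OF V(1)] unfolding m_def by auto
  then obtain x where x: "\<And>k. x k \<in> V" "\<And>k. J (x k) < m + inverse (real (Suc k))" by metis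
  have "Cauchy (\<lambda>k. snd (x k))"
  proof (rule Cauchy_squareI[OF _ inverse_Suc_LIMSEQ[of 4]])
    fix i j
    \<comment> \<open>The midpoint has energy at least \<open>m\<close>, while both end points
      exceed \<open>m\<close> by less than the reciprocals of their indices. The deficit 1/8 of the
      squared distance is thus at most half the sum of the two reciprocals, whence the factor
      4.\<close>
    have "J ((1/2) *\<^sub>R (x i + x j)) = (J (x i) + J (x j)) / 2 - (norm (snd (x i) - snd (x j)))\<^sup>2 / 8"
      unfolding J_def lin parallelogram[of "snd (x i)"] snd_scaleR snd_add norm_scaleR
      by (simp add: power_mult_distrib field_simps)
    moreover have "m \<le> J ((1/2) *\<^sub>R (x i + x j))"
      by (intro m subspace_scale subspace_add V x)
    ultimately show "(norm (snd (x i) - snd (x j)))\<^sup>2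
        \<le> 4 * inverse (real (Suc i)) + 4 * inverse (real (Suc j))"
      using x(2)[of i] x(2)[of j] unfolding atomize_conj by argo
  qed
  from Cauchy_from_snd[where x = x and V = V and C = C, OF V(1) _ P(2) x(1) this] P(1)
  have "Cauchy x" by blast
  then obtain v where v: "x \<longlonglongrightarrow> v" by (metis Cauchy_convergent convergent_def)
  have vV: "v \<in> V" using closed_sequentially[OF V(2) _ v] x(1) by blast
  have "(\<lambda>k. l (x k) - l v) \<longlonglongrightarrow> 0"
  proof (rule Lim_null_comparison)
    show "\<forall>\<^sub>F k in sequentially. norm (l (x k) - l v) \<le> K * norm (snd (x k) - snd v)"
      using l(2)[OF subspace_diff[OF V(1) x(1) vV]] by (intro always_eventually) (simp add: lin)
    have "(\<lambda>k. K * norm (snd (x k) - snd v)) \<longlonglongrightarrow> K * norm (snd v - snd v)"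
      by (intro tendsto_intros v)
    then show "(\<lambda>k. K * norm (snd (x k) - snd v)) \<longlonglongrightarrow> 0" by simp
  qed
  then have "(\<lambda>k. l (x k)) \<longlonglongrightarrow> l v" by (rule LIM_zero_cancel)
  then have "(\<lambda>k. J (x k)) \<longlonglongrightarrow> J v" unfolding J_def by (intro tendsto_intros v) auto
  moreover have "(\<lambda>k. m + 1 * inverse (real (Suc k))) \<longlonglongrightarrow> m + 0"
    by (intro tendsto_add inverse_Suc_LIMSEQ tendsto_const)
  ultimately have "J v \<le> m"
    using x(2) by (intro LIMSEQ_le[of "\<lambda>k. J (x k)" _ "\<lambda>k. m + 1 * inverse (real (Suc k))"]) (auto intro: less_imp_le)
  have "snd v \<bullet> snd z = l z" if z: "z \<in> V" for z
  proof -
    \<comment> \<open>The polynomial is \<open>J (v + t *\<^sub>R z) - J v\<close>.\<close>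
    have "0 \<le> ((norm (snd z))\<^sup>2 / 2) * t\<^sup>2 + (snd v \<bullet> snd z - l z) * t" for t
    proof -
      have "J v \<le> J (v + t *\<^sub>R z)"
        using \<open>J v \<le> m\<close> by (rule order_trans) (intro m subspace_add subspace_scale V vV z)
      then show ?thesis
        unfolding J_def lin power2_norm_eq_inner
        by (simp add: inner_add_left inner_add_right inner_commute power2_eq_square algebra_simps)
    qed
    then have "snd v \<bullet> snd z - l z = 0" by (rule linear_term_zero)
    then show ?thesis by simp
  qed
  then show ?thesis using vV by blast
qed

text \<open>\<open>\<mu>\<close> is the infimum of the Rayleigh quotient. Compactness is assumed for
  the function parts only; the gradients of a minimising sequence then converge in norm by
  \<open>est\<close>, so the minimum is attained without any weak convergence. The inequality
  \<open>\<mu>V\<close> holds on all of \<open>V\<close> and is an equality at the minimiser, and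
  its first variation there is the eigenvalue equation.\<close>

lemma rayleigh_minimizer:
  fixes V :: "('a::{real_inner,complete_space} \<times> 'b::{real_inner,complete_space}) set"
  assumes V: "subspace V" "closed V"
    and compact: "\<And>x M. (\<And>k::nat. x k \<in> V) \<Longrightarrow> (\<And>k. norm (x k) \<le> M) \<Longrightarrow>
       \<exists>r. strict_mono r \<and> Cauchy (\<lambda>k. fst (x (r k)))"
    and w: "w \<in> V" "fst w \<noteq> 0"
  shows "\<exists>\<mu>. \<exists>u\<in>V. fst u \<noteq> 0 \<and> 0 \<le> \<mu> \<and> (\<forall>v\<in>V. snd u \<bullet> snd v = \<mu> * (fst u \<bullet> fst v)) \<and>
     (\<forall>v\<in>V. \<mu> * (norm (fst v))\<^sup>2 \<le> (norm (snd v))\<^sup>2)"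
proof -
  define S where "S = {v \<in> V. norm (fst v) = 1}"
  define \<mu> where "\<mu> = Inf ((\<lambda>v. (norm (snd v))\<^sup>2) ` S)"
  have nrm: "(1 / norm (fst v)) *\<^sub>R v \<in> S" if "v \<in> V" "fst v \<noteq> 0" for v
    using that by (auto simp: S_def intro: subspace_scale[OF V(1)])
  have ne: "(\<lambda>v. (norm (snd v))\<^sup>2) ` S \<noteq> {}" using nrm[OF w] by auto
  have bdd: "bdd_below ((\<lambda>v. (norm (snd v))\<^sup>2) ` S)" by (rule bdd_belowI[of _ 0]) auto
  have \<mu>0: "0 \<le> \<mu>" unfolding \<mu>_def by (rule cInf_greatest[OF ne]) auto
  have \<mu>S: "\<mu> \<le> (norm (snd v))\<^sup>2" if "v \<in> S" for v
    unfolding \<mu>_def using bdd that by (intro cInf_lower) auto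
  have \<mu>V: "\<mu> * (norm (fst v))\<^sup>2 \<le> (norm (snd v))\<^sup>2" if "v \<in> V" for v
  proof (cases "fst v = 0")
    case False
    from \<mu>S[OF nrm[OF that False]] False show ?thesis by (simp add: field_simps power2_eq_square)
  qed simp
  have "\<exists>v\<in>S. (norm (snd v))\<^sup>2 < \<mu> + inverse (real (Suc k))" for k
    using Inf_approx[OF ne bdd, of "inverse (real (Suc k))"] unfolding \<mu>_def by auto
  then obtain y where y: "\<And>k. y k \<in> S" "\<And>k. (norm (snd (y k)))\<^sup>2 < \<mu> + inverse (real (Suc k))" by metis
  have yV: "y k \<in> V" "norm (fst (y k)) = 1" for k using y(1)[of k] by (auto simp: S_def)
  have "norm (y k) \<le> 1 + sqrt (\<mu> + 1)" for k
  proof -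
    have "inverse (real (Suc k)) \<le> 1" by (simp add: divide_simps)
    then have "(norm (snd (y k)))\<^sup>2 \<le> \<mu> + 1" using y(2)[of k] by linarith
    then have "norm (snd (y k)) \<le> sqrt (\<mu> + 1)" by (rule real_le_rsqrt)
    then show ?thesis using norm_Pair_le[of "fst (y k)" "snd (y k)"] yV(2)[of k] by simp
  qed
  from compact[of y, OF yV(1) this] obtain r where r: "strict_mono r" "Cauchy (\<lambda>k. fst (y (r k)))" by auto
  define x where "x k = y (r k)" for k
  have xV: "x k \<in> V" "norm (fst (x k)) = 1" for k by (auto simp: x_def yV)
  have xs: "(norm (snd (x k)))\<^sup>2 < \<mu> + inverse (real (Suc k))" for k
  proof -
    have "inverse (real (Suc (r k))) \<le> inverse (real (Suc k))"
      using seq_suble[OF r(1), of k] by (intro le_imp_inverse_le) auto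
    then show ?thesis using y(2)[of "r k"] unfolding x_def by linarith
  qed
  have Cf: "Cauchy (\<lambda>k. fst (x k))" using r(2) by (simp add: x_def)
  \<comment> \<open>The parallelogram law is used in both components. The Rayleigh inequality for
    \<open>x i + x j\<close> bounds the squared gradient of the sum below by \<open>\<mu>\<close>
    times 4 minus the squared distance of the function parts, and the terms \<open>4 * \<mu>\<close>
    cancel.\<close>
  have est: "(norm (snd (x i) - snd (x j)))\<^sup>2
      \<le> 2 * inverse (real (Suc i)) + 2 * inverse (real (Suc j)) + \<mu> * (norm (fst (x i) - fst (x j)))\<^sup>2" for i j
  proof -
    have "\<mu> * (norm (fst (x i) + fst (x j)))\<^sup>2 \<le> (norm (snd (x i) + snd (x j)))\<^sup>2"
      using \<mu>V[OF subspace_add[OF V(1) xV(1)[of i] xV(1)[of j]]] by simp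
    moreover have "(norm (fst (x i) + fst (x j)))\<^sup>2 = 4 - (norm (fst (x i) - fst (x j)))\<^sup>2"
      unfolding parallelogram[of "fst (x i)"] by (simp add: xV)
    ultimately have "\<mu> * (4 - (norm (fst (x i) - fst (x j)))\<^sup>2) \<le> (norm (snd (x i) + snd (x j)))\<^sup>2" by simp
    then show ?thesis
      unfolding parallelogram[of "snd (x i)"] using xs[of i] xs[of j] by (simp add: algebra_simps)
  qed
  have "Cauchy (\<lambda>k. snd (x k))"
  proof (rule CauchyI)
    fix e :: real assume e: "e > 0"
    \<comment> \<open>Half of \<open>e\<^sup>2\<close> is reserved for the term with
      \<open>\<mu>\<close> and a quarter for each reciprocal; \<open>\<mu> + 1\<close> instead of
      \<open>\<mu>\<close> covers \<open>\<mu> = 0\<close>.\<close>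
    define d where "d = e / sqrt (2 * (\<mu> + 1))"
    have d: "d > 0" "\<mu> * d\<^sup>2 \<le> e\<^sup>2 / 2" using e \<mu>0 by (auto simp: d_def power_divide field_simps)
    obtain M1 where M1: "\<And>m n. m \<ge> M1 \<Longrightarrow> n \<ge> M1 \<Longrightarrow> norm (fst (x m) - fst (x n)) < d"
      using CauchyD[OF Cf d(1)] by metis
    have "\<forall>\<^sub>F n in sequentially. 2 * inverse (real (Suc n)) < e\<^sup>2 / 4"
      using e by (intro order_tendstoD(2)[OF inverse_Suc_LIMSEQ]) simp
    then obtain M2 where M2: "\<And>n. n \<ge> M2 \<Longrightarrow> 2 * inverse (real (Suc n)) < e\<^sup>2 / 4"
      by (auto simp: eventually_sequentially)
    show "\<exists>M. \<forall>m\<ge>M. \<forall>n\<ge>M. norm (snd (x m) - snd (x n)) < e"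
    proof (intro exI[of _ "max M1 M2"] allI impI)
      fix m n assume mn: "max M1 M2 \<le> m" "max M1 M2 \<le> n"
      have "\<mu> * (norm (fst (x m) - fst (x n)))\<^sup>2 \<le> \<mu> * d\<^sup>2"
        using M1[of m n] mn \<mu>0 by (intro mult_left_mono power_mono) auto
      then have "(norm (snd (x m) - snd (x n)))\<^sup>2 < e\<^sup>2"
        using est[of m n] M2[of m] M2[of n] mn d(2) by simp
      then show "norm (snd (x m) - snd (x n)) < e" by (rule power_less_imp_less_base) (use e in simp)
    qed
  qed
  then obtain g where g: "(\<lambda>k. snd (x k)) \<longlonglongrightarrow> g" by (metis Cauchy_convergent convergent_def)
  from Cf obtain f where f: "(\<lambda>k. fst (x k)) \<longlonglongrightarrow> f" by (metis Cauchy_convergent convergent_def)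
  have "x \<longlonglongrightarrow> (f, g)" using tendsto_Pair[OF f g] by simp
  then have uV: "(f, g) \<in> V" using closed_sequentially[OF V(2)] xV(1) by blast
  have "(\<lambda>k. norm (fst (x k))) \<longlonglongrightarrow> norm f" by (intro tendsto_intros f)
  then have nf: "norm f = 1" using xV(2) by (simp add: LIMSEQ_const_iff)
  have "(\<lambda>k. (norm (snd (x k)))\<^sup>2) \<longlonglongrightarrow> (norm g)\<^sup>2" by (intro tendsto_intros g)
  moreover have "(\<lambda>k. \<mu> + 1 * inverse (real (Suc k))) \<longlonglongrightarrow> \<mu> + 0"
    by (intro tendsto_add inverse_Suc_LIMSEQ tendsto_const)
  ultimately have ng: "(norm g)\<^sup>2 \<le> \<mu>"
    using xs by (intro LIMSEQ_le[of "\<lambda>k. (norm (snd (x k)))\<^sup>2" _ "\<lambda>k. \<mu> + 1 * inverse (real (Suc k))"])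
      (auto intro: less_imp_le)
  have "g \<bullet> snd v = \<mu> * (f \<bullet> fst v)" if v: "v \<in> V" for v
  proof -
    \<comment> \<open>This is the Rayleigh inequality at \<open>(f, g) + t *\<^sub>R v\<close>,
      whose constant term is removed by \<open>norm f = 1\<close> and
      \<open>(norm g)\<^sup>2 \<le> \<mu>\<close>.\<close>
    have "0 \<le> ((norm (snd v))\<^sup>2 - \<mu> * (norm (fst v))\<^sup>2) * t\<^sup>2 + (2 * (g \<bullet> snd v - \<mu> * (f \<bullet> fst v))) * t" for t
    proof -
      have "\<mu> * (norm (f + t *\<^sub>R fst v))\<^sup>2 \<le> (norm (g + t *\<^sub>R snd v))\<^sup>2"
        using \<mu>V[OF subspace_add[OF V(1) uV subspace_scale[OF V(1) v, of t]]] by simp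
      moreover have "f \<bullet> f = 1" using nf by (simp add: norm_eq_1)
      moreover have "g \<bullet> g \<le> \<mu>" using ng by (simp add: power2_norm_eq_inner)
      ultimately show ?thesis
        unfolding power2_norm_eq_inner
        by (simp add: inner_add_left inner_add_right inner_commute power2_eq_square algebra_simps)
    qed
    then have "2 * (g \<bullet> snd v - \<mu> * (f \<bullet> fst v)) = 0" by (rule linear_term_zero)
    then show ?thesis by simp
  qed
  then show ?thesis using uV nf \<mu>0 \<mu>V by (intro exI[of _ \<mu>] bexI[of _ "(f, g)"]) auto
qed

section \<open>The abstract semilinear problem\<close>

text \<open>\<open>p\<close> carries the boundary values and need not lie in \<open>V\<close>, so
  the unknown is the correction \<open>v\<close>. \<open>\<Phi> v\<close> solves the linear problem
  with the nonlinearity frozen at \<open>p + v\<close>. It contracts the distance of gradients, not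
  the product distance; the fixed point theorem is therefore applied on the image of
  \<open>V\<close> under \<open>snd\<close>, on which \<open>snd\<close> has an inverse by the
  Poincare inequality and which is complete by \<open>Cauchy_from_snd\<close>.\<close>

lemma semilinear_solution:
  fixes V :: "('a::{real_inner,complete_space} \<times> 'b::{real_inner,complete_space}) set"
    and N :: "'a \<times> 'b \<Rightarrow> 'a"
  assumes V: "subspace V" "closed V"
    and P: "\<And>v. v \<in> V \<Longrightarrow> norm (fst v) \<le> C * norm (snd v)" "0 \<le> C"
    and N: "\<And>p q. norm (N p - N q) \<le> C1 * norm (fst p - fst q) + C2 * norm (snd p - snd q)"
    and c: "0 \<le> C1" "0 \<le> C2" "C1 * C\<^sup>2 + C2 * C < 1"
  shows "\<exists>!v. v \<in> V \<and> (\<forall>z\<in>V. snd (p + v) \<bullet> snd z + N (p + v) \<bullet> fst z = h \<bullet> fst z)"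
proof -
  let ?q = "C1 * C\<^sup>2 + C2 * C"
  have inj: "v = w" if "v \<in> V" "w \<in> V" "snd v = snd w" for v w
    using P(1)[OF subspace_diff[OF V(1) that(1,2)]] that(3) by (simp add: prod_eq_iff)
  have "\<exists>v'\<in>V. \<forall>z\<in>V. snd v' \<bullet> snd z = (h - N (p + v)) \<bullet> fst z - snd p \<bullet> snd z" for v
  proof (rule riesz_snd[OF V P])
    show "linear (\<lambda>z. (h - N (p + v)) \<bullet> fst z - snd p \<bullet> snd z)"
      by (rule linearI) (auto simp: inner_add_right algebra_simps)
    fix z assume "z \<in> V"
    have "\<bar>(h - N (p + v)) \<bullet> fst z\<bar> \<le> norm (h - N (p + v)) * (C * norm (snd z))"
      using P(1)[OF \<open>z \<in> V\<close>] by (intro order_trans[OF Cauchy_Schwarz_ineq2] mult_left_mono) auto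
    then show "\<bar>(h - N (p + v)) \<bullet> fst z - snd p \<bullet> snd z\<bar> \<le> (norm (h - N (p + v)) * C + norm (snd p)) * norm (snd z)"
      using Cauchy_Schwarz_ineq2[of "snd p" "snd z"] by (simp add: algebra_simps)
  qed
  then obtain \<Phi> where \<Phi>V: "\<And>v. \<Phi> v \<in> V"
    and \<Phi>: "\<And>v z. z \<in> V \<Longrightarrow> snd (\<Phi> v) \<bullet> snd z = (h - N (p + v)) \<bullet> fst z - snd p \<bullet> snd z" by metis
  have fixpoint: "(\<forall>z\<in>V. snd (p + v) \<bullet> snd z + N (p + v) \<bullet> fst z = h \<bullet> fst z) \<longleftrightarrow> \<Phi> v = v" if v: "v \<in> V" for v
  proof
    assume a: "\<forall>z\<in>V. snd (p + v) \<bullet> snd z + N (p + v) \<bullet> fst z = h \<bullet> fst z"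
    \<comment> \<open>Testing with \<open>\<Phi> v - v\<close> leaves the squared gradient norm of
      this difference.\<close>
    have "(snd (\<Phi> v) - snd v) \<bullet> snd (\<Phi> v - v) = 0"
      using \<Phi>[of "\<Phi> v - v" v] a subspace_diff[OF V(1) \<Phi>V v, of v]
      by (auto simp: inner_diff_left inner_add_left dest!: bspec)
    then show "\<Phi> v = v" by (intro inj \<Phi>V v) simp
  next
    assume "\<Phi> v = v"
    then show "\<forall>z\<in>V. snd (p + v) \<bullet> snd z + N (p + v) \<bullet> fst z = h \<bullet> fst z"
      using \<Phi>[of _ v] by (auto simp: inner_diff_left inner_add_left)
  qed
  have contr: "norm (snd (\<Phi> v) - snd (\<Phi> w)) \<le> ?q * norm (snd v - snd w)" if v: "v \<in> V" and w: "w \<in> V" for v w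
  proof -
    define d where "d = \<Phi> v - \<Phi> w"
    have d: "d \<in> V" unfolding d_def by (intro subspace_diff V \<Phi>V)
    \<comment> \<open>Subtracting the equations for \<open>\<Phi> v\<close> and
      \<open>\<Phi> w\<close>, tested with \<open>d\<close>, cancels \<open>h\<close> and
      \<open>snd p\<close>.\<close>
    have "(norm (snd d))\<^sup>2 = - ((N (p + v) - N (p + w)) \<bullet> fst d)"
      using \<Phi>[OF d, of v] \<Phi>[OF d, of w] unfolding power2_norm_eq_inner
      by (simp add: d_def inner_diff_left)
    also have "\<dots> \<le> norm (N (p + v) - N (p + w)) * norm (fst d)"
      using Cauchy_Schwarz_ineq2[of "N (p + v) - N (p + w)" "fst d"] by linarith
    also have "\<dots> \<le> (C1 * norm (fst (v - w)) + C2 * norm (snd (v - w))) * (C * norm (snd d))"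
      using N[of "p + v" "p + w"] P(1)[OF d] c by (intro mult_mono) auto
    also have "\<dots> \<le> (C1 * (C * norm (snd (v - w))) + C2 * norm (snd (v - w))) * (C * norm (snd d))"
      using P(1)[OF subspace_diff[OF V(1) v w]] c P(2) by (intro mult_right_mono add_right_mono mult_left_mono) auto
    also have "\<dots> = (?q * norm (snd v - snd w)) * norm (snd d)"
      by (simp add: algebra_simps power2_eq_square)
    finally have "norm (snd d) * norm (snd d) \<le> (?q * norm (snd v - snd w)) * norm (snd d)"
      by (simp add: power2_eq_square)
    then have "norm (snd d) \<le> ?q * norm (snd v - snd w)"
      using c P(2) by (cases "norm (snd d) = 0") auto
    then show ?thesis by (simp add: d_def)
  qed
  define F where "F = (\<lambda>g. snd (\<Phi> (inv_into V snd g)))"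
  have inv: "inv_into V snd (snd v) = v" if "v \<in> V" for v
    using that inj by (intro inv_into_f_f) (auto simp: inj_on_def)
  have "complete (snd ` V)"
    unfolding complete_def
  proof (intro allI impI, elim conjE)
    fix s assume s: "\<forall>n::nat. s n \<in> snd ` V" and C: "Cauchy s"
    define x where "x n = inv_into V snd (s n)" for n
    have x: "x n \<in> V" "snd (x n) = s n" for n
      using s by (auto simp: x_def inv_into_into f_inv_into_f)
    have "Cauchy (\<lambda>k. snd (x k))" using C by (simp add: x)
    from Cauchy_from_snd[where x = x and V = V and C = C, OF V(1) _ P(2) x(1) this] P(1)
    have "Cauchy x" by blast
    then obtain v where v: "x \<longlonglongrightarrow> v" by (metis Cauchy_convergent convergent_def)
    then have "v \<in> V" using closed_sequentially[OF V(2)] x(1) by blast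
    moreover have "s \<longlonglongrightarrow> snd v" using tendsto_snd[OF v] by (simp add: x)
    ultimately show "\<exists>l\<in>snd ` V. s \<longlonglongrightarrow> l" by auto
  qed
  moreover have "snd ` V \<noteq> {}" using subspace_0[OF V(1)] by auto
  ultimately have "\<exists>!g\<in>snd ` V. F g = g"
  proof (rule Banach_fix)
    show "F ` snd ` V \<subseteq> snd ` V" by (auto simp: F_def intro!: imageI \<Phi>V)
    show "dist (F a) (F b) \<le> ?q * dist a b" if "a \<in> snd ` V" "b \<in> snd ` V" for a b
    proof -
      obtain v w where "v \<in> V" "a = snd v" "w \<in> V" "b = snd w" using \<open>a \<in> snd ` V\<close> \<open>b \<in> snd ` V\<close> by blast
      then show ?thesis using contr[of v w] by (simp add: F_def inv dist_norm)
    qed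
  qed (use c P(2) in auto)
  then obtain g where g: "g \<in> snd ` V" "F g = g" and uniq: "\<And>g'. g' \<in> snd ` V \<Longrightarrow> F g' = g' \<Longrightarrow> g' = g" by metis
  obtain v where v: "v \<in> V" "g = snd v" using g by auto
  have "\<Phi> v = v" using g(2) v by (intro inj \<Phi>V v) (simp add: F_def inv)
  have unique: "w = v" if "w \<in> V" "\<Phi> w = w" for w
    using that uniq[of "snd w"] v by (intro inj) (auto simp: F_def inv)
  show ?thesis
  proof (rule ex1I[of _ v])
    show "v \<in> V \<and> (\<forall>z\<in>V. snd (p + v) \<bullet> snd z + N (p + v) \<bullet> fst z = h \<bullet> fst z)"
      unfolding fixpoint[OF v(1)] using v(1) \<open>\<Phi> v = v\<close> by (rule conjI)
  next
    fix w assume w: "w \<in> V \<and> (\<forall>z\<in>V. snd (p + w) \<bullet> snd z + N (p + w) \<bullet> fst z = h \<bullet> fst z)"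
    show "w = v"
      by (rule unique[OF conjunct1[OF w]]) (rule fixpoint[OF conjunct1[OF w], THEN iffD1, OF conjunct2[OF w]])
  qed
qed

section \<open>Test functions and the fundamental lemma\<close>

lemma partial_eq: "(f has_derivative f') (at x) \<Longrightarrow> partial i f x = f' (axis i 1)"
  unfolding partial_def by (metis frechet_derivative_at)

lemma Ck_differentiable: "Ck (Suc k) f \<Longrightarrow> f differentiable (at x)"
  by simp

lemma Ck_continuous: "Ck k f \<Longrightarrow> continuous_on UNIV f"
  by (cases k) (auto simp: continuous_on_eq_continuous_at intro: differentiable_imp_continuous_within)

lemma Ck_Suc_D: "Ck (Suc k) f \<Longrightarrow> Ck k f"
proof (induction k arbitrary: f)
  case 0 show ?case unfolding Ck.simps(1) by (rule Ck_continuous[OF 0])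
next
  case (Suc k) then show ?case unfolding Ck.simps(2)[of "Suc k"] Ck.simps(2)[of k] by blast
qed

lemma has_derivative_frechet: "Ck (Suc k) f \<Longrightarrow> (f has_derivative frechet_derivative f (at x)) (at x)"
  by (rule frechet_derivative_works[THEN iffD1]) (rule Ck_differentiable)

lemma partial_add:
  assumes "f differentiable (at x)" "g differentiable (at x)"
  shows "partial i (\<lambda>x. f x + g x) x = partial i f x + partial i g x"
  using has_derivative_add[OF iffD1[OF frechet_derivative_works assms(1)] iffD1[OF frechet_derivative_works assms(2)]]
  by (subst partial_eq) (auto simp: partial_def)

lemma partial_mult:
  assumes "f differentiable (at x)" "g differentiable (at x)"
  shows "partial i (\<lambda>x. f x * g x) x = f x * partial i g x + partial i f x * g x"
  using has_derivative_mult[OF iffD1[OF frechet_derivative_works assms(1)] iffD1[OF frechet_derivative_works assms(2)]]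
  by (subst partial_eq) (auto simp: partial_def)

lemma partial_bounded_linear:
  assumes "bounded_linear h" "f differentiable (at x)"
  shows "partial i (\<lambda>x. h (f x)) x = h (partial i f x)"
  using bounded_linear.has_derivative[OF assms(1) iffD1[OF frechet_derivative_works assms(2)]]
  by (subst partial_eq) (auto simp: partial_def)

lemma Ck_add: "Ck k f \<Longrightarrow> Ck k g \<Longrightarrow> Ck k (\<lambda>x. f x + g x)"
proof (induction k arbitrary: f g)
  case 0 then show ?case by (auto intro: continuous_intros)
next
  case (Suc k)
  then have "partial i (\<lambda>x. f x + g x) = (\<lambda>x. partial i f x + partial i g x)" for i
    by (intro ext partial_add) auto
  then show ?case using Suc by (auto intro: differentiable_add)
qed

lemma Ck_bounded_linear:
  assumes "bounded_linear h"
  shows "Ck k f \<Longrightarrow> Ck k (\<lambda>x. h (f x))"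
proof (induction k arbitrary: f)
  case 0 then show ?case using assms by (auto intro: bounded_linear.continuous_on)
next
  case (Suc k)
  then have "partial i (\<lambda>x. h (f x)) = (\<lambda>x. h (partial i f x))" for i
    by (intro ext partial_bounded_linear assms) auto
  moreover have "(\<lambda>x. h (f x)) differentiable (at x)" for x
    using bounded_linear.has_derivative[OF assms has_derivative_frechet[OF Suc.prems]]
    unfolding differentiable_def by blast
  ultimately show ?case using Suc by auto
qed

lemma Ck_mult: "Ck k f \<Longrightarrow> Ck k g \<Longrightarrow> Ck k (\<lambda>x. f x * g x)"
proof (induction k arbitrary: f g)
  case 0 then show ?case by (auto intro: continuous_intros)
next
  case (Suc k)
  then have "partial i (\<lambda>x. f x * g x) = (\<lambda>x. f x * partial i g x + partial i f x * g x)" for i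
    by (intro ext partial_mult) auto
  then show ?case using Suc Suc.prems[THEN Ck_Suc_D] by (auto intro: differentiable_mult Ck_add)
qed

lemma Ck_const: "Ck k (\<lambda>x. c)"
proof (induction k arbitrary: c)
  case (Suc k)
  have "partial i (\<lambda>x. c) = (\<lambda>x. 0)" for i :: 'a
    by (intro ext) (subst partial_eq[OF has_derivative_const], simp)
  then show ?case using Suc by simp
qed auto

lemma Ck_prod: "(\<And>i. i \<in> A \<Longrightarrow> Ck k (f i)) \<Longrightarrow> Ck k (\<lambda>x. \<Prod>i\<in>A. f i x)"
  by (induction A rule: infinite_finite_induct) (auto intro: Ck_mult Ck_const)

lemma smooth_C1:
  assumes "smooth f"
  shows "f differentiable (at x)" "continuous_on UNIV f" "continuous_on UNIV (partial i f)"
  using assms Ck_continuous[of 0 f] unfolding smooth_def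
  by (metis Ck.simps(2), blast, metis Ck.simps(1) Ck.simps(2))

lemma test_function_smooth: "\<phi> \<in> test_functions \<Omega> \<Longrightarrow> smooth \<phi>"
  by (simp add: test_functions_def)

section \<open>Smooth bump functions on boxes\<close>

text \<open>These functions are closed under differentiation, which makes them smooth in the sense of \<open>Ck\<close>.\<close>

definition flat_exp :: "real poly \<Rightarrow> real \<Rightarrow> real" where
  "flat_exp p t = (if t > 0 then poly p (1 / t) * exp (- (1 / t)) else 0)"

lemma poly_over_exp_LIM: "((\<lambda>s. poly q s / exp s) \<longlongrightarrow> (0::real)) at_top"
proof -
  have "((\<lambda>s. \<Sum>i\<le>degree q. coeff q i * (s ^ i / exp s)) \<longlongrightarrow> 0) at_top"
    by (intro tendsto_null_sum tendsto_mult_right_zero tendsto_power_div_exp_0)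
  then show ?thesis by (simp add: poly_altdef sum_divide_distrib)
qed

text \<open>For positive \<open>t\<close> both derivatives by the chain rule produce a factor
  \<open>1 / t\<^sup>2\<close>, with sign minus for the polynomial and plus for the exponential;
  \<open>monom 1 2\<close> is that factor as a polynomial in \<open>1 / t\<close>. At 0 the
  exponential decay beats every polynomial in \<open>1 / t\<close>.\<close>

lemma flat_exp_derivative:
  "(flat_exp p has_real_derivative flat_exp (monom 1 2 * (p - pderiv p)) t) (at t)"
proof -
  consider "t > 0" | "t < 0" | "t = 0" by linarith
  then show ?thesis
  proof cases
    case 1
    have "((\<lambda>t. poly p (1 / t) * exp (- (1 / t))) has_real_derivative
       flat_exp (monom 1 2 * (p - pderiv p)) t) (at t)"
      using 1 by (auto intro!: derivative_eq_intros DERIV_chain2[OF poly_DERIV]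
          simp: flat_exp_def poly_monom field_simps power2_eq_square)
    then show ?thesis
      by (rule has_field_derivative_transform_within_open[where S = "{0<..}"]) (use 1 in \<open>auto simp: flat_exp_def\<close>)
  next
    case 2
    have "((\<lambda>t. 0) has_real_derivative flat_exp (monom 1 2 * (p - pderiv p)) t) (at t)"
      using 2 by (simp add: flat_exp_def)
    then show ?thesis
      by (rule has_field_derivative_transform_within_open[where S = "{..<0}"]) (use 2 in \<open>auto simp: flat_exp_def\<close>)
  next
    case 3
    have "((\<lambda>h. flat_exp p h / h) \<longlongrightarrow> 0) (at_right 0)"
    proof (subst filterlim_at_right_to_top)
      \<comment> \<open>With \<open>h = 1 / s\<close> the difference quotient at 0 is
        \<open>s * poly p s / exp s\<close>, and \<open>pCons 0 p\<close> is the polynomial in the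
        numerator.\<close>
      have "((\<lambda>s. poly (pCons 0 p) s / exp s) \<longlongrightarrow> 0) at_top" by (rule poly_over_exp_LIM)
      then show "((\<lambda>x. flat_exp p (inverse x) / inverse x) \<longlongrightarrow> 0) at_top"
      proof (rule Lim_transform_eventually)
        show "\<forall>\<^sub>F s in at_top. poly (pCons 0 p) s / exp s = flat_exp p (inverse s) / inverse s"
          using eventually_gt_at_top[of 0]
          by eventually_elim (simp add: flat_exp_def exp_minus field_simps)
      qed
    qed
    moreover have "((\<lambda>h. flat_exp p h / h) \<longlongrightarrow> 0) (at_left 0)"
    proof (rule Lim_transform_eventually[OF tendsto_const])
      show "\<forall>\<^sub>F h in at_left 0. 0 = flat_exp p h / h"
        unfolding eventually_at_filter by (intro always_eventually) (simp add: flat_exp_def)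
    qed
    ultimately have "((\<lambda>h. flat_exp p h / h) \<longlongrightarrow> 0) (at 0)" by (simp add: filterlim_at_split)
    then show ?thesis using 3 by (simp add: DERIV_def flat_exp_def)
  qed
qed

lemma flat_exp_affine_derivative:
  "((\<lambda>x :: real^'n. complex_of_real (flat_exp p (c * x $ i + d))) has_derivative
     (\<lambda>h. complex_of_real (flat_exp (monom 1 2 * (p - pderiv p)) (c * x $ i + d) * (c * h $ i)))) (at x)"
proof -
  have "((\<lambda>x :: real^'n. c * x $ i + d) has_derivative (\<lambda>h. c * h $ i)) (at x)"
    by (auto intro!: derivative_eq_intros bounded_linear.has_derivative[OF bounded_linear_vec_nth])
  from DERIV_compose_FDERIV[OF flat_exp_derivative this]
  show ?thesis by (intro has_derivative_of_real) (simp add: mult.commute)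
qed

lemma Ck_flat_exp_affine: "Ck k (\<lambda>x :: real^'n::finite. complex_of_real (flat_exp p (c * x $ i + d)))"
proof (induction k arbitrary: p)
  case 0
  show ?case
    unfolding Ck.simps(1) continuous_on_eq_continuous_at[OF open_UNIV]
    using has_derivative_continuous[OF flat_exp_affine_derivative] by blast
next
  case (Suc k)
  let ?q = "monom 1 2 * (p - pderiv p)"
  have *: "partial j (\<lambda>x :: real^'n. complex_of_real (flat_exp p (c * x $ i + d))) =
     (\<lambda>x. complex_of_real (if j = i then c else 0) * complex_of_real (flat_exp ?q (c * x $ i + d)))" for j
    by (intro ext) (subst partial_eq[OF flat_exp_affine_derivative], simp add: axis_def)
  show ?case
    unfolding Ck.simps(2) *
    using flat_exp_affine_derivative by (auto simp: differentiable_def intro!: Ck_mult Ck_const Suc) blast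
qed

text \<open>A product over the coordinates of \<open>exp (- 1 / (m * (x $ i - a $ i)))\<close> and
  \<open>exp (- 1 / (m * (b $ i - x $ i)))\<close> inside the box, tending to its indicator as
  \<open>m\<close> grows. The arguments are expanded into the affine shape
  \<open>c * x $ i + d\<close> of \<open>Ck_flat_exp_affine\<close>.\<close>

definition box_bump :: "real \<Rightarrow> real^'n \<Rightarrow> real^'n \<Rightarrow> real^'n::finite \<Rightarrow> complex" where
  "box_bump m a b x = (\<Prod>i\<in>UNIV. complex_of_real (flat_exp 1 (m * x $ i + (- m * a $ i))) *
      complex_of_real (flat_exp 1 (- m * x $ i + m * b $ i)))"

lemma flat_exp_1: "flat_exp 1 t = (if t > 0 then exp (- (1 / t)) else 0)"
  by (simp add: flat_exp_def)

lemma norm_box_bump_le_1: "norm (box_bump m a b x) \<le> 1"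
proof -
  have "0 \<le> flat_exp 1 t \<and> flat_exp 1 t \<le> 1" for t by (simp add: flat_exp_1)
  then show ?thesis
    unfolding box_bump_def prod_norm[symmetric] by (intro prod_le_1) (simp add: norm_mult mult_le_one)
qed

lemma box_bump_eq_0_iff: "m > 0 \<Longrightarrow> box_bump m a b x = 0 \<longleftrightarrow> x \<notin> box a b"
proof -
  assume m: "m > 0"
  have "flat_exp 1 t = 0 \<longleftrightarrow> t \<le> 0" for t by (simp add: flat_exp_1)
  moreover have "m * x $ i + (- m * a $ i) \<le> 0 \<longleftrightarrow> \<not> a $ i < x $ i" "- m * x $ i + m * b $ i \<le> 0 \<longleftrightarrow> \<not> x $ i < b $ i" for i
    using m by (auto simp: not_less)
  ultimately show ?thesis by (auto simp: box_bump_def mem_box_cart)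
qed

lemma box_bump_test_function:
  fixes \<Omega> :: "(real^'n::finite) set"
  assumes "m > 0" "cbox a b \<subseteq> \<Omega>"
  shows "box_bump m a b \<in> test_functions \<Omega>"
proof -
  have "{x. box_bump m a b x \<noteq> 0} \<subseteq> cbox a b"
    using box_bump_eq_0_iff[OF assms(1)] box_subset_cbox by blast
  then have c: "closure {x. box_bump m a b x \<noteq> 0} \<subseteq> cbox a b" by (rule closure_minimal) (rule closed_cbox)
  then have "compact (closure {x. box_bump m a b x \<noteq> 0})"
    using compact_Int_closed[OF compact_cbox closed_closure, of a b "{x. box_bump m a b x \<noteq> 0}"]
    by (simp add: inf.absorb2)
  moreover have "smooth (box_bump m a b)"
    unfolding smooth_def box_bump_def[abs_def] by (intro allI Ck_prod Ck_mult Ck_flat_exp_affine)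
  ultimately show ?thesis using c assms(2) by (auto simp: test_functions_def)
qed

lemma box_bump_LIMSEQ: "(\<lambda>m. box_bump (real (Suc m)) a b x) \<longlonglongrightarrow> indicator (box a b) x"
proof (cases "x \<in> box a b")
  case False
  then have "box_bump (real (Suc m)) a b x = 0" for m by (subst box_bump_eq_0_iff) auto
  then show ?thesis using False by (simp del: of_nat_Suc)
next
  case True
  have *: "(\<lambda>m. flat_exp 1 (real (Suc m) * t)) \<longlonglongrightarrow> 1" if "t > 0" for t
  proof -
    have "(\<lambda>m. exp (- (inverse (real (Suc m)) * (1 / t)))) \<longlonglongrightarrow> exp (- (0 * (1 / t)))"
      by (intro tendsto_intros LIMSEQ_inverse_real_of_nat)
    moreover have "flat_exp 1 (real (Suc m) * t) = exp (- (inverse (real (Suc m)) * (1 / t)))" for m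
      using that by (simp add: flat_exp_1 divide_simps)
    ultimately show ?thesis by simp
  qed
  have "(\<lambda>m. \<Prod>i\<in>UNIV. complex_of_real (flat_exp 1 (real (Suc m) * (x $ i - a $ i))) *
      complex_of_real (flat_exp 1 (real (Suc m) * (b $ i - x $ i)))) \<longlonglongrightarrow> (\<Prod>i\<in>(UNIV :: 'a set). complex_of_real 1 * complex_of_real 1)"
    using True by (intro tendsto_prod tendsto_mult tendsto_of_real *) (auto simp: mem_box_cart)
  moreover have "box_bump (real (Suc m)) a b x = (\<Prod>i\<in>UNIV. complex_of_real (flat_exp 1 (real (Suc m) * (x $ i - a $ i))) *
      complex_of_real (flat_exp 1 (real (Suc m) * (b $ i - x $ i))))" for m
    unfolding box_bump_def by (simp add: algebra_simps)
  ultimately show ?thesis using True by simp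
qed

section \<open>The fundamental lemma of the calculus of variations\<close>

lemma sigma_finite_lebesgue: "sigma_finite_measure (lebesgue :: 'a::euclidean_space measure)"
proof
  show "\<exists>A. countable A \<and> A \<subseteq> sets lebesgue \<and> \<Union>A = space lebesgue \<and> (\<forall>a\<in>A. emeasure (lebesgue :: 'a measure) a \<noteq> \<infinity>)"
    using UN_box_eq_UNIV
    by (intro exI[of _ "range (\<lambda>k. box (- (real k *\<^sub>R One)) (real k *\<^sub>R One))"]) (auto simp: emeasure_lborel_box_eq)
qed

text \<open>The sets over which \<open>h\<close> integrates to zero include the boxes, which are
  stable under intersection and generate the Borel sets, and are stable under complements and
  countable disjoint unions. Lebesgue sets differ from Borel sets by null sets only, and an
  integrable function whose integrals over all measurable sets vanish is zero almost
  everywhere.\<close>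

lemma integral_box_zero_imp_AE_zero:
  fixes h :: "real^'n::finite \<Rightarrow> complex"
  assumes h: "integrable lebesgue h"
    and 0: "\<And>a b. (LINT x|lebesgue. indicator (box a b) x *\<^sub>R h x) = 0"
  shows "AE x in lebesgue. h x = 0"
proof (rule sigma_finite_measure.density_zero[OF sigma_finite_lebesgue h])
  have int: "integrable lebesgue (\<lambda>x. indicat_real A x *\<^sub>R h x)" if "A \<in> sets lebesgue" for A
    using integrable_mult_indicator[OF that h] .
  have UN: "(LINT x|lebesgue. indicator (\<Union>i. F i) x *\<^sub>R h x) = 0"
    if F: "disjoint_family F" "\<And>i::nat. F i \<in> sets lebesgue" "\<And>i. (LINT x|lebesgue. indicator (F i) x *\<^sub>R h x) = 0"
    for F :: "nat \<Rightarrow> (real^'n) set"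
  proof -
    have "(LINT x:(\<Union>i. F i)|lebesgue. h x) = (\<Sum>i. LINT x:F i|lebesgue. h x)"
      using F by (intro lebesgue_integral_countable_add) (auto simp: disjoint_family_on_def set_integrable_def intro!: int)
    then show ?thesis using F(3) by (simp add: set_lebesgue_integral_def)
  qed
  \<comment> \<open>Complements need the integral over the whole space, which is exhausted by
    growing boxes.\<close>
  have total: "(LINT x|lebesgue. h x) = 0"
  proof -
    have "(\<lambda>k. LINT x|lebesgue. indicator (box (- (real k *\<^sub>R One)) (real k *\<^sub>R One)) x *\<^sub>R h x) \<longlonglongrightarrow> (LINT x|lebesgue. h x)"
    proof (rule integral_dominated_convergence[where w = "\<lambda>x. norm (h x)"])
      show "AE x in lebesgue. (\<lambda>k. indicat_real (box (- (real k *\<^sub>R One)) (real k *\<^sub>R One)) x *\<^sub>R h x) \<longlonglongrightarrow> h x"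
      proof (intro always_eventually allI)
        fix x :: "real^'n"
        have "x \<in> (\<Union>k. box (- (real k *\<^sub>R One)) (real k *\<^sub>R One))" using UN_box_eq_UNIV by auto
        then obtain k0 where k0: "x \<in> box (- (real k0 *\<^sub>R One)) (real k0 *\<^sub>R One)" by auto
        have "\<forall>\<^sub>F k in sequentially. h x = indicat_real (box (- (real k *\<^sub>R One)) (real k *\<^sub>R One)) x *\<^sub>R h x"
          using eventually_ge_at_top[of k0]
        proof eventually_elim
          fix k assume "k0 \<le> k"
          then have "real k0 \<le> real k" by simp
          then have "x \<in> box (- (real k *\<^sub>R One)) (real k *\<^sub>R One)"
            using k0 unfolding mem_box by (auto simp: inner_minus_left intro: less_le_trans le_less_trans) 
          then show "h x = indicat_real (box (- (real k *\<^sub>R One)) (real k *\<^sub>R One)) x *\<^sub>R h x" by simp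
        qed
        then show "(\<lambda>k. indicat_real (box (- (real k *\<^sub>R One)) (real k *\<^sub>R One)) x *\<^sub>R h x) \<longlonglongrightarrow> h x"
          by (rule Lim_transform_eventually[OF tendsto_const])
      qed
      show "(\<lambda>x. indicat_real (box (- (real k *\<^sub>R One)) (real k *\<^sub>R One)) x *\<^sub>R h x) \<in> borel_measurable lebesgue" for k
        by (intro borel_measurable_integrable int) simp
    qed (use h in \<open>auto simp: indicator_def\<close>)
    then show ?thesis unfolding 0 by (simp add: LIMSEQ_const_iff)
  qed
  have B: "A \<in> sets lebesgue" if "A \<in> sigma_sets UNIV (range (\<lambda>(a, b). box a b))" for A :: "(real^'n) set"
  proof -
    have "A \<in> sets borel" using that unfolding borel_eq_box by simp
    then show ?thesis by simp
  qed
  have borel: "(LINT x|lebesgue. indicator A x *\<^sub>R h x) = 0" if "A \<in> sets borel" for A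
  proof -
    have "Int_stable (range (\<lambda>(a, b). box a b :: (real^'n) set))"
      by (auto simp: Int_stable_def box_Int_box)
    moreover have "range (\<lambda>(a, b). box a b :: (real^'n) set) \<subseteq> Pow UNIV" by auto
    moreover have "A \<in> sigma_sets UNIV (range (\<lambda>(a, b). box a b))"
      using that unfolding borel_eq_box by simp
    ultimately show ?thesis
    proof (induction rule: sigma_sets_induct_disjoint)
      case (basic A) then show ?case using 0 by auto
    next
      case empty then show ?case by simp
    next
      case (compl A)
      then have A: "A \<in> sets lebesgue" by (intro B)
      have "(LINT x|lebesgue. indicat_real (UNIV - A) x *\<^sub>R h x) = (LINT x|lebesgue. h x - indicat_real A x *\<^sub>R h x)"
        by (intro Bochner_Integration.integral_cong) (auto simp: indicator_def)
      also have "\<dots> = 0" using h int[OF A] compl total by simp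
      finally show ?case .
    next
      case (union F)
      then show ?case by (intro UN B) auto
    qed
  qed
  fix A :: "(real^'n) set" assume "A \<in> sets lebesgue"
  then obtain S N N' where A: "A = S \<union> N" "N \<subseteq> N'" "N' \<in> null_sets lborel" "S \<in> sets lborel"
    by (rule sets_completionE)
  have "N' \<in> null_sets lebesgue" using A(3) by (simp add: null_sets_completionI)
  then have "AE x in lebesgue. x \<notin> N'" by (rule AE_not_in)
  then have "(LINT x|lebesgue. indicat_real A x *\<^sub>R h x) = (LINT x|lebesgue. indicator S x *\<^sub>R h x)"
  proof (intro integral_cong_AE)
    assume "AE x in lebesgue. x \<notin> N'"
    then show "AE x in lebesgue. indicat_real A x *\<^sub>R h x = indicat_real S x *\<^sub>R h x"
      by eventually_elim (use A in \<open>auto simp: indicator_def\<close>)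
  qed (use A \<open>A \<in> sets lebesgue\<close> int in \<open>auto dest!: int intro: borel_measurable_integrable\<close>)
  also have "\<dots> = 0" using A(4) by (intro borel) simp
  finally show "set_lebesgue_integral lebesgue A h = 0" by (simp add: set_lebesgue_integral_def)
qed

lemma continuous_measurable_lebesgue_on:
  fixes f :: "'a::euclidean_space \<Rightarrow> 'b::topological_space"
  assumes "continuous_on UNIV f"
  shows "f \<in> borel_measurable (lebesgue_on S)"
  using borel_measurable_continuous_onI[OF assms]
  by (intro measurable_restrict_space1 measurable_completion) simp

text \<open>By dominated convergence, \<open>h\<close> integrates to zero over each open box whose
  closed box lies in \<open>\<Omega>\<close>, the indicator being a limit of bumps. Since
  \<open>h\<close> is controlled only on \<open>\<Omega>\<close>, it is cut off to one closed box at
  a time before arbitrary boxes are tested, and \<open>\<Omega>\<close> is a countable union of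
  closed boxes.\<close>

lemma fundamental_lemma:
  fixes h :: "real^'n::finite \<Rightarrow> complex"
  assumes "open \<Omega>" and h: "h \<in> L2 (lebesgue_on \<Omega>)"
    and 0: "\<And>\<phi>. \<phi> \<in> test_functions \<Omega> \<Longrightarrow> (LINT x|lebesgue_on \<Omega>. h x * \<phi> x) = 0"
  shows "AE x in lebesgue_on \<Omega>. h x = 0"
proof -
  have \<Omega>[measurable]: "\<Omega> \<in> sets lebesgue" using \<open>open \<Omega>\<close> by (simp add: sets_completionI_sets)
  have [measurable]: "h \<in> borel_measurable (lebesgue_on \<Omega>)" using h by (rule L2_measurable)
  have int: "integrable (lebesgue_on \<Omega>) (\<lambda>x. h x * indicator (cbox a b) x)" for a b
  proof (rule L2_mult_integrable[OF h])
    have "integrable lebesgue (\<lambda>x. indicator \<Omega> x *\<^sub>R indicat_real (cbox a b) x)"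
      using \<Omega> by (intro integrable_mult_indicator integrable_real_indicator) (auto simp: emeasure_lborel_cbox_eq)
    then have i: "integrable (lebesgue_on \<Omega>) (indicat_real (cbox a b))"
      by (subst integrable_restrict_space) (auto simp: \<Omega>)
    have "(\<lambda>x. (norm (indicator (cbox a b) x :: complex))\<^sup>2) = indicat_real (cbox a b)"
      by (auto simp: indicator_def)
    then show "(indicator (cbox a b) :: real^'n \<Rightarrow> complex) \<in> L2 (lebesgue_on \<Omega>)"
      using i by (intro L2I measurable_restrict_space1 borel_measurable_indicator) auto
  qed
  have box0: "(LINT x|lebesgue_on \<Omega>. h x * indicator (box a b) x) = 0" if sub: "cbox a b \<subseteq> \<Omega>" for a b
  proof -
    have t: "box_bump (real (Suc m)) a b \<in> test_functions \<Omega>" for m by (intro box_bump_test_function sub) simp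
    then have meas[measurable]: "box_bump (real (Suc m)) a b \<in> borel_measurable (lebesgue_on \<Omega>)" for m
      by (intro continuous_measurable_lebesgue_on smooth_C1(2)) (rule test_function_smooth[OF t])
    have hb: "(\<lambda>x. h x * box_bump (real (Suc m)) a b x) \<in> borel_measurable (lebesgue_on \<Omega>)" for m
      by measurable
    have "(\<lambda>m. LINT x|lebesgue_on \<Omega>. h x * box_bump (real (Suc m)) a b x) \<longlonglongrightarrow>
        (LINT x|lebesgue_on \<Omega>. h x * indicator (box a b) x)"
    proof (rule integral_dominated_convergence[where w = "\<lambda>x. norm (h x * indicator (cbox a b) x)"])
      show "AE x in lebesgue_on \<Omega>. (\<lambda>m. h x * box_bump (real (Suc m)) a b x) \<longlonglongrightarrow> h x * indicator (box a b) x"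
        by (intro always_eventually allI tendsto_mult tendsto_const box_bump_LIMSEQ)
      show "AE x in lebesgue_on \<Omega>. norm (h x * box_bump (real (Suc m)) a b x) \<le> norm (h x * indicator (cbox a b) x)" for m
      proof (intro always_eventually allI)
        fix x show "norm (h x * box_bump (real (Suc m)) a b x) \<le> norm (h x * indicator (cbox a b) x)"
          using norm_box_bump_le_1[of "real (Suc m)" a b x] box_bump_eq_0_iff[of "real (Suc m)" a b x] box_subset_cbox[of a b]
          by (cases "x \<in> cbox a b") (auto simp: norm_mult mult_left_le)
      qed
      show "(\<lambda>x. h x * indicator (box a b) x) \<in> borel_measurable (lebesgue_on \<Omega>)"
        by (rule borel_measurable_LIMSEQ_metric[of "\<lambda>m x. h x * box_bump (real (Suc m)) a b x"])
           (intro hb tendsto_mult tendsto_const box_bump_LIMSEQ)+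
    qed (use hb int[of a b] in \<open>auto intro: integrable_norm\<close>)
    then show ?thesis using 0[OF t] by (simp add: LIMSEQ_const_iff)
  qed
  have cb: "AE x in lebesgue. x \<in> cbox c d \<longrightarrow> h x = 0" if sub: "cbox c d \<subseteq> \<Omega>" for c d
  proof -
    define g where "g x = indicator (box c d) x *\<^sub>R (indicator \<Omega> x *\<^sub>R h x)" for x
    have eq: "(LINT x|lebesgue. indicator \<Omega> x *\<^sub>R (h x * indicator (box a b) x)) = (LINT x|lebesgue_on \<Omega>. h x * indicator (box a b) x)" for a b
      by (subst integral_restrict_space) (auto simp: \<Omega>)
    have "integrable lebesgue (\<lambda>x. indicator \<Omega> x *\<^sub>R (h x * indicator (cbox c d) x))"
      using int[of c d] by (subst (asm) integrable_restrict_space) (auto simp: \<Omega>)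
    from integrable_mult_indicator[OF _ this, of "box c d"]
    have "integrable lebesgue (\<lambda>x. indicat_real (box c d) x *\<^sub>R (indicator \<Omega> x *\<^sub>R (h x * indicator (cbox c d) x)))" by simp
    then have gi: "integrable lebesgue g"
      by (rule Bochner_Integration.integrable_cong[THEN iffD1, rotated 2])
         (use box_subset_cbox[of c d] in \<open>auto simp: g_def indicator_def\<close>)
    have "AE x in lebesgue. g x = 0"
    proof (rule integral_box_zero_imp_AE_zero[OF gi])
      fix a b
      \<comment> \<open>Intersecting with \<open>box c d\<close> moves an arbitrary box into
        \<open>\<Omega>\<close>, where \<open>box0\<close> applies.\<close>
      obtain p q where pq: "box a b \<inter> box c d = box p q" "cbox p q \<subseteq> \<Omega> \<or> box p q = {}"
      proof -
        have *: "box a b \<inter> box c d = box (\<Sum>i\<in>Basis. max (a\<bullet>i) (c\<bullet>i) *\<^sub>R i) (\<Sum>i\<in>Basis. min (b\<bullet>i) (d\<bullet>i) *\<^sub>R i)"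
          by (rule box_Int_box)
        have "cbox (\<Sum>i\<in>Basis. max (a\<bullet>i) (c\<bullet>i) *\<^sub>R i) (\<Sum>i\<in>Basis. min (b\<bullet>i) (d\<bullet>i) *\<^sub>R i) \<subseteq> cbox c d"
          by (auto simp: mem_box)
        then show ?thesis using that[OF *] sub by blast
      qed
      have "(LINT x|lebesgue. indicator (box a b) x *\<^sub>R g x) = (LINT x|lebesgue. indicator \<Omega> x *\<^sub>R (h x * indicator (box p q) x))"
        unfolding pq(1)[symmetric] by (intro Bochner_Integration.integral_cong) (auto simp: g_def indicator_def)
      also have "\<dots> = 0" using pq(2) unfolding eq by (auto intro: box0)
      finally show "(LINT x|lebesgue. indicator (box a b) x *\<^sub>R g x) = 0" .
    qed
    \<comment> \<open>The faces of the box are a null set.\<close>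
    moreover have "AE x in lebesgue. x \<notin> cbox c d - box c d"
      by (intro AE_not_in) (simp add: negligible_iff_null_sets[symmetric] negligible_frontier_interval)
    ultimately show ?thesis
      by eventually_elim (use sub in \<open>auto simp: g_def indicator_def split: if_splits\<close>)
  qed
  obtain D where D: "countable D" "D \<subseteq> Pow \<Omega>" "\<And>X. X \<in> D \<Longrightarrow> \<exists>a b. X = cbox a b" "\<Union>D = \<Omega>"
    using open_countable_Union_open_cbox[OF \<open>open \<Omega>\<close>] by metis
  have "AE x in lebesgue. \<forall>X\<in>D. x \<in> X \<longrightarrow> h x = 0"
    unfolding AE_ball_countable[OF D(1)]
  proof
    fix X assume "X \<in> D"
    then show "AE x in lebesgue. x \<in> X \<longrightarrow> h x = 0" using D(2) D(3)[of X] cb by blast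
  qed
  then have "AE x in lebesgue. x \<in> \<Omega> \<longrightarrow> h x = 0"
    by eventually_elim (use D(4) in auto)
  then show ?thesis by (subst AE_restrict_space_iff) (auto simp: \<Omega>)
qed

section \<open>Rellich compactness\<close>

definition grad :: "(real^'n::finite \<Rightarrow> complex) \<Rightarrow> real^'n \<Rightarrow> complex^'n" where
  "grad f x = (\<chi> i. partial i f x)"

definition cont_diff :: "(real^'n::finite \<Rightarrow> complex) \<Rightarrow> bool" where
  "cont_diff f \<longleftrightarrow> (\<forall>x. f differentiable (at x)) \<and> (\<forall>i. continuous_on UNIV (partial i f))"

text \<open>The regularity that the integral estimates use. Test functions belong to this class;
  \<open>cont_diff\<close> alone, without a condition on the support, serves the smooth
  approximations in \<open>has_trace\<close>.\<close>

definition cont_diff_cs :: "(real^'n::finite \<Rightarrow> complex) \<Rightarrow> bool" where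
  "cont_diff_cs f \<longleftrightarrow> cont_diff f \<and> bounded {x. f x \<noteq> 0}"

lemma C1D:
  assumes "cont_diff f"
  shows C1_differentiable: "f differentiable (at x)"
    and C1_continuous: "continuous_on UNIV f"
    and C1_continuous_partial: "continuous_on UNIV (partial i f)"
    and C1_has_derivative: "(f has_derivative frechet_derivative f (at x)) (at x)"
    and C1_continuous_grad: "continuous_on UNIV (grad f)"
proof -
  show d: "f differentiable (at x)" for x using assms by (simp add: cont_diff_def)
  show "continuous_on UNIV f" using d
    by (auto simp: continuous_on_eq_continuous_at intro: differentiable_imp_continuous_within)
  show "continuous_on UNIV (partial i f)" for i using assms by (simp add: cont_diff_def)
  then show "continuous_on UNIV (grad f)" unfolding grad_def[abs_def] by (intro continuous_intros)
  show "(f has_derivative frechet_derivative f (at x)) (at x)"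
    using d by (rule frechet_derivative_works[THEN iffD1])
qed

lemma smooth_imp_C1: "smooth f \<Longrightarrow> cont_diff f"
  using smooth_C1 by (auto simp: cont_diff_def)

lemma C1c_imp_C1: "cont_diff_cs f \<Longrightarrow> cont_diff f" by (simp add: cont_diff_cs_def)

lemma C1c_support:
  assumes "cont_diff_cs f"
  obtains R where "R > 0" "\<And>x. f x \<noteq> 0 \<Longrightarrow> norm x \<le> R"
  using assms unfolding cont_diff_cs_def bounded_pos by auto

lemma C1_add: "cont_diff f \<Longrightarrow> cont_diff g \<Longrightarrow> cont_diff (\<lambda>x. f x + g x)"
proof -
  assume f: "cont_diff f" and g: "cont_diff g"
  have "partial i (\<lambda>x. f x + g x) = (\<lambda>x. partial i f x + partial i g x)" for i
    by (intro ext partial_add C1D f g)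
  then show ?thesis using f g unfolding cont_diff_def by (auto intro!: continuous_intros)
qed

lemma C1_bounded_linear: "bounded_linear h \<Longrightarrow> cont_diff f \<Longrightarrow> cont_diff (\<lambda>x. h (f x))"
proof -
  assume h: "bounded_linear h" and f: "cont_diff f"
  have "partial i (\<lambda>x. h (f x)) = (\<lambda>x. h (partial i f x))" for i
    by (intro ext partial_bounded_linear C1D f h)
  then show ?thesis
    using f bounded_linear.has_derivative[OF h C1_has_derivative[OF f]] unfolding cont_diff_def
    by (auto intro: bounded_linear.continuous_on[OF h] differentiableI)
qed

lemma C1_mult: "cont_diff f \<Longrightarrow> cont_diff g \<Longrightarrow> cont_diff (\<lambda>x. f x * g x)"
proof -
  assume f: "cont_diff f" and g: "cont_diff g"
  have "partial i (\<lambda>x. f x * g x) = (\<lambda>x. f x * partial i g x + partial i f x * g x)" for i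
    by (intro ext partial_mult C1D f g)
  then show ?thesis using f g C1_continuous[OF f] C1_continuous[OF g] unfolding cont_diff_def
    by (auto intro!: continuous_intros)
qed

lemma partial_diff: "cont_diff f \<Longrightarrow> cont_diff g \<Longrightarrow> partial i (\<lambda>x. f x - g x) x = partial i f x - partial i g x"
  using partial_add[of f x "\<lambda>x. - g x" i] partial_bounded_linear[OF bounded_linear_minus[OF bounded_linear_ident], of g x i]
  by (simp add: C1D C1_bounded_linear[OF bounded_linear_minus[OF bounded_linear_ident]])

lemma C1_diff: "cont_diff f \<Longrightarrow> cont_diff g \<Longrightarrow> cont_diff (\<lambda>x. f x - g x)"
  using C1_add[of f "\<lambda>x. - g x"] C1_bounded_linear[OF bounded_linear_minus[OF bounded_linear_ident], of g] by simp

lemma grad_diff: "cont_diff f \<Longrightarrow> cont_diff g \<Longrightarrow> grad (\<lambda>x. f x - g x) x = grad f x - grad g x"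
  by (simp add: grad_def vec_eq_iff partial_diff)

lemma C1c_diff:
  assumes "cont_diff_cs f" "cont_diff_cs g" shows "cont_diff_cs (\<lambda>x. f x - g x)"
  unfolding cont_diff_cs_def
proof
  show "cont_diff (\<lambda>x. f x - g x)" using assms by (intro C1_diff C1c_imp_C1)
  have "{x. f x - g x \<noteq> 0} \<subseteq> {x. f x \<noteq> 0} \<union> {x. g x \<noteq> 0}" by auto
  then show "bounded {x. f x - g x \<noteq> 0}" using assms unfolding cont_diff_cs_def by (meson bounded_Un bounded_subset)
qed

lemma C1c_mult: "cont_diff f \<Longrightarrow> cont_diff_cs g \<Longrightarrow> cont_diff_cs (\<lambda>x. f x * g x)"
  unfolding cont_diff_cs_def by (auto intro: C1_mult elim: bounded_subset)

lemma test_function_C1c: "\<phi> \<in> test_functions \<Omega> \<Longrightarrow> cont_diff_cs \<phi>"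
  unfolding cont_diff_cs_def test_functions_def
  by (auto intro: smooth_imp_C1 compact_imp_bounded bounded_subset[OF _ closure_subset])

lemma partial_zero_outside:
  assumes "x \<notin> closure {x. f x \<noteq> 0}"
  shows "partial i f x = 0"
proof -
  have "(f has_derivative (\<lambda>h. 0)) (at x)"
    by (rule has_derivative_transform_within_open[of "\<lambda>x. 0" _ _ _ "- closure {x. f x \<noteq> 0}"])
       (use assms closure_subset[of "{x. f x \<noteq> 0}"] in auto)
  then show ?thesis by (simp add: partial_eq)
qed

lemma frechet_derivative_sum_partial:
  assumes "cont_diff f"
  shows "frechet_derivative f (at x) h = (\<Sum>i\<in>UNIV. h $ i *\<^sub>R partial i f x)"
proof -
  have "linear (frechet_derivative f (at x))"
    by (rule has_derivative_linear[OF C1_has_derivative[OF assms]])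
  have "h = (\<Sum>i\<in>UNIV. h $ i *\<^sub>R axis i 1)"
    using basis_expansion[of h] by (simp add: scalar_mult_eq_scaleR)
  then have "frechet_derivative f (at x) h = frechet_derivative f (at x) (\<Sum>i\<in>UNIV. h $ i *\<^sub>R axis i 1)"
    by (rule arg_cong)
  also have "\<dots> = (\<Sum>i\<in>UNIV. frechet_derivative f (at x) (h $ i *\<^sub>R axis i 1))"
    by (rule linear_sum) fact
  finally have "frechet_derivative f (at x) h = (\<Sum>i\<in>UNIV. frechet_derivative f (at x) (h $ i *\<^sub>R axis i 1))" .
  then show ?thesis using \<open>linear (frechet_derivative f (at x))\<close> by (simp add: partial_def linear_scale)
qed

lemma norm_frechet_derivative_le:
  assumes "cont_diff f"
  shows "norm (frechet_derivative f (at x) h) \<le> norm h * norm (grad f x)"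
proof -
  have "norm (frechet_derivative f (at x) h) \<le> (\<Sum>i\<in>UNIV. \<bar>h $ i\<bar> * \<bar>norm (partial i f x)\<bar>)"
    unfolding frechet_derivative_sum_partial[OF assms] by (intro sum_norm_le) simp
  also have "\<dots> \<le> L2_set (\<lambda>i. h $ i) UNIV * L2_set (\<lambda>i. norm (partial i f x)) UNIV"
    by (rule L2_set_mult_ineq)
  also have "\<dots> = norm h * norm (grad f x)"
    by (simp add: norm_vec_def grad_def L2_set_def)
  finally show ?thesis .
qed

lemma integrable_continuous_bounded_support:
  fixes f :: "'a::euclidean_space \<Rightarrow> 'b::{banach, second_countable_topology}"
  assumes "continuous_on UNIV f" "\<And>x. f x \<noteq> 0 \<Longrightarrow> norm x \<le> R"
  shows "integrable lborel f"
proof -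
  have "integrable lborel (\<lambda>x. indicator (cball 0 R) x *\<^sub>R f x)"
    by (rule borel_integrable_compact) (auto intro: continuous_on_subset[OF assms(1)])
  moreover have "(\<lambda>x. indicator (cball 0 R) x *\<^sub>R f x) = f"
    using assms(2) by (auto simp: indicator_def fun_eq_iff)
  ultimately show ?thesis by simp
qed

lemma C1c_grad_support:
  assumes "cont_diff_cs f" and R: "\<And>x. f x \<noteq> 0 \<Longrightarrow> norm x \<le> R"
  shows "grad f x \<noteq> 0 \<Longrightarrow> norm x \<le> R" "partial i f x \<noteq> 0 \<Longrightarrow> norm x \<le> R"
proof -
  have "closure {x. f x \<noteq> 0} \<subseteq> cball 0 R" using R by (intro closure_minimal) auto
  then have *: "partial i f x = 0" if "\<not> norm x \<le> R" for i using that by (intro partial_zero_outside) auto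
  show "partial i f x \<noteq> 0 \<Longrightarrow> norm x \<le> R" using * by blast
  show "grad f x \<noteq> 0 \<Longrightarrow> norm x \<le> R" using * by (auto simp: grad_def vec_eq_iff)
qed

text \<open>The gradient is bounded on a ball by compactness and vanishes outside it, so the mean
  value inequality gives a global constant, which later dominates all difference quotients.\<close>

lemma C1c_lipschitz:
  assumes "cont_diff_cs f"
  obtains K where "K \<ge> 0" "\<And>x y. norm (f x - f y) \<le> K * norm (x - y)"
proof -
  obtain R where R: "R > 0" "\<And>x. f x \<noteq> 0 \<Longrightarrow> norm x \<le> R" using C1c_support[OF assms] by metis
  have C1: "cont_diff f" using assms by (rule C1c_imp_C1)
  have "compact (grad f ` cball 0 R)"
    by (intro compact_continuous_image continuous_on_subset[OF C1_continuous_grad[OF C1]]) auto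
  then obtain K where K: "K > 0" "\<And>x. x \<in> cball 0 R \<Longrightarrow> norm (grad f x) \<le> K"
    using compact_imp_bounded[of "grad f ` cball 0 R"] unfolding bounded_pos by auto
  have K': "norm (grad f x) \<le> K" for x
    using K C1c_grad_support(1)[OF assms R(2), of x] by (cases "grad f x = 0") auto
  show ?thesis
  proof (rule that[of K])
    show "norm (f x - f y) \<le> K * norm (x - y)" for x y
    proof (rule differentiable_bound[of UNIV])
      show "onorm (frechet_derivative f (at x)) \<le> K" for x
      proof (rule onorm_le)
        fix h show "norm (frechet_derivative f (at x) h) \<le> K * norm h"
          using norm_frechet_derivative_le[OF C1, of x h] mult_left_mono[OF K'[of x] norm_ge_zero[of h]]
          by (simp add: mult.commute)
      qed
    qed (use C1_has_derivative[OF C1] in auto)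
  qed (use K in simp)
qed

section \<open>Difference quotients, integration by parts and translations\<close>

lemma difference_quotient_LIMSEQ:
  assumes "cont_diff f"
  shows "(\<lambda>n. real (Suc n) *\<^sub>R (f (x + (1 / real (Suc n)) *\<^sub>R h) - f x)) \<longlonglongrightarrow> frechet_derivative f (at x) h"
proof -
  have "((\<lambda>t. f (x + t *\<^sub>R h)) has_vector_derivative frechet_derivative f (at x) h) (at 0)"
  proof -
    have g: "((\<lambda>t. x + t *\<^sub>R h) has_derivative (\<lambda>t. t *\<^sub>R h)) (at (0::real))"
      by (auto intro!: derivative_eq_intros)
    have "((\<lambda>t. f (x + t *\<^sub>R h)) has_derivative (\<lambda>t. frechet_derivative f (at x) (t *\<^sub>R h))) (at (0::real))"
      using has_derivative_compose[OF g, of f "frechet_derivative f (at x)"] C1_has_derivative[OF assms, of x] by simp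
    then show ?thesis
      using has_derivative_linear[OF C1_has_derivative[OF assms, of x]]
      by (simp add: has_vector_derivative_def linear_scale)
  qed
  then have "((\<lambda>t. norm (f (x + t *\<^sub>R h) - f x - t *\<^sub>R frechet_derivative f (at x) h) / norm t) \<longlongrightarrow> 0) (at 0)"
    by (simp add: has_vector_derivative_def has_derivative_iff_norm)
  then have "((\<lambda>t. norm ((1 / t) *\<^sub>R (f (x + t *\<^sub>R h) - f x) - frechet_derivative f (at x) h)) \<longlongrightarrow> 0) (at 0)"
  proof (rule Lim_transform_eventually)
    show "\<forall>\<^sub>F t in at 0. norm (f (x + t *\<^sub>R h) - f x - t *\<^sub>R frechet_derivative f (at x) h) / norm t =
        norm ((1 / t) *\<^sub>R (f (x + t *\<^sub>R h) - f x) - frechet_derivative f (at x) h)"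
      unfolding eventually_at_filter
    proof (intro always_eventually allI impI)
      fix t :: real assume t: "t \<noteq> 0"
      have eq: "(1 / t) *\<^sub>R a - b = (1 / t) *\<^sub>R (a - t *\<^sub>R b)" for a b :: complex
        unfolding scaleR_diff_right using t by simp
      show "norm (f (x + t *\<^sub>R h) - f x - t *\<^sub>R frechet_derivative f (at x) h) / norm t =
          norm ((1 / t) *\<^sub>R (f (x + t *\<^sub>R h) - f x) - frechet_derivative f (at x) h)"
        unfolding eq norm_scaleR by simp
    qed
  qed
  then have "((\<lambda>t. (1 / t) *\<^sub>R (f (x + t *\<^sub>R h) - f x)) \<longlongrightarrow> frechet_derivative f (at x) h) (at 0)"
    by (rule LIM_zero_cancel[OF tendsto_norm_zero_cancel])
  moreover have "filterlim (\<lambda>n. 1 / real (Suc n)) (at 0) sequentially"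
    unfolding filterlim_at using LIMSEQ_inverse_real_of_nat by (simp add: inverse_eq_divide)
  ultimately have "((\<lambda>n. (1 / (1 / real (Suc n))) *\<^sub>R (f (x + (1 / real (Suc n)) *\<^sub>R h) - f x)) \<longlonglongrightarrow> frechet_derivative f (at x) h)"
    by (rule filterlim_compose)
  then show ?thesis by simp
qed

lemma lborel_integral_translate:
  fixes f :: "'a::euclidean_space \<Rightarrow> 'b::{banach, second_countable_topology}"
  assumes "f \<in> borel_measurable borel"
  shows "(LINT x|lborel. f (c + x)) = (LINT x|lborel. f x)"
  using integral_distr[of "(+) c" lborel borel f] assms lborel_distr_plus[of c] by simp

lemma lborel_nn_integral_translate:
  fixes f :: "'a::euclidean_space \<Rightarrow> ennreal"
  assumes "f \<in> borel_measurable borel"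
  shows "(\<integral>\<^sup>+x. f (c + x) \<partial>lborel) = (\<integral>\<^sup>+x. f x \<partial>lborel)"
  using nn_integral_distr[of "(+) c" lborel borel f] assms lborel_distr_plus[of c] by simp

text \<open>One integrable majorant for all steps \<open>1 / real (Suc n)\<close>, as dominated
  convergence requires. The step vectors have norm at most \<open>norm h\<close>, so all quotients
  vanish outside a ball whose radius is enlarged by \<open>norm h\<close>.\<close>

lemma difference_quotient_dominated:
  assumes "cont_diff_cs f"
  obtains B R where "B \<ge> 0"
    "\<And>n x. norm (real (Suc n) *\<^sub>R (f (x + (1 / real (Suc n)) *\<^sub>R h) - f x)) \<le> B * indicator (cball 0 R) x"
proof -
  obtain R where R: "R > 0" "\<And>x. f x \<noteq> 0 \<Longrightarrow> norm x \<le> R" using C1c_support[OF assms] by metis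
  obtain K where K: "K \<ge> 0" "\<And>x y. norm (f x - f y) \<le> K * norm (x - y)" using C1c_lipschitz[OF assms] by metis
  show ?thesis
  proof (rule that[of "K * norm h" "R + norm h"])
    fix n x
    have *: "norm (real (Suc n) *\<^sub>R (f (x + (1 / real (Suc n)) *\<^sub>R h) - f x)) \<le> K * norm h"
    proof -
      have "norm (f (x + (1 / real (Suc n)) *\<^sub>R h) - f x) \<le> K * (norm h / real (Suc n))"
        using K(2)[of "x + (1 / real (Suc n)) *\<^sub>R h" x] by simp
      then have "real (Suc n) * norm (f (x + (1 / real (Suc n)) *\<^sub>R h) - f x) \<le> real (Suc n) * (K * (norm h / real (Suc n)))"
        by (intro mult_left_mono) auto
      then show ?thesis by (simp del: of_nat_Suc)
    qed
    show "norm (real (Suc n) *\<^sub>R (f (x + (1 / real (Suc n)) *\<^sub>R h) - f x)) \<le> K * norm h * indicator (cball 0 (R + norm h)) x"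
    proof (cases "norm x \<le> R + norm h")
      case True then show ?thesis using * by simp
    next
      case False
      have "norm x \<le> norm (x + (1 / real (Suc n)) *\<^sub>R h) + norm ((1 / real (Suc n)) *\<^sub>R h)"
        using norm_triangle_ineq4[of "x + (1 / real (Suc n)) *\<^sub>R h" "(1 / real (Suc n)) *\<^sub>R h"] by simp
      moreover have "norm ((1 / real (Suc n)) *\<^sub>R h) \<le> norm h" using mult_left_mono[of 1 "real (Suc n)" "norm h"] by (simp add: divide_le_eq)
      ultimately have "f (x + (1 / real (Suc n)) *\<^sub>R h) = 0" "f x = 0"
        using False R(2)[of x] R(2)[of "x + (1 / real (Suc n)) *\<^sub>R h"] norm_ge_zero[of h] by (linarith|force)+
      then show ?thesis using K(1) by simp
    qed
  qed (use K in simp)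
qed

lemma integrable_cball_const:
  "integrable lborel (\<lambda>x :: 'a::euclidean_space. B * indicator (cball 0 R) x :: real)"
  by (intro Bochner_Integration.integrable_mult_right integrable_real_indicator) (use emeasure_bounded_finite[of "cball (0::'a) R"] in \<open>auto simp: less_top\<close>)

text \<open>Translation invariance makes the integral of every difference quotient zero, and the
  limit inherits this.\<close>

lemma C1c_integral_derivative_zero:
  assumes "cont_diff_cs f"
  shows "(LINT x|lborel. frechet_derivative f (at x) h) = 0"
proof -
  have C1: "cont_diff f" using assms by (rule C1c_imp_C1)
  have [measurable]: "f \<in> borel_measurable borel" by (rule borel_measurable_continuous_onI[OF C1_continuous[OF C1]])
  obtain R where R: "R > 0" "\<And>x. f x \<noteq> 0 \<Longrightarrow> norm x \<le> R" using C1c_support[OF assms] by metis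
  have int: "integrable lborel f" by (rule integrable_continuous_bounded_support[OF C1_continuous[OF C1] R(2)])
  have int2: "integrable lborel (\<lambda>x. f (x + c))" for c
    using integrable_distr[of "(+) c" lborel borel f] int lborel_distr_plus[of c] by (simp add: add.commute)
  obtain B R' where BR: "B \<ge> 0" "\<And>n x. norm (real (Suc n) *\<^sub>R (f (x + (1 / real (Suc n)) *\<^sub>R h) - f x)) \<le> B * indicator (cball 0 R') x"
    using difference_quotient_dominated[OF assms, of h] by metis
  have "(\<lambda>n. LINT x|lborel. real (Suc n) *\<^sub>R (f (x + (1 / real (Suc n)) *\<^sub>R h) - f x)) \<longlonglongrightarrow>
      (LINT x|lborel. frechet_derivative f (at x) h)"
  proof (rule integral_dominated_convergence[where w = "\<lambda>x. B * indicator (cball 0 R') x"])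
    show "(\<lambda>x. frechet_derivative f (at x) h) \<in> borel_measurable lborel"
      unfolding frechet_derivative_sum_partial[OF C1]
      using borel_measurable_continuous_onI[OF C1_continuous_partial[OF C1]] by measurable
    show "AE x in lborel. (\<lambda>n. real (Suc n) *\<^sub>R (f (x + (1 / real (Suc n)) *\<^sub>R h) - f x)) \<longlonglongrightarrow> frechet_derivative f (at x) h"
      by (intro always_eventually allI difference_quotient_LIMSEQ C1)
    show "AE x in lborel. norm (real (Suc n) *\<^sub>R (f (x + (1 / real (Suc n)) *\<^sub>R h) - f x)) \<le> B * indicator (cball 0 R') x" for n
      by (intro always_eventually allI BR(2))
    show "(\<lambda>x. real (Suc n) *\<^sub>R (f (x + (1 / real (Suc n)) *\<^sub>R h) - f x)) \<in> borel_measurable lborel" for n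
      by measurable
  qed (rule integrable_cball_const)
  moreover have "(LINT x|lborel. real (Suc n) *\<^sub>R (f (x + (1 / real (Suc n)) *\<^sub>R h) - f x)) = 0" for n
  proof -
    have "(LINT x|lborel. f (x + (1 / real (Suc n)) *\<^sub>R h)) = (LINT x|lborel. f x)"
      using lborel_integral_translate[of f "(1 / real (Suc n)) *\<^sub>R h"] by (simp add: add.commute)
    then show ?thesis using int int2 by (simp del: of_nat_Suc)
  qed
  ultimately show ?thesis by (simp add: LIMSEQ_const_iff)
qed

lemma C1c_integral_partial_zero: "cont_diff_cs f \<Longrightarrow> (LINT x|lborel. partial i f x) = 0"
  using C1c_integral_derivative_zero[of f "axis i 1"] by (simp add: partial_def)

text \<open>The product \<open>f * g\<close> has bounded support because \<open>g\<close> has, so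
  its partial derivatives integrate to zero.\<close>

lemma integration_by_parts:
  assumes f: "cont_diff f" and g: "cont_diff_cs g"
  shows "(LINT x|lborel. f x * partial i g x) = - (LINT x|lborel. partial i f x * g x)"
proof -
  obtain R where R: "R > 0" "\<And>x. g x \<noteq> 0 \<Longrightarrow> norm x \<le> R" using C1c_support[OF g] by metis
  note c = C1_continuous[OF f] C1_continuous_partial[OF f] C1_continuous[OF C1c_imp_C1[OF g]] C1_continuous_partial[OF C1c_imp_C1[OF g]]
  have 1: "integrable lborel (\<lambda>x. f x * partial i g x)"
    by (rule integrable_continuous_bounded_support[of _ R]) (use c C1c_grad_support(2)[OF g R(2)] in \<open>auto intro: continuous_intros\<close>)
  have 2: "integrable lborel (\<lambda>x. partial i f x * g x)"
    by (rule integrable_continuous_bounded_support[of _ R]) (use c R(2) in \<open>auto intro: continuous_intros\<close>)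
  have "(LINT x|lborel. f x * partial i g x + partial i f x * g x) = 0"
    using C1c_integral_partial_zero[OF C1c_mult[OF f g], of i] f C1c_imp_C1[OF g]
    by (simp add: partial_mult C1_differentiable)
  then show ?thesis using 1 2 by (simp add: eq_neg_iff_add_eq_0)
qed

text \<open>Splitting \<open>h\<close> into \<open>N\<close> equal steps bounds the left-hand side by the integral of a difference
  quotient with step \<open>h / N\<close>, and \<open>N \<rightarrow> \<infinity>\<close> gives the derivative.\<close>

lemma translation_estimate:
  fixes f :: "real^'n::finite \<Rightarrow> complex"
  assumes "cont_diff_cs f"
  shows "(LINT x|lborel. (norm (f (x + h) - f x))\<^sup>2) \<le> (norm h)\<^sup>2 * (LINT x|lborel. (norm (grad f x))\<^sup>2)"
proof -
  have C1: "cont_diff f" using assms by (rule C1c_imp_C1)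
  note c = C1_continuous[OF C1]
  have m[measurable]: "f \<in> borel_measurable borel" by (rule borel_measurable_continuous_onI[OF c])
  obtain R where R: "R > 0" "\<And>x. f x \<noteq> 0 \<Longrightarrow> norm x \<le> R" using C1c_support[OF assms] by metis
  have int: "integrable lborel (\<lambda>x. (norm (f (x + a) - f (x + b)))\<^sup>2)" for a b
  proof (rule integrable_continuous_bounded_support[of _ "R + norm a + norm b"])
    show "continuous_on UNIV (\<lambda>x. (norm (f (x + a) - f (x + b)))\<^sup>2)"
      by (intro continuous_intros continuous_on_compose2[OF c]) auto
    fix x assume "(norm (f (x + a) - f (x + b)))\<^sup>2 \<noteq> 0"
    then have "f (x + a) \<noteq> 0 \<or> f (x + b) \<noteq> 0" by auto
    then have "norm (x + a) \<le> R \<or> norm (x + b) \<le> R" using R(2) by auto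
    moreover have "norm x \<le> norm (x + a) + norm a" "norm x \<le> norm (x + b) + norm b"
      using norm_triangle_ineq4[of "x + a" a] norm_triangle_ineq4[of "x + b" b] by simp_all
    ultimately show "norm x \<le> R + norm a + norm b"
      using norm_ge_zero[of a] norm_ge_zero[of b] by argo
  qed
  define q where "q n x = real (Suc n) *\<^sub>R (f (x + (1 / real (Suc n)) *\<^sub>R h) - f x)" for n x
  have step: "(LINT x|lborel. (norm (f (x + h) - f x))\<^sup>2) \<le> (LINT x|lborel. (norm (q n x))\<^sup>2)" for n
  proof -
    define N where "N = Suc n"
    define s where "s = (1 / real N) *\<^sub>R h"
    have N: "N > 0" "real N *\<^sub>R s = h" by (auto simp: N_def s_def)
    \<comment> \<open>Telescoping and Cauchy-Schwarz cost one factor \<open>N\<close>. A second one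
      comes from the \<open>N\<close> integrals below, equal by translation invariance, and
      \<open>(real N)\<^sup>2\<close> turns the increment into the quotient
      \<open>q n\<close>.\<close>
    have pt: "(norm (f (x + h) - f x))\<^sup>2 \<le> real N * (\<Sum>j<N. (norm (f (x + real (Suc j) *\<^sub>R s) - f (x + real j *\<^sub>R s)))\<^sup>2)" for x
    proof -
      have "f (x + h) - f x = (\<Sum>j<N. f (x + real (Suc j) *\<^sub>R s) - f (x + real j *\<^sub>R s))"
        unfolding sum_lessThan_telescope[of "\<lambda>j. f (x + real j *\<^sub>R s)"] using N by simp
      then have "norm (f (x + h) - f x) \<le> (\<Sum>j<N. norm (f (x + real (Suc j) *\<^sub>R s) - f (x + real j *\<^sub>R s)))"
        by (simp only: norm_sum)
      then have "(norm (f (x + h) - f x))\<^sup>2 \<le> (\<Sum>j<N. norm (f (x + real (Suc j) *\<^sub>R s) - f (x + real j *\<^sub>R s)))\<^sup>2"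
        by (intro power_mono) auto
      also have "\<dots> \<le> (\<Sum>j<N. (norm (f (x + real (Suc j) *\<^sub>R s) - f (x + real j *\<^sub>R s)))\<^sup>2) * real (card {..<N})"
        by (rule sum_squared_le_sum_of_squares)
      finally show ?thesis by (simp add: mult.commute)
    qed
    have "(LINT x|lborel. (norm (f (x + h) - f x))\<^sup>2) \<le>
        (LINT x|lborel. real N * (\<Sum>j<N. (norm (f (x + real (Suc j) *\<^sub>R s) - f (x + real j *\<^sub>R s)))\<^sup>2))"
      using int[of h 0] by (intro integral_mono pt Bochner_Integration.integrable_mult_right Bochner_Integration.integrable_sum int) simp
    also have "\<dots> = real N * (\<Sum>j<N. (LINT x|lborel. (norm (f (x + real (Suc j) *\<^sub>R s) - f (x + real j *\<^sub>R s)))\<^sup>2))"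
      using int by (simp del: of_nat_Suc)
    also have "\<dots> = real N * (\<Sum>j<N. (LINT x|lborel. (norm (f (x + s) - f x))\<^sup>2))"
    proof -
      have "(LINT x|lborel. (norm (f (x + real (Suc j) *\<^sub>R s) - f (x + real j *\<^sub>R s)))\<^sup>2) = (LINT x|lborel. (norm (f (x + s) - f x))\<^sup>2)" for j
        using lborel_integral_translate[of "\<lambda>x. (norm (f (x + s) - f x))\<^sup>2" "real j *\<^sub>R s"]
        by (simp add: algebra_simps)
      then show ?thesis by simp
    qed
    also have "\<dots> = (LINT x|lborel. (norm (q n x))\<^sup>2)"
    proof -
      have "(\<lambda>x. (norm (q n x))\<^sup>2) = (\<lambda>x. (real N)\<^sup>2 * (norm (f (x + s) - f x))\<^sup>2)"
        by (simp add: fun_eq_iff q_def N_def s_def power_mult_distrib del: of_nat_Suc)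
      then show ?thesis by (simp add: power2_eq_square[of "real N"] mult.assoc)
    qed
    finally show ?thesis .
  qed
  obtain B R' where BR: "B \<ge> 0" "\<And>n x. norm (q n x) \<le> B * indicator (cball 0 R') x"
    using difference_quotient_dominated[OF assms, of h] unfolding q_def by metis
  have D: "(\<lambda>x. frechet_derivative f (at x) h) \<in> borel_measurable borel"
    unfolding frechet_derivative_sum_partial[OF C1]
    using borel_measurable_continuous_onI[OF C1_continuous_partial[OF C1]] by measurable
  have "(\<lambda>n. LINT x|lborel. (norm (q n x))\<^sup>2) \<longlonglongrightarrow> (LINT x|lborel. (norm (frechet_derivative f (at x) h))\<^sup>2)"
  proof (rule integral_dominated_convergence[where w = "\<lambda>x. B\<^sup>2 * indicator (cball 0 R') x"])
    show "AE x in lborel. (\<lambda>n. (norm (q n x))\<^sup>2) \<longlonglongrightarrow> (norm (frechet_derivative f (at x) h))\<^sup>2"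
      unfolding q_def by (intro always_eventually allI tendsto_intros difference_quotient_LIMSEQ C1)
    show "AE x in lborel. norm ((norm (q n x))\<^sup>2) \<le> B\<^sup>2 * indicator (cball 0 R') x" for n
    proof (intro always_eventually allI)
      fix x
      have "(norm (q n x))\<^sup>2 \<le> (B * indicator (cball 0 R') x)\<^sup>2" using BR by (intro power_mono) auto
      then show "norm ((norm (q n x))\<^sup>2) \<le> B\<^sup>2 * indicator (cball 0 R') x"
        by (auto simp: indicator_def power_mult_distrib split: if_splits)
    qed
    show "(\<lambda>x. (norm (q n x))\<^sup>2) \<in> borel_measurable lborel" for n unfolding q_def by measurable
    show "(\<lambda>x. (norm (frechet_derivative f (at x) h))\<^sup>2) \<in> borel_measurable lborel" using D by measurable
  qed (rule integrable_cball_const)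
  then have "(LINT x|lborel. (norm (f (x + h) - f x))\<^sup>2) \<le> (LINT x|lborel. (norm (frechet_derivative f (at x) h))\<^sup>2)"
    using step by (intro LIMSEQ_le_const) auto
  also have "\<dots> \<le> (LINT x|lborel. (norm h)\<^sup>2 * (norm (grad f x))\<^sup>2)"
  proof (rule integral_mono)
    have gi: "integrable lborel (\<lambda>x. (norm (grad f x))\<^sup>2)"
      by (rule integrable_continuous_bounded_support[of _ R])
         (use C1c_grad_support(1)[OF assms R(2)] in \<open>auto intro!: continuous_intros C1_continuous_grad C1\<close>)
    then show gi': "integrable lborel (\<lambda>x. (norm h)\<^sup>2 * (norm (grad f x))\<^sup>2)" by simp
    show le: "(norm (frechet_derivative f (at x) h))\<^sup>2 \<le> (norm h)\<^sup>2 * (norm (grad f x))\<^sup>2" for x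
      unfolding power_mult_distrib[symmetric] by (intro power_mono norm_frechet_derivative_le C1) simp
    show "integrable lborel (\<lambda>x. (norm (frechet_derivative f (at x) h))\<^sup>2)"
      by (rule Bochner_Integration.integrable_bound[OF gi']) (use D le in auto)
  qed
  finally show ?thesis by simp
qed

section \<open>Cubic cells and the compactness estimate\<close>

text \<open>For positive \<open>\<delta>\<close> these are half-open cubes of side
  \<open>\<delta>\<close> indexed by integer vectors; every point lies in exactly one.\<close>

definition cell :: "real \<Rightarrow> ('n \<Rightarrow> int) \<Rightarrow> (real^'n::finite) set" where
  "cell \<delta> k = {x. \<forall>i. \<lfloor>x $ i / \<delta>\<rfloor> = k i}"

lemma mem_cell_iff:
  "0 < \<delta> \<Longrightarrow> x \<in> cell \<delta> k \<longleftrightarrow> (\<forall>i. real_of_int (k i) * \<delta> \<le> x $ i \<and> x $ i < (real_of_int (k i) + 1) * \<delta>)"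
  unfolding cell_def by (simp add: floor_eq_iff pos_le_divide_eq pos_divide_less_eq)

lemma cell_borel [measurable]: "0 < \<delta> \<Longrightarrow> cell \<delta> k \<in> sets borel"
proof -
  assume "0 < \<delta>"
  then have "cell \<delta> k = (\<Inter>i. {x. real_of_int (k i) * \<delta> \<le> x $ i} \<inter> {x. x $ i < (real_of_int (k i) + 1) * \<delta>})"
    by (auto simp: mem_cell_iff)
  also have "\<dots> \<in> sets borel"
    by (intro sets.countable_INT' sets.Int borel_closed closed_halfspace_component_ge_cart borel_open open_halfspace_component_lt_cart) auto
  finally show ?thesis .
qed

lemma emeasure_cell:
  fixes k :: "'n::finite \<Rightarrow> int"
  assumes "0 < \<delta>"
  shows "emeasure lborel (cell \<delta> k) = ennreal (\<delta> ^ CARD('n))"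
proof -
  define l :: "real^'n" where "l = (\<chi> i. real_of_int (k i) * \<delta>)"
  define u :: "real^'n" where "u = (\<chi> i. (real_of_int (k i) + 1) * \<delta>)"
  have B: "(u - l) \<bullet> b = \<delta> \<and> l \<bullet> b \<le> u \<bullet> b" if b: "b \<in> Basis" for b
  proof -
    obtain i where "b = axis i 1" using b by (auto simp: Basis_vec_def)
    then show ?thesis using assms by (simp add: l_def u_def inner_axis algebra_simps)
  qed
  have m: "(\<Prod>b\<in>Basis. (u - l) \<bullet> b) = \<delta> ^ CARD('n)" using B by simp
  have sub: "box l u \<subseteq> cell \<delta> k" "cell \<delta> k \<subseteq> cbox l u"
    using assms by (auto simp: mem_cell_iff mem_box_cart l_def u_def less_imp_le)
  have "emeasure lborel (box l u) \<le> emeasure lborel (cell \<delta> k)"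
    using assms by (intro emeasure_mono sub) (simp add: cell_borel)
  moreover have "emeasure lborel (cell \<delta> k) \<le> emeasure lborel (cbox l u)"
    by (intro emeasure_mono sub) simp
  moreover have "emeasure lborel (box l u) = ennreal (\<delta> ^ CARD('n))"
    using B m by (subst emeasure_lborel_box) auto
  moreover have "emeasure lborel (cbox l u) = ennreal (\<delta> ^ CARD('n))"
    using B m by (subst emeasure_lborel_cbox) auto
  ultimately show ?thesis by (simp add: order_antisym)
qed

text \<open>Cauchy-Schwarz against the indicator of the cell, whose measure is the first factor. The
  right-hand side is a nonnegative integral, so it is meaningful without square integrability of
  \<open>f\<close> over the cell.\<close>

lemma Cauchy_Schwarz_cell:
  fixes f :: "real^'n::finite \<Rightarrow> complex"
  assumes \<delta>: "0 < \<delta>" and f: "integrable lborel (\<lambda>x. indicator (cell \<delta> k) x *\<^sub>R f x)"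
    and m[measurable]: "f \<in> borel_measurable borel"
  shows "ennreal ((norm (LINT x|lborel. indicator (cell \<delta> k) x *\<^sub>R f x))\<^sup>2)
    \<le> ennreal (\<delta> ^ CARD('n)) * (\<integral>\<^sup>+x. indicator (cell \<delta> k) x * ennreal ((norm (f x))\<^sup>2) \<partial>lborel)"
proof -
  note [measurable] = cell_borel[OF \<delta>]
  have "ennreal ((norm (LINT x|lborel. indicator (cell \<delta> k) x *\<^sub>R f x))\<^sup>2)
    = (ennreal (norm (LINT x|lborel. indicator (cell \<delta> k) x *\<^sub>R f x)))\<^sup>2" by (simp add: ennreal_power)
  also have "\<dots> \<le> (\<integral>\<^sup>+x. ennreal (norm (indicator (cell \<delta> k) x *\<^sub>R f x)) \<partial>lborel)\<^sup>2"
    by (intro power_mono integral_norm_bound_ennreal f) simp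
  also have "\<dots> = (\<integral>\<^sup>+x. indicator (cell \<delta> k) x * (indicator (cell \<delta> k) x * ennreal (norm (f x))) \<partial>lborel)\<^sup>2"
    by (intro arg_cong[of _ _ "\<lambda>t. t\<^sup>2"] nn_integral_cong) (auto simp: indicator_def)
  also have "\<dots> \<le> (\<integral>\<^sup>+x. (indicator (cell \<delta> k) x)\<^sup>2 \<partial>lborel) * (\<integral>\<^sup>+x. (indicator (cell \<delta> k) x * ennreal (norm (f x)))\<^sup>2 \<partial>lborel)"
    by (intro Cauchy_Schwarz_nn_integral) measurable
  also have "(\<integral>\<^sup>+x. (indicator (cell \<delta> k) x)\<^sup>2 \<partial>lborel) = (\<integral>\<^sup>+x. indicator (cell \<delta> k) x \<partial>(lborel :: (real^'n) measure))"
    by (intro nn_integral_cong) (auto simp: indicator_def)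
  also have "\<dots> = ennreal (\<delta> ^ CARD('n))" using \<delta> by (simp add: emeasure_cell cell_borel)
  also have "(\<integral>\<^sup>+x. (indicator (cell \<delta> k) x * ennreal (norm (f x)))\<^sup>2 \<partial>lborel) = (\<integral>\<^sup>+x. indicator (cell \<delta> k) x * ennreal ((norm (f x))\<^sup>2) \<partial>lborel)"
    by (intro nn_integral_cong) (auto simp: indicator_def ennreal_power)
  finally show ?thesis .
qed

lemma finite_int_functions: "finite {k :: 'n::finite \<Rightarrow> int. \<forall>i. k i \<in> {-B..B}}"
proof -
  have "{k :: 'n \<Rightarrow> int. \<forall>i. k i \<in> {-B..B}} = (\<Pi>\<^sub>E i\<in>UNIV. {-B..B})"
    by (auto simp: PiE_def Pi_def)
  then show ?thesis by (simp add: finite_PiE)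
qed

lemma integrable_C1c:
  fixes f :: "real^'n::finite \<Rightarrow> complex"
  assumes "cont_diff_cs f"
  shows integrable_C1c_fun: "integrable lborel f"
    and integrable_C1c_norm2: "integrable lborel (\<lambda>x. (norm (f x))\<^sup>2)"
    and integrable_C1c_grad2: "integrable lborel (\<lambda>x. (norm (grad f x))\<^sup>2)"
proof -
  obtain R where R: "R > 0" "\<And>x. f x \<noteq> 0 \<Longrightarrow> norm x \<le> R" using C1c_support[OF assms] by metis
  note C1 = C1c_imp_C1[OF assms]
  show "integrable lborel f" by (rule integrable_continuous_bounded_support[OF C1_continuous[OF C1] R(2)])
  show "integrable lborel (\<lambda>x. (norm (f x))\<^sup>2)"
    by (rule integrable_continuous_bounded_support[of _ R])
       (use R(2) in \<open>auto intro!: continuous_intros C1_continuous C1\<close>)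
  show "integrable lborel (\<lambda>x. (norm (grad f x))\<^sup>2)"
    by (rule integrable_continuous_bounded_support[of _ R])
       (use C1c_grad_support(1)[OF assms R(2)] in \<open>auto intro!: continuous_intros C1_continuous_grad C1\<close>)
qed

text \<open>Since the integrals of \<open>f\<close> over the cells are finitely many functionals, this is the compactness
  estimate behind Rellich's theorem.\<close>

lemma cell_Poincare:
  fixes f :: "real^'n::finite \<Rightarrow> complex"
  assumes f: "cont_diff_cs f" and \<delta>: "0 < \<delta>" and K: "finite K" "\<And>x. f x \<noteq> 0 \<Longrightarrow> \<exists>k\<in>K. x \<in> cell \<delta> k"
  shows "\<delta> ^ CARD('n) * (LINT x|lborel. (norm (f x))\<^sup>2) \<le>
     2 * (\<Sum>k\<in>K. (norm (LINT x|lborel. indicator (cell \<delta> k) x *\<^sub>R f x))\<^sup>2)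
     + 2 * (2 * \<delta>) ^ CARD('n) * (real CARD('n) * \<delta>\<^sup>2) * (LINT x|lborel. (norm (grad f x))\<^sup>2)"
proof -
  note [measurable] = cell_borel[OF \<delta>]
  define c where "c = \<delta> ^ CARD('n)"
  have c: "c > 0" using \<delta> by (simp add: c_def)
  have C1: "cont_diff f" using f by (rule C1c_imp_C1)
  have m[measurable]: "f \<in> borel_measurable borel" by (rule borel_measurable_continuous_onI[OF C1_continuous[OF C1]])
  define E where "E = (LINT x|lborel. (norm (grad f x))\<^sup>2)"
  \<comment> \<open>The cube of side \<open>2 * \<delta>\<close> contains all differences of two
    points of one cell.\<close>
  define Q where "Q = cbox (\<chi> i. -\<delta>) ((\<chi> i. \<delta>) :: real^'n)"
  \<comment> \<open>\<open>g x\<close> bounds the oscillation around \<open>x\<close> within its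
    cell whichever cell that is, so it can be integrated over the whole space at once.\<close>
  define g where "g x = (\<integral>\<^sup>+z. indicator Q z * ennreal ((norm (f (x + z) - f x))\<^sup>2) \<partial>lborel)" for x
  define a where "a k = (LINT x|lborel. indicator (cell \<delta> k) x *\<^sub>R f x)" for k
  have [measurable]: "Q \<in> sets borel" by (simp add: Q_def)
  have Qm: "emeasure lborel Q = ennreal ((2 * \<delta>) ^ CARD('n))"
  proof -
    have B: "((\<chi> i. \<delta>) - (\<chi> i. -\<delta>)) \<bullet> b = 2 * \<delta> \<and> (\<chi> i. -\<delta>) \<bullet> b \<le> (\<chi> i. \<delta>) \<bullet> b" if b: "b \<in> Basis" for b :: "real^'n"
    proof -
      obtain i where "b = axis i 1" using b by (auto simp: Basis_vec_def)
      then show ?thesis using \<delta> by (simp add: inner_axis)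
    qed
    then have "(\<Prod>b\<in>(Basis :: (real^'n) set). ((\<chi> i. \<delta>) - (\<chi> i. -\<delta>)) \<bullet> b) = (2 * \<delta>) ^ CARD('n)" by simp
    then show ?thesis unfolding Q_def using B by (subst emeasure_lborel_cbox) auto
  qed
  have gint: "(\<integral>\<^sup>+x. g x \<partial>lborel) \<le> ennreal ((2 * \<delta>) ^ CARD('n) * (real CARD('n) * \<delta>\<^sup>2) * E)"
  proof -
    \<comment> \<open>After Fubini the inner integral has a fixed shift \<open>z\<close> in
      \<open>Q\<close>, to which the translation estimate applies with
      \<open>(norm z)\<^sup>2 \<le> real CARD('n) * \<delta>\<^sup>2\<close>.\<close>
    have "(\<integral>\<^sup>+x. g x \<partial>lborel) = (\<integral>\<^sup>+z. (\<integral>\<^sup>+x. indicator Q z * ennreal ((norm (f (x + z) - f x))\<^sup>2) \<partial>lborel) \<partial>lborel)"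
      unfolding g_def by (rule lborel_pair.Fubini') measurable
    also have "\<dots> \<le> (\<integral>\<^sup>+z. ennreal (real CARD('n) * \<delta>\<^sup>2 * E) * indicator Q z \<partial>lborel)"
    proof (rule nn_integral_mono)
      fix z :: "real^'n"
      show "(\<integral>\<^sup>+x. indicator Q z * ennreal ((norm (f (x + z) - f x))\<^sup>2) \<partial>lborel) \<le> ennreal (real CARD('n) * \<delta>\<^sup>2 * E) * indicator Q z"
      proof (cases "z \<in> Q")
        case True
        have "(norm z)\<^sup>2 = (\<Sum>i\<in>UNIV. (z $ i)\<^sup>2)" by (simp add: norm_vec_def L2_set_def sum_nonneg)
        also have "\<dots> \<le> (\<Sum>i\<in>(UNIV :: 'n set). \<delta>\<^sup>2)"
        proof (rule sum_mono)
          fix i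
          have "- \<delta> \<le> z $ i" "z $ i \<le> \<delta>" using True by (auto simp: Q_def mem_box_cart)
          then show "(z $ i)\<^sup>2 \<le> \<delta>\<^sup>2" using \<delta> by (subst power2_le_iff_abs_le) auto
        qed
        finally have z: "(norm z)\<^sup>2 \<le> real CARD('n) * \<delta>\<^sup>2" by simp
        have i: "integrable lborel (\<lambda>x. (norm (f (x + z) - f x))\<^sup>2)"
        proof -
          obtain R where R: "R > 0" "\<And>x. f x \<noteq> 0 \<Longrightarrow> norm x \<le> R" using C1c_support[OF f] by metis
          show ?thesis
          proof (rule integrable_continuous_bounded_support[of _ "R + norm z"])
            show "continuous_on UNIV (\<lambda>x. (norm (f (x + z) - f x))\<^sup>2)"
              by (intro continuous_intros continuous_on_compose2[OF C1_continuous[OF C1]]) auto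
            fix x assume "(norm (f (x + z) - f x))\<^sup>2 \<noteq> 0"
            then have "f (x + z) \<noteq> 0 \<or> f x \<noteq> 0" by auto
            then have "norm (x + z) \<le> R \<or> norm x \<le> R" using R(2) by auto
            moreover have "norm x \<le> norm (x + z) + norm z"
              using norm_triangle_ineq4[of "x + z" z] by simp
            ultimately show "norm x \<le> R + norm z" using norm_ge_zero[of z] by argo
          qed
        qed
        have "(\<integral>\<^sup>+x. ennreal ((norm (f (x + z) - f x))\<^sup>2) \<partial>lborel) = ennreal (LINT x|lborel. (norm (f (x + z) - f x))\<^sup>2)"
          by (rule nn_integral_eq_integral[OF i]) simp
        also have "\<dots> \<le> ennreal ((norm z)\<^sup>2 * E)"
          unfolding E_def by (intro ennreal_leI translation_estimate f)
        also have "\<dots> \<le> ennreal (real CARD('n) * \<delta>\<^sup>2 * E)"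
          using z by (intro ennreal_leI mult_right_mono) (auto simp: E_def)
        finally show ?thesis using True by simp
      qed simp
    qed
    also have "\<dots> = ennreal (real CARD('n) * \<delta>\<^sup>2 * E) * ennreal ((2 * \<delta>) ^ CARD('n))"
      by (subst nn_integral_cmult) (simp_all add: Qm)
    also have "\<dots> = ennreal ((2 * \<delta>) ^ CARD('n) * (real CARD('n) * \<delta>\<^sup>2) * E)"
      using \<delta> by (subst ennreal_mult[symmetric]) (auto simp: E_def ac_simps)
    finally show ?thesis .
  qed
  have cellint: "integrable lborel (\<lambda>y. indicator (cell \<delta> k) y *\<^sub>R (f y - b))" for k b
  proof -
    have "integrable lborel (\<lambda>y. indicator (cell \<delta> k) y *\<^sub>R f y - indicator (cell \<delta> k) y *\<^sub>R b)"
    proof (rule Bochner_Integration.integrable_diff)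
      show "integrable lborel (\<lambda>y. indicator (cell \<delta> k) y *\<^sub>R f y)"
        by (intro integrable_mult_indicator integrable_C1c_fun f) simp
      show "integrable lborel (\<lambda>y. indicator (cell \<delta> k) y *\<^sub>R b)"
        using \<delta> by (intro integrable_scaleR_left integrable_real_indicator) (auto simp: emeasure_cell cell_borel)
    qed
    then show ?thesis by (simp add: scaleR_diff_right)
  qed
  have pt: "ennreal (c\<^sup>2 * (norm (f x))\<^sup>2) \<le> ennreal (2 * (norm (a k))\<^sup>2) + ennreal (2 * c) * g x"
    if x: "x \<in> cell \<delta> k" for x k
  proof -
    \<comment> \<open>\<open>c\<close> times the value at \<open>x\<close> is the cell integral
      \<open>a k\<close> minus the integrated oscillation \<open>d\<close>.\<close>
    define d where "d = (LINT y|lborel. indicator (cell \<delta> k) y *\<^sub>R (f y - f x))"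
    have "d = a k - (LINT y|lborel. indicator (cell \<delta> k) y *\<^sub>R f x)"
      unfolding d_def a_def using cellint[of k 0] cellint[of k "f x"] \<delta>
      by (subst Bochner_Integration.integral_diff[symmetric])
         (auto simp: scaleR_diff_right emeasure_cell cell_borel)
    also have "(LINT y|lborel. indicator (cell \<delta> k) y *\<^sub>R f x) = c *\<^sub>R f x"
      using \<delta> by (simp add: measure_def emeasure_cell cell_borel c_def)
    finally have "c *\<^sub>R f x = a k + (- d)" by simp
    then have "(norm (c *\<^sub>R f x))\<^sup>2 \<le> 2 * (norm (a k))\<^sup>2 + 2 * (norm d)\<^sup>2"
      using norm_add_squared_le[of "a k" "- d"] by simp
    then have "ennreal (c\<^sup>2 * (norm (f x))\<^sup>2) \<le> ennreal (2 * (norm (a k))\<^sup>2) + ennreal (2 * (norm d)\<^sup>2)"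
      using c by (simp add: power_mult_distrib ennreal_plus[symmetric] ennreal_leI del: ennreal_plus)
    also have "ennreal (2 * (norm d)\<^sup>2) = 2 * ennreal ((norm d)\<^sup>2)" by (simp add: ennreal_mult)
    also have "ennreal ((norm d)\<^sup>2) \<le> ennreal c * (\<integral>\<^sup>+y. indicator (cell \<delta> k) y * ennreal ((norm (f y - f x))\<^sup>2) \<partial>lborel)"
      unfolding d_def c_def by (rule Cauchy_Schwarz_cell[OF \<delta> cellint]) measurable
    also have "(\<integral>\<^sup>+y. indicator (cell \<delta> k) y * ennreal ((norm (f y - f x))\<^sup>2) \<partial>lborel)
       = (\<integral>\<^sup>+z. indicator (cell \<delta> k) (x + z) * ennreal ((norm (f (x + z) - f x))\<^sup>2) \<partial>lborel)"
      by (rule lborel_nn_integral_translate[symmetric]) measurable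
    also have "\<dots> \<le> g x"
      unfolding g_def
    proof (intro nn_integral_mono mult_right_mono)
      fix z
      have "z \<in> Q" if "x + z \<in> cell \<delta> k"
      proof -
        have "\<bar>z $ i\<bar> \<le> \<delta>" for i
        proof -
          have "real_of_int (k i) * \<delta> \<le> x $ i" "x $ i < real_of_int (k i) * \<delta> + \<delta>"
            "real_of_int (k i) * \<delta> \<le> x $ i + z $ i" "x $ i + z $ i < real_of_int (k i) * \<delta> + \<delta>"
            using x that \<delta> by (simp_all add: mem_cell_iff algebra_simps)
          then show ?thesis by linarith
        qed
        then show ?thesis by (auto simp: Q_def mem_box_cart abs_le_iff minus_le_iff)
      qed
      then show "indicator (cell \<delta> k) (x + z) \<le> (indicator Q z :: ennreal)" by (auto simp: indicator_def)
    qed simp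
    finally have "ennreal (c\<^sup>2 * (norm (f x))\<^sup>2) \<le> ennreal (2 * (norm (a k))\<^sup>2) + 2 * (ennreal c * g x)"
      by (simp add: mult_left_mono add_left_mono)
    moreover have "2 * (ennreal c * g x) = ennreal (2 * c) * g x"
      using c by (simp add: ennreal_mult mult.assoc)
    ultimately show ?thesis by simp
  qed
  have "ennreal (c\<^sup>2 * (LINT x|lborel. (norm (f x))\<^sup>2)) = (\<integral>\<^sup>+x. ennreal (c\<^sup>2 * (norm (f x))\<^sup>2) \<partial>lborel)"
    using integrable_C1c_norm2[OF f] c by (subst nn_integral_eq_integral) auto
  also have "\<dots> \<le> (\<integral>\<^sup>+x. (\<Sum>k\<in>K. ennreal (2 * (norm (a k))\<^sup>2) * indicator (cell \<delta> k) x) + ennreal (2 * c) * g x \<partial>lborel)"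
  proof (rule nn_integral_mono)
    fix x
    show "ennreal (c\<^sup>2 * (norm (f x))\<^sup>2) \<le> (\<Sum>k\<in>K. ennreal (2 * (norm (a k))\<^sup>2) * indicator (cell \<delta> k) x) + ennreal (2 * c) * g x"
    proof (cases "f x = 0")
      case False
      then obtain k where k: "k \<in> K" "x \<in> cell \<delta> k" using K(2) by blast
      have "ennreal (2 * (norm (a k))\<^sup>2) \<le> (\<Sum>k\<in>K. ennreal (2 * (norm (a k))\<^sup>2) * indicator (cell \<delta> k) x)"
        using member_le_sum[OF k(1), of "\<lambda>k. ennreal (2 * (norm (a k))\<^sup>2) * indicator (cell \<delta> k) x"] K(1) k(2) by simp
      then show ?thesis using pt[OF k(2)] by (meson add_right_mono order_trans)
    qed simp
  qed
  also have "\<dots> = (\<Sum>k\<in>K. ennreal (2 * (norm (a k))\<^sup>2) * ennreal c) + ennreal (2 * c) * (\<integral>\<^sup>+x. g x \<partial>lborel)"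
  proof -
    have [measurable]: "g \<in> borel_measurable borel" unfolding g_def[abs_def] by measurable
    show ?thesis using \<delta>
      by (subst nn_integral_add) (auto simp: nn_integral_sum nn_integral_cmult emeasure_cell cell_borel c_def)
  qed
  also have "\<dots> \<le> (\<Sum>k\<in>K. ennreal (2 * (norm (a k))\<^sup>2) * ennreal c) + ennreal (2 * c) * ennreal ((2 * \<delta>) ^ CARD('n) * (real CARD('n) * \<delta>\<^sup>2) * E)"
    by (intro add_left_mono mult_left_mono gint) simp
  also have "\<dots> = ennreal ((\<Sum>k\<in>K. 2 * (norm (a k))\<^sup>2 * c) + 2 * c * ((2 * \<delta>) ^ CARD('n) * (real CARD('n) * \<delta>\<^sup>2) * E))"
    using c \<delta> by (simp add: ennreal_mult[symmetric] sum_ennreal E_def sum_nonneg ennreal_plus[symmetric] del: ennreal_plus)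
  \<comment> \<open>Both terms on the right contain a factor \<open>c\<close>, the first from the
    measure of a cell, so one power of \<open>c\<close> cancels.\<close>
  finally have "c\<^sup>2 * (LINT x|lborel. (norm (f x))\<^sup>2) \<le> (\<Sum>k\<in>K. 2 * (norm (a k))\<^sup>2 * c) + 2 * c * ((2 * \<delta>) ^ CARD('n) * (real CARD('n) * \<delta>\<^sup>2) * E)"
    using c \<delta> by (subst (asm) ennreal_le_iff) (auto simp: E_def intro!: add_nonneg_nonneg sum_nonneg mult_nonneg_nonneg)
  also have "(\<Sum>k\<in>K. 2 * (norm (a k))\<^sup>2 * c) = 2 * c * (\<Sum>k\<in>K. (norm (a k))\<^sup>2)"
    by (simp add: sum_distrib_left ac_simps)
  finally have "c * (c * (LINT x|lborel. (norm (f x))\<^sup>2)) \<le> c * (2 * (\<Sum>k\<in>K. (norm (a k))\<^sup>2) + 2 * (2 * \<delta>) ^ CARD('n) * (real CARD('n) * \<delta>\<^sup>2) * E)"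
    by (simp add: power2_eq_square algebra_simps)
  then show ?thesis using c unfolding a_def E_def c_def[symmetric] by simp
qed

text \<open>The integrals over all cells of the sides \<open>1 / real (Suc j)\<close> are countably
  many bounded sequences, made convergent by one diagonal subsequence. Given
  \<open>\<epsilon>\<close>, a fixed \<open>j\<close> makes the gradient term of
  \<open>cell_Poincare\<close>, which after division by the cell measure is of order
  \<open>(\<delta> j)\<^sup>2\<close>, uniformly small; then only the finitely many cells that can
  meet the common support remain.\<close>

lemma C1c_Rellich:
  fixes \<phi> :: "nat \<Rightarrow> real^'n::finite \<Rightarrow> complex"
  assumes \<phi>: "\<And>k. cont_diff_cs (\<phi> k)" and R: "\<And>k x. \<phi> k x \<noteq> 0 \<Longrightarrow> norm x \<le> R"
    and M: "\<And>k. (LINT x|lborel. (norm (\<phi> k x))\<^sup>2) \<le> M" "\<And>k. (LINT x|lborel. (norm (grad (\<phi> k) x))\<^sup>2) \<le> M"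
  shows "\<exists>r :: nat \<Rightarrow> nat. strict_mono r \<and> (\<forall>\<epsilon>>0. \<exists>N. \<forall>k\<ge>N. \<forall>l\<ge>N. (LINT x|lborel. (norm (\<phi> (r k) x - \<phi> (r l) x))\<^sup>2) < \<epsilon>)"
proof -
  define \<delta> :: "nat \<Rightarrow> real" where "\<delta> j = 1 / real (Suc j)" for j
  have \<delta>: "0 < \<delta> j" "\<delta> j \<le> 1" for j by (auto simp: \<delta>_def)
  define a where "a k p = (LINT x|lborel. indicator (cell (\<delta> (fst p)) (snd p)) x *\<^sub>R \<phi> k x)" for k and p :: "nat \<times> ('n \<Rightarrow> int)"
  have cellint: "integrable lborel (\<lambda>x. indicator (cell (\<delta> j) q) x *\<^sub>R \<phi> k x)" for j q k
    by (intro integrable_mult_indicator integrable_C1c_fun \<phi>) (simp add: cell_borel \<delta>)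
  have M0: "0 \<le> M" using M(1)[of 0] by (rule order_trans[rotated]) simp
  \<comment> \<open>Sides are at most 1, so the measure of a cell drops out of
    Cauchy-Schwarz.\<close>
  have bound: "norm (a k p) \<le> sqrt M" for k p
  proof -
    have m: "\<phi> k \<in> borel_measurable borel"
      by (rule borel_measurable_continuous_onI[OF C1_continuous[OF C1c_imp_C1[OF \<phi>]]])
    have "ennreal ((norm (a k p))\<^sup>2) \<le> ennreal (\<delta> (fst p) ^ CARD('n)) *
       (\<integral>\<^sup>+x. indicator (cell (\<delta> (fst p)) (snd p)) x * ennreal ((norm (\<phi> k x))\<^sup>2) \<partial>lborel)"
      unfolding a_def by (intro Cauchy_Schwarz_cell \<delta> cellint m)
    also have "\<dots> \<le> 1 * (\<integral>\<^sup>+x. ennreal ((norm (\<phi> k x))\<^sup>2) \<partial>lborel)"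
    proof (intro mult_mono nn_integral_mono)
      show "ennreal (\<delta> (fst p) ^ CARD('n)) \<le> 1"
        using \<delta>[of "fst p"] by (simp add: power_le_one less_imp_le)
    qed (auto simp: indicator_def)
    also have "\<dots> = ennreal (LINT x|lborel. (norm (\<phi> k x))\<^sup>2)"
      using integrable_C1c_norm2[OF \<phi>] by (simp add: nn_integral_eq_integral)
    also have "\<dots> \<le> ennreal M" by (intro ennreal_leI M)
    finally have "(norm (a k p))\<^sup>2 \<le> M" using M0 by simp
    then show ?thesis by (rule real_le_rsqrt)
  qed
  \<comment> \<open>The diagonal argument, over the countable set of pairs of a side index and a
    cell index.\<close>
  obtain r where r: "strict_mono r" "\<And>p. \<exists>l. (\<lambda>k. a (r k) p) \<longlonglongrightarrow> l"
    by (rule function_convergent_subsequence[where f = a, OF countableI_type[of UNIV] bound]) (rule that, simp_all)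
  have cau: "\<exists>N. \<forall>k\<ge>N. \<forall>l\<ge>N. (LINT x|lborel. (norm (\<phi> (r k) x - \<phi> (r l) x))\<^sup>2) < \<epsilon>" if \<epsilon>: "\<epsilon> > 0" for \<epsilon>
  proof -
    define n where "n = CARD('n)"
    have "(\<lambda>j. 2 * 2 ^ n * (real n * (1 * inverse (real (Suc j)))\<^sup>2) * (4 * M)) \<longlonglongrightarrow> 2 * 2 ^ n * (real n * 0\<^sup>2) * (4 * M)"
      by (intro tendsto_intros inverse_Suc_LIMSEQ)
    then have "(\<lambda>j. 2 * 2 ^ n * (real n * (\<delta> j)\<^sup>2) * (4 * M)) \<longlonglongrightarrow> 0"
      unfolding \<delta>_def by (simp add: inverse_eq_divide)
    then have "\<forall>\<^sub>F j in sequentially. 2 * 2 ^ n * (real n * (\<delta> j)\<^sup>2) * (4 * M) < \<epsilon> / 2"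
      by (rule order_tendstoD(2)) (use \<epsilon> in simp)
    \<comment> \<open>\<open>4 * M\<close> bounds the squared gradient norm of a difference of two
      members of the sequence.\<close>
    then obtain j where j: "2 * 2 ^ n * (real n * (\<delta> j)\<^sup>2) * (4 * M) < \<epsilon> / 2"
      using eventually_happens'[OF sequentially_bot] by blast
    define B where "B = \<lceil>R / \<delta> j\<rceil> + 1"
    define K where "K = {k :: 'n \<Rightarrow> int. \<forall>i. k i \<in> {-B..B}}"
    have K: "finite K" unfolding K_def by (rule finite_int_functions)
    have inK: "\<exists>k\<in>K. x \<in> cell (\<delta> j) k" if "norm x \<le> R" for x :: "real^'n"
    proof (intro bexI[of _ "\<lambda>i. \<lfloor>x $ i / \<delta> j\<rfloor>"])
      have "\<lfloor>x $ i / \<delta> j\<rfloor> \<in> {-B..B}" for i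
      proof -
        have "\<bar>x $ i\<bar> \<le> R" using component_le_norm_cart[of x i] that by simp
        then have "\<bar>x $ i / \<delta> j\<bar> \<le> R / \<delta> j" using \<delta>[of j] by (simp add: divide_right_mono)
        then have t: "- (R / \<delta> j) \<le> x $ i / \<delta> j" "x $ i / \<delta> j \<le> R / \<delta> j" by linarith+
        have "- B \<le> \<lfloor>x $ i / \<delta> j\<rfloor>" unfolding B_def using t(1) by linarith
        moreover have "\<lfloor>x $ i / \<delta> j\<rfloor> \<le> B" unfolding B_def using t(2) by linarith
        ultimately show ?thesis by simp
      qed
      then show "(\<lambda>i. \<lfloor>x $ i / \<delta> j\<rfloor>) \<in> K" by (auto simp: K_def)
    qed (simp add: cell_def)
    define c where "c = \<delta> j ^ n"
    have c: "c > 0" using \<delta>[of j] by (simp add: c_def)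
    \<comment> \<open>Chosen so that the squares over all cells in \<open>K\<close> add up to at
      most \<open>c * \<epsilon> / 8\<close>; the added 1 covers an empty \<open>K\<close>.\<close>
    define e where "e = sqrt (c * \<epsilon> / (8 * (real (card K) + 1)))"
    have e: "e > 0" using c \<epsilon> by (simp add: e_def)
    have "\<exists>N. \<forall>k\<ge>N. \<forall>l\<ge>N. norm (a (r k) (j, q) - a (r l) (j, q)) < e" for q
    proof -
      have "Cauchy (\<lambda>k. a (r k) (j, q))" using r(2)[of "(j, q)"] by (auto intro: LIMSEQ_imp_Cauchy)
      then show ?thesis using CauchyD[OF _ e] by blast
    qed
    then obtain N where N: "\<And>q k l. k \<ge> N q \<Longrightarrow> l \<ge> N q \<Longrightarrow> norm (a (r k) (j, q) - a (r l) (j, q)) < e" by metis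
    define N0 where "N0 = Max (insert 0 (N ` K))"
    have N0: "N q \<le> N0" if "q \<in> K" for q unfolding N0_def using K that by (intro Max_ge) auto
    show ?thesis
    proof (intro exI[of _ N0] allI impI)
      fix k l assume kl: "N0 \<le> k" "N0 \<le> l"
      define f where "f x = \<phi> (r k) x - \<phi> (r l) x" for x
      have f: "cont_diff_cs f" unfolding f_def by (intro C1c_diff \<phi>)
      have grad_f: "(LINT x|lborel. (norm (grad f x))\<^sup>2) \<le> 4 * M"
      proof -
        have "(LINT x|lborel. (norm (grad f x))\<^sup>2) \<le> (LINT x|lborel. 2 * (norm (grad (\<phi> (r k)) x))\<^sup>2 + 2 * (norm (grad (\<phi> (r l)) x))\<^sup>2)"
        proof (rule integral_mono)
          show "integrable lborel (\<lambda>x. 2 * (norm (grad (\<phi> (r k)) x))\<^sup>2 + 2 * (norm (grad (\<phi> (r l)) x))\<^sup>2)"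
            by (intro Bochner_Integration.integrable_add Bochner_Integration.integrable_mult_right integrable_C1c_grad2 \<phi>)
          show "(norm (grad f x))\<^sup>2 \<le> 2 * (norm (grad (\<phi> (r k)) x))\<^sup>2 + 2 * (norm (grad (\<phi> (r l)) x))\<^sup>2" for x
            using norm_add_squared_le[of "grad (\<phi> (r k)) x" "- grad (\<phi> (r l)) x"]
            unfolding f_def by (simp add: grad_diff C1c_imp_C1 \<phi>)
        qed (rule integrable_C1c_grad2[OF f])
        also have "\<dots> \<le> 4 * M" using M(2)[of "r k"] M(2)[of "r l"] integrable_C1c_grad2[OF \<phi>] by simp
        finally show ?thesis .
      qed
      have supp: "\<exists>k\<in>K. x \<in> cell (\<delta> j) k" if "f x \<noteq> 0" for x
      proof -
        have "\<phi> (r k) x \<noteq> 0 \<or> \<phi> (r l) x \<noteq> 0" using that by (auto simp: f_def)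
        then show ?thesis using R inK by blast
      qed
      have "(LINT x|lborel. indicator (cell (\<delta> j) q) x *\<^sub>R f x) = a (r k) (j, q) - a (r l) (j, q)" for q
        unfolding a_def f_def by (simp add: scaleR_diff_right cellint)
      moreover have "norm (a (r k) (j, q) - a (r l) (j, q)) \<le> e" if "q \<in> K" for q
        using N[of q k l] N0[OF that] kl by (simp add: less_imp_le)
      ultimately have "(\<Sum>q\<in>K. (norm (LINT x|lborel. indicator (cell (\<delta> j) q) x *\<^sub>R f x))\<^sup>2) \<le> (\<Sum>q\<in>K. e\<^sup>2)"
        by (intro sum_mono power_mono) simp_all
      also have "\<dots> = real (card K) * (c * \<epsilon> / (8 * (real (card K) + 1)))" using c \<epsilon> by (simp add: e_def)
      also have "\<dots> \<le> c * \<epsilon> / 8" using c \<epsilon> by (simp add: divide_simps)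
      finally have S: "(\<Sum>q\<in>K. (norm (LINT x|lborel. indicator (cell (\<delta> j) q) x *\<^sub>R f x))\<^sup>2) \<le> c * \<epsilon> / 8" .
      have "c * (LINT x|lborel. (norm (f x))\<^sup>2) \<le>
          2 * (\<Sum>q\<in>K. (norm (LINT x|lborel. indicator (cell (\<delta> j) q) x *\<^sub>R f x))\<^sup>2)
          + 2 * (2 * \<delta> j) ^ n * (real n * (\<delta> j)\<^sup>2) * (LINT x|lborel. (norm (grad f x))\<^sup>2)"
        unfolding c_def n_def by (rule cell_Poincare[OF f \<delta>(1) K supp])
      also have "\<dots> \<le> 2 * (c * \<epsilon> / 8) + 2 * (2 * \<delta> j) ^ n * (real n * (\<delta> j)\<^sup>2) * (4 * M)"
        using S grad_f \<delta>(1)[of j] by (intro add_mono mult_left_mono) auto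
      also have "\<dots> = c * (\<epsilon> / 4 + 2 * 2 ^ n * (real n * (\<delta> j)\<^sup>2) * (4 * M))"
        by (simp add: c_def power_mult_distrib algebra_simps)
      also have "\<dots> < c * \<epsilon>" using c j \<epsilon> by (intro mult_strict_left_mono) auto
      finally show "(LINT x|lborel. (norm (\<phi> (r k) x - \<phi> (r l) x))\<^sup>2) < \<epsilon>" using c by (simp add: f_def)
    qed
  qed
  show ?thesis
    by (rule exI[of _ r]) (use r(1) cau in auto)
qed

section \<open>Weak gradients\<close>

definition zero_ext :: "'a set \<Rightarrow> ('a \<Rightarrow> 'b::real_vector) \<Rightarrow> 'a \<Rightarrow> 'b" where
  "zero_ext \<Omega> u x = indicator \<Omega> x *\<^sub>R u x"

lemma zero_ext_L2:
  fixes u :: "'a::euclidean_space \<Rightarrow> 'b::euclidean_space"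
  assumes "\<Omega> \<in> sets lebesgue"
  shows "zero_ext \<Omega> u \<in> L2 lebesgue \<longleftrightarrow> u \<in> L2 (lebesgue_on \<Omega>)"
proof -
  have "(\<lambda>x. (norm (zero_ext \<Omega> u x))\<^sup>2) = (\<lambda>x. indicator \<Omega> x *\<^sub>R (norm (u x))\<^sup>2)"
    by (auto simp: zero_ext_def indicator_def)
  then have "integrable lebesgue (\<lambda>x. (norm (zero_ext \<Omega> u x))\<^sup>2) \<longleftrightarrow> integrable (lebesgue_on \<Omega>) (\<lambda>x. (norm (u x))\<^sup>2)"
    using assms by (simp add: integrable_restrict_space)
  moreover have "zero_ext \<Omega> u \<in> borel_measurable lebesgue \<longleftrightarrow> u \<in> borel_measurable (lebesgue_on \<Omega>)"
    unfolding zero_ext_def[abs_def] using assms by (subst borel_measurable_restrict_space_iff) auto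
  ultimately show ?thesis by (simp add: L2_def)
qed

lemma integral_lebesgue_on:
  fixes f :: "'a::euclidean_space \<Rightarrow> 'b::{banach, second_countable_topology}"
  assumes "\<Omega> \<in> sets lebesgue"
  shows "(LINT x|lebesgue_on \<Omega>. f x) = (LINT x|lebesgue. indicator \<Omega> x *\<^sub>R f x)"
  using assms by (subst integral_restrict_space) auto

lemma AE_zero_ext:
  assumes "\<Omega> \<in> sets lebesgue"
  shows "(AE x in lebesgue. zero_ext \<Omega> u x = zero_ext \<Omega> v x) \<longleftrightarrow> (AE x in lebesgue_on \<Omega>. u x = v x)"
proof -
  have "(AE x in lebesgue_on \<Omega>. u x = v x) \<longleftrightarrow> (AE x in lebesgue. x \<in> \<Omega> \<longrightarrow> u x = v x)"
    using assms by (subst AE_restrict_space_iff) auto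
  also have "\<dots> \<longleftrightarrow> (AE x in lebesgue. zero_ext \<Omega> u x = zero_ext \<Omega> v x)"
    by (intro AE_cong) (auto simp: zero_ext_def indicator_def)
  finally show ?thesis by simp
qed

lemma has_weak_gradientD:
  assumes "has_weak_gradient \<Omega> u G"
  shows "u \<in> L2 (lebesgue_on \<Omega>)" "G \<in> L2 (lebesgue_on \<Omega>)"
    "\<phi> \<in> test_functions \<Omega> \<Longrightarrow>
      (LINT x|lebesgue_on \<Omega>. u x * partial i \<phi> x) = - (LINT x|lebesgue_on \<Omega>. G x $ i * \<phi> x)"
  using assms by (auto simp: has_weak_gradient_def)

lemma L2_vec_nth:
  assumes "G \<in> L2 M"
  shows "(\<lambda>x. (G x :: complex^'n::finite) $ i) \<in> L2 M"
proof (rule L2_dominated[OF assms])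
  show "(\<lambda>x. G x $ i) \<in> borel_measurable M"
    using borel_measurable_continuous_onI[OF continuous_on_component[OF continuous_on_id], of i] L2_measurable[OF assms]
    by (rule measurable_compose_rev[of _ borel _ G M, unfolded o_def id_def])
qed (rule AE_I2, rule Finite_Cartesian_Product.norm_nth_le)

lemma L2_bounded_continuous:
  fixes f :: "real^'n::finite \<Rightarrow> 'b::euclidean_space"
  assumes "continuous_on UNIV f" "bounded \<Omega>" "\<Omega> \<in> sets lebesgue"
  shows "f \<in> L2 (lebesgue_on \<Omega>)"
proof -
  obtain R where R: "\<And>x. x \<in> \<Omega> \<Longrightarrow> norm x \<le> R" using assms(2) by (auto simp: bounded_iff)
  have "integrable lborel (\<lambda>x. indicator (cball 0 R) x *\<^sub>R (norm (f x))\<^sup>2)"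
    by (rule borel_integrable_compact) (auto intro!: continuous_intros continuous_on_subset[OF assms(1)])
  then have "integrable lebesgue (\<lambda>x. indicator (cball 0 R) x *\<^sub>R (norm (f x))\<^sup>2)"
    by (subst integrable_completion) (auto dest: borel_measurable_integrable)
  from integrable_mult_indicator[OF assms(3) this]
  have "integrable lebesgue (\<lambda>x. indicator \<Omega> x *\<^sub>R (indicator (cball 0 R) x *\<^sub>R (norm (f x))\<^sup>2))" .
  also have "(\<lambda>x. indicator \<Omega> x *\<^sub>R (indicator (cball 0 R) x *\<^sub>R (norm (f x))\<^sup>2)) = (\<lambda>x. indicator \<Omega> x *\<^sub>R (norm (f x))\<^sup>2)"
    using R by (auto simp: indicator_def)
  finally have "integrable (lebesgue_on \<Omega>) (\<lambda>x. (norm (f x))\<^sup>2)"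
    using assms(3) by (subst integrable_restrict_space) auto
  then show ?thesis by (intro L2I continuous_measurable_lebesgue_on assms)
qed

lemma L2_zero_ext:
  fixes f :: "'a::euclidean_space \<Rightarrow> 'b::euclidean_space"
  assumes "f \<in> L2 lebesgue" "A \<in> sets lebesgue"
  shows "zero_ext A f \<in> L2 lebesgue"
proof (rule L2_dominated[OF assms(1)])
  show "zero_ext A f \<in> borel_measurable lebesgue"
    unfolding zero_ext_def[abs_def] using assms L2_measurable[OF assms(1)] by measurable
qed (auto simp: zero_ext_def indicator_def)

lemma L2_lebesgue_on:
  fixes f :: "'a::euclidean_space \<Rightarrow> 'b::euclidean_space"
  shows "f \<in> L2 lebesgue \<Longrightarrow> A \<in> sets lebesgue \<Longrightarrow> f \<in> L2 (lebesgue_on A)"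
  using L2_zero_ext zero_ext_L2 by blast

lemma test_function_L2:
  fixes \<Omega> :: "(real^'n::finite) set"
  assumes "\<phi> \<in> test_functions \<Omega>"
  shows "\<phi> \<in> L2 lebesgue" "grad \<phi> \<in> L2 lebesgue" "partial i \<phi> \<in> L2 lebesgue"
    "A \<in> sets lebesgue \<Longrightarrow> \<phi> \<in> L2 (lebesgue_on A)" "A \<in> sets lebesgue \<Longrightarrow> partial i \<phi> \<in> L2 (lebesgue_on A)"
proof -
  note c = test_function_C1c[OF assms]
  have *: "f \<in> L2 lebesgue" if "continuous_on UNIV f" "integrable lborel (\<lambda>x. (norm (f x))\<^sup>2)" for f :: "real^'n \<Rightarrow> 'b::euclidean_space"
    using that borel_measurable_continuous_onI[OF that(1)]
    by (intro L2I measurable_completion) (auto simp: integrable_completion)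
  have L: "\<phi> \<in> L2 lebesgue" using integrable_C1c_norm2[OF c] C1_continuous[OF C1c_imp_C1[OF c]] by (intro *)
  have G: "grad \<phi> \<in> L2 lebesgue" using integrable_C1c_grad2[OF c] C1_continuous_grad[OF C1c_imp_C1[OF c]] by (intro *)
  have P: "partial i \<phi> \<in> L2 lebesgue" for i using L2_vec_nth[OF G, of i] by (simp add: grad_def)
  show "\<phi> \<in> L2 lebesgue" "grad \<phi> \<in> L2 lebesgue" "partial i \<phi> \<in> L2 lebesgue" by fact+
  show "\<phi> \<in> L2 (lebesgue_on A)" "partial i \<phi> \<in> L2 (lebesgue_on A)" if "A \<in> sets lebesgue"
    using L P that by (auto intro: L2_lebesgue_on)
qed

section \<open>Uniqueness and algebra of weak gradients\<close>

text \<open>Both gradients have the same integrals against test functions, so the fundamental lemma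
  applies to each component of their difference.\<close>

lemma has_weak_gradient_unique:
  assumes "open \<Omega>" "has_weak_gradient \<Omega> u G" "has_weak_gradient \<Omega> v G'" "AE x in lebesgue_on \<Omega>. u x = v x"
  shows "AE x in lebesgue_on \<Omega>. G x = G' x"
proof -
  have S: "\<Omega> \<in> sets lebesgue" using assms(1) by simp
  have "AE x in lebesgue_on \<Omega>. G x $ i - G' x $ i = 0" for i
  proof (rule fundamental_lemma[OF assms(1)])
    note G = L2_vec_nth[OF has_weak_gradientD(2)[OF assms(2)], of i] L2_vec_nth[OF has_weak_gradientD(2)[OF assms(3)], of i]
    show "(\<lambda>x. G x $ i - G' x $ i) \<in> L2 (lebesgue_on \<Omega>)" by (intro L2_diff G)
    fix \<phi> assume \<phi>: "\<phi> \<in> test_functions \<Omega>"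
    have m: "u \<in> borel_measurable (lebesgue_on \<Omega>)" "v \<in> borel_measurable (lebesgue_on \<Omega>)"
      "partial i \<phi> \<in> borel_measurable (lebesgue_on \<Omega>)"
      using has_weak_gradientD(1)[OF assms(2)] has_weak_gradientD(1)[OF assms(3)] test_function_L2(5)[OF \<phi> S]
      by (auto dest: L2_measurable)
    have "(LINT x|lebesgue_on \<Omega>. u x * partial i \<phi> x) = (LINT x|lebesgue_on \<Omega>. v x * partial i \<phi> x)"
      using assms(4) m by (intro integral_cong_AE) auto
    then have "(LINT x|lebesgue_on \<Omega>. G x $ i * \<phi> x) = (LINT x|lebesgue_on \<Omega>. G' x $ i * \<phi> x)"
      unfolding has_weak_gradientD(3)[OF assms(2) \<phi>] has_weak_gradientD(3)[OF assms(3) \<phi>] by simp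
    then show "(LINT x|lebesgue_on \<Omega>. (G x $ i - G' x $ i) * \<phi> x) = 0"
      unfolding left_diff_distrib
      by (subst Bochner_Integration.integral_diff) (auto intro!: L2_mult_integrable G test_function_L2(4)[OF \<phi> S])
  qed
  then have "AE x in lebesgue_on \<Omega>. \<forall>i\<in>UNIV. G x $ i - G' x $ i = 0" by (subst AE_finite_all) auto
  then show ?thesis by eventually_elim (simp add: vec_eq_iff)
qed

lemma wgrad: "u \<in> H1 \<Omega> \<Longrightarrow> has_weak_gradient \<Omega> u (wgrad \<Omega> u)"
  unfolding H1_def wgrad_def mem_Collect_eq by (rule someI_ex[of "\<lambda>G. has_weak_gradient \<Omega> u G"])

lemma has_weak_gradient_H1: "has_weak_gradient \<Omega> u G \<Longrightarrow> u \<in> H1 \<Omega>"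
  by (auto simp: H1_def)

lemma wgrad_AE_eq: "open \<Omega> \<Longrightarrow> has_weak_gradient \<Omega> u G \<Longrightarrow> AE x in lebesgue_on \<Omega>. wgrad \<Omega> u x = G x"
  using has_weak_gradient_unique[of \<Omega> u "wgrad \<Omega> u" u G] wgrad[OF has_weak_gradient_H1] by auto

lemma has_weak_gradient_add:
  assumes "has_weak_gradient \<Omega> u G" "has_weak_gradient \<Omega> v H" and S: "\<Omega> \<in> sets lebesgue"
  shows "has_weak_gradient \<Omega> (\<lambda>x. u x + v x) (\<lambda>x. G x + H x)"
  unfolding has_weak_gradient_def
proof (intro conjI ballI allI)
  note u = has_weak_gradientD[OF assms(1)] and v = has_weak_gradientD[OF assms(2)]
  show "(\<lambda>x. u x + v x) \<in> L2 (lebesgue_on \<Omega>)" "(\<lambda>x. G x + H x) \<in> L2 (lebesgue_on \<Omega>)"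
    by (intro L2_add u v)+
  fix \<phi> i assume \<phi>: "\<phi> \<in> test_functions \<Omega>"
  show "(LINT x|lebesgue_on \<Omega>. (u x + v x) * partial i \<phi> x) = - (LINT x|lebesgue_on \<Omega>. (G x + H x) $ i * \<phi> x)"
    using u(1,2) v(1,2) u(3)[OF \<phi>, of i] v(3)[OF \<phi>, of i] test_function_L2(4,5)[OF \<phi> S]
    by (simp add: distrib_right L2_mult_integrable L2_vec_nth)
qed

text \<open>Injectivity keeps the support unchanged. As \<open>h\<close> is only real linear, this
  covers conjugation as well as multiplication by \<open>\<i>\<close> and nonzero real
  scaling.\<close>

lemma test_function_bounded_linear:
  assumes "bounded_linear h" "inj h" "\<phi> \<in> test_functions \<Omega>"
  shows "(\<lambda>x. h (\<phi> x)) \<in> test_functions \<Omega>"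
proof -
  have "h (\<phi> x) = 0 \<longleftrightarrow> \<phi> x = 0" for x
    using linear_0[OF bounded_linear.linear[OF assms(1)]] assms(2) by (metis injD)
  then show ?thesis
    using assms(3) Ck_bounded_linear[OF assms(1)] by (auto simp: test_functions_def smooth_def)
qed

lemma norm_vector_scalar_mult: "norm (c *s z) = norm c * norm z" for z :: "complex^'n::finite"
  by (simp add: norm_vec_def norm_mult L2_set_right_distrib)

lemma has_weak_gradient_scale:
  assumes "has_weak_gradient \<Omega> u G"
  shows "has_weak_gradient \<Omega> (\<lambda>x. c * u x) (\<lambda>x. c *s G x)"
  unfolding has_weak_gradient_def
proof (intro conjI ballI allI)
  note u = has_weak_gradientD[OF assms]
  note m = L2_measurable[OF u(1)] L2_measurable[OF u(2)]
  show "(\<lambda>x. c * u x) \<in> L2 (lebesgue_on \<Omega>)"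
    by (rule L2_dominated[OF L2_scaleR[OF u(1), of "norm c"]]) (use m in \<open>auto simp: norm_mult\<close>)
  have "continuous_on UNIV (\<lambda>z :: complex^'a. c *s z)"
    unfolding vector_scalar_mult_def by (intro continuous_intros)
  then have "(\<lambda>x. c *s G x) \<in> borel_measurable (lebesgue_on \<Omega>)"
    using m(2) by (rule borel_measurable_continuous_on)
  then show "(\<lambda>x. c *s G x) \<in> L2 (lebesgue_on \<Omega>)"
    by (intro L2_dominated[OF L2_scaleR[OF u(2), of "norm c"]]) (auto simp: norm_vector_scalar_mult)
  fix \<phi> i assume \<phi>: "\<phi> \<in> test_functions \<Omega>"
  show "(LINT x|lebesgue_on \<Omega>. c * u x * partial i \<phi> x) = - (LINT x|lebesgue_on \<Omega>. (c *s G x) $ i * \<phi> x)"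
    using u(3)[OF \<phi>, of i] by (simp add: mult.assoc)
qed

definition cnj_vec :: "complex^'n \<Rightarrow> complex^'n" where
  "cnj_vec z = (\<chi> i. cnj (z $ i))"

lemma norm_cnj_vec [simp]: "norm (cnj_vec z) = norm z"
  by (simp add: norm_vec_def cnj_vec_def)

lemma continuous_on_cnj_vec: "continuous_on UNIV cnj_vec"
  unfolding cnj_vec_def[abs_def] by (intro continuous_intros)

text \<open>The defining identity is tested with the conjugate test function and then
  conjugated.\<close>

lemma has_weak_gradient_cnj:
  assumes "has_weak_gradient \<Omega> u G"
  shows "has_weak_gradient \<Omega> (\<lambda>x. cnj (u x)) (\<lambda>x. cnj_vec (G x))"
  unfolding has_weak_gradient_def
proof (intro conjI ballI allI)
  note u = has_weak_gradientD[OF assms]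
  note m = L2_measurable[OF u(1)] L2_measurable[OF u(2)]
  show "(\<lambda>x. cnj (u x)) \<in> L2 (lebesgue_on \<Omega>)"
    by (rule L2_dominated[OF u(1)]) (use m borel_measurable_continuous_on[OF _ m(1), of cnj] in \<open>auto intro: continuous_intros\<close>)
  show "(\<lambda>x. cnj_vec (G x)) \<in> L2 (lebesgue_on \<Omega>)"
    by (rule L2_dominated[OF u(2)]) (use borel_measurable_continuous_on[OF continuous_on_cnj_vec m(2)] in auto)
  fix \<phi> i assume \<phi>: "\<phi> \<in> test_functions \<Omega>"
  have "(\<lambda>x. cnj (\<phi> x)) \<in> test_functions \<Omega>"
    by (rule test_function_bounded_linear[OF bounded_linear_cnj _ \<phi>]) (auto simp: inj_def)
  note 1 = u(3)[OF this, of i]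
  have p: "partial i (\<lambda>x. cnj (\<phi> x)) x = cnj (partial i \<phi> x)" for x
    by (rule partial_bounded_linear[OF bounded_linear_cnj C1_differentiable[OF C1c_imp_C1[OF test_function_C1c[OF \<phi>]]]])
  have 2: "(LINT x|lebesgue_on \<Omega>. u x * cnj (partial i \<phi> x)) = - (LINT x|lebesgue_on \<Omega>. G x $ i * cnj (\<phi> x))"
    using 1 unfolding p .
  have "(LINT x|lebesgue_on \<Omega>. cnj (u x) * partial i \<phi> x) = (LINT x|lebesgue_on \<Omega>. cnj (u x * cnj (partial i \<phi> x)))"
    by simp
  also have "\<dots> = cnj (LINT x|lebesgue_on \<Omega>. u x * cnj (partial i \<phi> x))" by (rule Bochner_Integration.integral_cnj)
  also have "\<dots> = - cnj (LINT x|lebesgue_on \<Omega>. G x $ i * cnj (\<phi> x))" unfolding 2 by simp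
  also have "cnj (LINT x|lebesgue_on \<Omega>. G x $ i * cnj (\<phi> x)) = (LINT x|lebesgue_on \<Omega>. cnj (G x $ i * cnj (\<phi> x)))"
    by (rule Bochner_Integration.integral_cnj[symmetric])
  finally show "(LINT x|lebesgue_on \<Omega>. cnj (u x) * partial i \<phi> x) = - (LINT x|lebesgue_on \<Omega>. cnj_vec (G x) $ i * \<phi> x)"
    by (simp add: cnj_vec_def)
qed

text \<open>Test functions and their derivatives vanish outside \<open>\<Omega>\<close>, so both
  integrals extend to the whole space, where integration by parts needs bounded support of one
  factor only.\<close>

lemma has_weak_gradient_C1:
  fixes \<Omega> :: "(real^'n::finite) set"
  assumes \<Omega>: "open \<Omega>" "bounded \<Omega>" and f: "cont_diff f"
  shows "has_weak_gradient \<Omega> f (grad f)"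
  unfolding has_weak_gradient_def
proof (intro conjI ballI allI)
  have S: "\<Omega> \<in> sets lebesgue" using \<Omega>(1) by simp
  show "f \<in> L2 (lebesgue_on \<Omega>)" "grad f \<in> L2 (lebesgue_on \<Omega>)"
    by (intro L2_bounded_continuous C1_continuous C1_continuous_grad f \<Omega> S)+
  fix \<phi> i assume \<phi>: "\<phi> \<in> test_functions \<Omega>"
  note p = test_function_C1c[OF \<phi>]
  have z: "x \<notin> \<Omega> \<Longrightarrow> \<phi> x = 0" "x \<notin> \<Omega> \<Longrightarrow> partial i \<phi> x = 0" for x
    using \<phi> closure_subset[of "{x. \<phi> x \<noteq> 0}"] by (auto simp: test_functions_def intro!: partial_zero_outside)
  have 1: "(LINT x|lebesgue_on \<Omega>. f x * partial i \<phi> x) = (LINT x|lborel. f x * partial i \<phi> x)"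
  proof -
    have "(\<lambda>x. indicator \<Omega> x *\<^sub>R (f x * partial i \<phi> x)) = (\<lambda>x. f x * partial i \<phi> x)"
      using z by (auto simp: indicator_def)
    moreover have "continuous_on UNIV (\<lambda>x. f x * partial i \<phi> x)"
      by (intro continuous_intros C1_continuous C1_continuous_partial f C1c_imp_C1 p)
    ultimately show ?thesis unfolding integral_lebesgue_on[OF S]
      by (simp add: integral_completion borel_measurable_continuous_onI)
  qed
  have 2: "(LINT x|lebesgue_on \<Omega>. grad f x $ i * \<phi> x) = (LINT x|lborel. partial i f x * \<phi> x)"
  proof -
    have "(\<lambda>x. indicator \<Omega> x *\<^sub>R (grad f x $ i * \<phi> x)) = (\<lambda>x. partial i f x * \<phi> x)"
      using z by (auto simp: indicator_def grad_def)
    moreover have "continuous_on UNIV (\<lambda>x. partial i f x * \<phi> x)"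
      by (intro continuous_intros C1_continuous C1_continuous_partial f C1c_imp_C1 p)
    ultimately show ?thesis unfolding integral_lebesgue_on[OF S]
      by (simp add: integral_completion borel_measurable_continuous_onI)
  qed
  show "(LINT x|lebesgue_on \<Omega>. f x * partial i \<phi> x) = - (LINT x|lebesgue_on \<Omega>. grad f x $ i * \<phi> x)"
    unfolding 1 2 by (rule integration_by_parts[OF f p])
qed

section \<open>The Sobolev spaces as subspaces of a Hilbert space\<close>

lemma subspace_closure:
  fixes S :: "'a::real_normed_vector set"
  assumes "subspace S"
  shows "subspace (closure S)"
proof (rule subspaceI)
  show "0 \<in> closure S" using subspace_0[OF assms] closure_subset by blast
next
  fix x y assume "x \<in> closure S" "y \<in> closure S"
  then obtain f g where f: "\<And>n::nat. f n \<in> S" "f \<longlonglongrightarrow> x" and g: "\<And>n::nat. g n \<in> S" "g \<longlonglongrightarrow> y"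
    unfolding closure_sequential by blast
  have "(\<lambda>n. f n + g n) \<longlonglongrightarrow> x + y" by (intro tendsto_add f g)
  moreover have "\<And>n. f n + g n \<in> S" by (intro subspace_add assms f g)
  ultimately show "x + y \<in> closure S"
    unfolding closure_sequential by (intro exI[of _ "\<lambda>n. f n + g n"]) simp
next
  fix c x assume "x \<in> closure S"
  then obtain f where f: "\<And>n::nat. f n \<in> S" "f \<longlonglongrightarrow> x" unfolding closure_sequential by blast
  have "(\<lambda>n. c *\<^sub>R f n) \<longlonglongrightarrow> c *\<^sub>R x" by (intro tendsto_scaleR tendsto_const f)
  moreover have "\<And>n. c *\<^sub>R f n \<in> S" by (intro subspace_scale assms f)
  ultimately show "c *\<^sub>R x \<in> closure S"
    unfolding closure_sequential by (intro exI[of _ "\<lambda>n. c *\<^sub>R f n"]) simp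
qed

lemma Re_mult_inner: "Re (a * b) = a \<bullet> cnj b"
  by (simp add: inner_complex_def)

text \<open>The link between the complex bilinear forms of the problem and the real inner products
  of the Hilbert space argument.\<close>

lemma Re_cdot_inner: "Re (cdot a b) = a \<bullet> cnj_vec b"
  unfolding cdot_def inner_vec_def Re_sum Re_mult_inner by (simp add: cnj_vec_def)

lemma cdot_integrable:
  fixes P Q :: "'a \<Rightarrow> complex^'n::finite"
  assumes "P \<in> L2 M" "Q \<in> L2 M"
  shows "integrable M (\<lambda>x. cdot (P x) (Q x))"
  unfolding cdot_def by (intro Bochner_Integration.integrable_sum L2_mult_integrable L2_vec_nth assms)

lemma test_function_add:
  assumes "\<phi> \<in> test_functions \<Omega>" "\<psi> \<in> test_functions \<Omega>"
  shows "(\<lambda>x. \<phi> x + \<psi> x) \<in> test_functions \<Omega>"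
proof -
  let ?A = "closure {x. \<phi> x \<noteq> 0} \<union> closure {x. \<psi> x \<noteq> 0}"
  have "{x. \<phi> x + \<psi> x \<noteq> 0} \<subseteq> {x. \<phi> x \<noteq> 0} \<union> {x. \<psi> x \<noteq> 0}" by auto
  then have "{x. \<phi> x + \<psi> x \<noteq> 0} \<subseteq> ?A" by (rule order_trans) (intro Un_mono closure_subset)
  then have sub: "closure {x. \<phi> x + \<psi> x \<noteq> 0} \<subseteq> ?A" by (rule closure_minimal) auto
  have "compact ?A" using assms by (auto simp: test_functions_def intro: compact_Un)
  then have "compact (closure {x. \<phi> x + \<psi> x \<noteq> 0})"
    using compact_Int_closed[OF _ closed_closure, of ?A "{x. \<phi> x + \<psi> x \<noteq> 0}"] sub by (simp add: inf.absorb2)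
  then show ?thesis using assms sub by (auto simp: test_functions_def smooth_def intro!: Ck_add)
qed

lemma test_function_zero: "(\<lambda>x. 0) \<in> test_functions \<Omega>"
  by (auto simp: test_functions_def smooth_def Ck_const)

lemma test_function_scaleR:
  assumes "\<phi> \<in> test_functions \<Omega>"
  shows "(\<lambda>x. c *\<^sub>R \<phi> x) \<in> test_functions \<Omega>"
proof (cases "c = 0")
  case True then show ?thesis by (simp add: test_function_zero)
next
  case False
  then show ?thesis
    by (intro test_function_bounded_linear[OF bounded_linear_scaleR_right _ assms]) (auto simp: inj_def)
qed

lemma test_function_outside: "\<phi> \<in> test_functions \<Omega> \<Longrightarrow> x \<notin> \<Omega> \<Longrightarrow> \<phi> x = 0 \<and> partial i \<phi> x = 0 \<and> grad \<phi> x = 0"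
  using closure_subset[of "{x. \<phi> x \<noteq> 0}"]
  by (auto simp: test_functions_def grad_def vec_eq_iff intro!: partial_zero_outside)

section \<open>The embedding of the Sobolev space\<close>

locale bounded_open =
  fixes \<Omega> :: "(real^'n::finite) set"
  assumes open_domain: "open \<Omega>" and bounded_domain: "bounded \<Omega>"
begin

lemma domain_sets [simp]: "\<Omega> \<in> sets lebesgue"
  using open_domain by simp

abbreviation "L2D \<equiv> L2 (lebesgue_on \<Omega>)"

text \<open>The type \<open>l2\<close> is tied to Lebesgue measure on the whole space, so functions on \<open>\<Omega>\<close> enter it through
  their extension by zero.\<close>

definition E :: "(real^'n \<Rightarrow> 'b::euclidean_space) \<Rightarrow> (real^'n, 'b) l2" where
  "E u = to_l2 (zero_ext \<Omega> u)"

lemma zero_ext_L2D: "u \<in> L2D \<Longrightarrow> zero_ext \<Omega> u \<in> L2 lebesgue"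
  for u :: "real^'n \<Rightarrow> 'b::euclidean_space"
  by (simp add: zero_ext_L2)

lemma E_eq_iff:
  fixes u :: "real^'n \<Rightarrow> 'b::euclidean_space"
  shows "u \<in> L2D \<Longrightarrow> v \<in> L2D \<Longrightarrow> E u = E v \<longleftrightarrow> (AE x in lebesgue_on \<Omega>. u x = v x)"
  unfolding E_def by (simp add: to_l2_eq_iff zero_ext_L2D AE_zero_ext)

lemma E_add:
  fixes u :: "real^'n \<Rightarrow> 'b::euclidean_space"
  assumes "u \<in> L2D" "v \<in> L2D"
  shows "E (\<lambda>x. u x + v x) = E u + E v"
proof -
  have "zero_ext \<Omega> (\<lambda>x. u x + v x) = (\<lambda>x. zero_ext \<Omega> u x + zero_ext \<Omega> v x)"
    by (simp add: fun_eq_iff zero_ext_def scaleR_add_right)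
  then show ?thesis
    unfolding E_def by (simp only: to_l2_add[OF zero_ext_L2D[OF assms(1)] zero_ext_L2D[OF assms(2)]])
qed

lemma E_scaleR:
  fixes u :: "real^'n \<Rightarrow> 'b::euclidean_space"
  assumes "u \<in> L2D"
  shows "E (\<lambda>x. c *\<^sub>R u x) = c *\<^sub>R E u"
proof -
  have "zero_ext \<Omega> (\<lambda>x. c *\<^sub>R u x) = (\<lambda>x. c *\<^sub>R zero_ext \<Omega> u x)"
    by (simp add: fun_eq_iff zero_ext_def mult.commute)
  then show ?thesis unfolding E_def by (simp only: to_l2_scaleR[OF zero_ext_L2D[OF assms]])
qed

lemma E_diff:
  fixes u :: "real^'n \<Rightarrow> 'b::euclidean_space"
  assumes "u \<in> L2D" "v \<in> L2D"
  shows "E (\<lambda>x. u x - v x) = E u - E v"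
proof -
  have "zero_ext \<Omega> (\<lambda>x. u x - v x) = (\<lambda>x. zero_ext \<Omega> u x - zero_ext \<Omega> v x)"
    by (simp add: fun_eq_iff zero_ext_def scaleR_diff_right)
  then show ?thesis
    unfolding E_def by (simp only: to_l2_diff[OF zero_ext_L2D[OF assms(1)] zero_ext_L2D[OF assms(2)]])
qed

lemma E_inner:
  fixes u :: "real^'n \<Rightarrow> 'b::euclidean_space"
  assumes "u \<in> L2D" "v \<in> L2D"
  shows "E u \<bullet> E v = (LINT x|lebesgue_on \<Omega>. u x \<bullet> v x)"
proof -
  have "zero_ext \<Omega> u x \<bullet> zero_ext \<Omega> v x = indicator \<Omega> x *\<^sub>R (u x \<bullet> v x)" for x
    by (simp add: zero_ext_def indicator_def)
  then show ?thesis
    unfolding E_def using assms by (simp add: to_l2_inner zero_ext_L2D integral_lebesgue_on)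
qed

lemma E_norm:
  fixes u :: "real^'n \<Rightarrow> 'b::euclidean_space"
  shows "u \<in> L2D \<Longrightarrow> (norm (E u))\<^sup>2 = (LINT x|lebesgue_on \<Omega>. (norm (u x))\<^sup>2)"
  by (simp add: power2_norm_eq_inner E_inner)

lemma E_norm_cong:
  fixes u :: "real^'n \<Rightarrow> 'b::euclidean_space" and v :: "real^'n \<Rightarrow> 'c::euclidean_space"
  assumes "u \<in> L2D" "v \<in> L2D" "\<And>x. norm (u x) = norm (v x)"
  shows "norm (E u) = norm (E v)"
  by (rule power2_eq_imp_eq) (simp_all add: E_norm assms)

text \<open>The comparison function lives on the whole space because representatives
  \<open>rep_l2 a\<close> need not vanish outside \<open>\<Omega>\<close>; restriction to
  \<open>\<Omega>\<close> only decreases the left-hand integral.\<close>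

lemma E_norm_le:
  fixes u :: "real^'n \<Rightarrow> 'b::euclidean_space" and v :: "real^'n \<Rightarrow> 'c::euclidean_space"
  assumes "u \<in> L2D" "v \<in> L2 lebesgue" "\<And>x. norm (u x) \<le> K * norm (v x)" "0 \<le> K"
  shows "norm (E u) \<le> K * norm (to_l2 v)"
proof (rule power2_le_imp_le)
  have "(norm (E u))\<^sup>2 = (LINT x|lebesgue. (norm (zero_ext \<Omega> u x))\<^sup>2)"
    unfolding E_def using assms(1) by (simp add: to_l2_norm zero_ext_L2D norm_L2_def)
  also have "\<dots> \<le> (LINT x|lebesgue. K\<^sup>2 * (norm (v x))\<^sup>2)"
  proof (rule integral_mono)
    show "integrable lebesgue (\<lambda>x. (norm (zero_ext \<Omega> u x))\<^sup>2)" by (intro L2_integrable zero_ext_L2D assms)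
    show "integrable lebesgue (\<lambda>x. K\<^sup>2 * (norm (v x))\<^sup>2)" by (intro integrable_mult_right L2_integrable assms)
    show "(norm (zero_ext \<Omega> u x))\<^sup>2 \<le> K\<^sup>2 * (norm (v x))\<^sup>2" for x
      unfolding power_mult_distrib[symmetric]
      using assms(3)[of x] assms(4) by (intro power_mono) (auto simp: zero_ext_def indicator_def)
  qed
  also have "\<dots> = (K * norm (to_l2 v))\<^sup>2"
    using assms(2) by (simp add: to_l2_norm norm_L2_def power_mult_distrib)
  finally show "(norm (E u))\<^sup>2 \<le> (K * norm (to_l2 v))\<^sup>2" .
qed (use assms(4) in simp)

text \<open>The graph embedding of the Sobolev space; by \<open>norm_H1_eq\<close> the Sobolev norm
  becomes the product norm. By \<open>sob_eq\<close> any weak gradient may replace the chosen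
  \<open>wgrad\<close>.\<close>

definition sob :: "(real^'n \<Rightarrow> complex) \<Rightarrow> (real^'n, complex) l2 \<times> (real^'n, complex^'n) l2" where
  "sob u = (E u, E (wgrad \<Omega> u))"

lemma H1_L2D: "u \<in> H1 \<Omega> \<Longrightarrow> u \<in> L2D" "u \<in> H1 \<Omega> \<Longrightarrow> wgrad \<Omega> u \<in> L2D"
  using has_weak_gradientD(1,2)[OF wgrad] by auto

lemma sob_eq: "has_weak_gradient \<Omega> u G \<Longrightarrow> sob u = (E u, E G)"
  unfolding sob_def
  using wgrad_AE_eq[OF open_domain, of u G] H1_L2D(2)[OF has_weak_gradient_H1] has_weak_gradientD(2)[of \<Omega> u G]
  by (simp add: E_eq_iff)

lemma H1_add: "u \<in> H1 \<Omega> \<Longrightarrow> v \<in> H1 \<Omega> \<Longrightarrow> (\<lambda>x. u x + v x) \<in> H1 \<Omega>"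
  by (rule has_weak_gradient_H1[OF has_weak_gradient_add[OF wgrad wgrad domain_sets]])

lemma sob_add: "u \<in> H1 \<Omega> \<Longrightarrow> v \<in> H1 \<Omega> \<Longrightarrow> sob (\<lambda>x. u x + v x) = sob u + sob v"
  by (subst sob_eq[OF has_weak_gradient_add[OF wgrad wgrad domain_sets]]) (auto simp: sob_def E_add H1_L2D)

lemma H1_scale: "u \<in> H1 \<Omega> \<Longrightarrow> (\<lambda>x. c * u x) \<in> H1 \<Omega>"
  by (rule has_weak_gradient_H1[OF has_weak_gradient_scale[OF wgrad]])

lemma sob_scaleR:
  assumes "u \<in> H1 \<Omega>"
  shows "sob (\<lambda>x. c *\<^sub>R u x) = c *\<^sub>R sob u"
proof -
  have "complex_of_real c *s z = c *\<^sub>R z" for z :: "complex^'n"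
    by (simp add: vec_eq_iff scaleR_conv_of_real[where 'a = complex])
  then have "has_weak_gradient \<Omega> (\<lambda>x. c *\<^sub>R u x) (\<lambda>x. c *\<^sub>R wgrad \<Omega> u x)"
    using has_weak_gradient_scale[OF wgrad[OF assms], of "complex_of_real c"] by (simp add: scaleR_conv_of_real)
  from sob_eq[OF this] show ?thesis by (simp add: sob_def E_scaleR H1_L2D[OF assms])
qed

lemma H1_diff: "u \<in> H1 \<Omega> \<Longrightarrow> v \<in> H1 \<Omega> \<Longrightarrow> (\<lambda>x. u x - v x) \<in> H1 \<Omega>"
  using H1_add[of u "\<lambda>x. -1 * v x"] H1_scale[of v "-1"] by simp

lemma sob_diff: "u \<in> H1 \<Omega> \<Longrightarrow> v \<in> H1 \<Omega> \<Longrightarrow> sob (\<lambda>x. u x - v x) = sob u - sob v"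
  using sob_add[of u "\<lambda>x. -1 * v x"] H1_scale[of v "-1"] sob_scaleR[of v "-1"] by simp

lemma C1_H1: "cont_diff f \<Longrightarrow> f \<in> H1 \<Omega>"
  by (rule has_weak_gradient_H1[OF has_weak_gradient_C1[OF open_domain bounded_domain]])

lemma sob_C1: "cont_diff f \<Longrightarrow> sob f = (E f, E (grad f))"
  by (rule sob_eq[OF has_weak_gradient_C1[OF open_domain bounded_domain]])

lemma test_C1: "\<phi> \<in> test_functions \<Omega> \<Longrightarrow> cont_diff \<phi>"
  by (rule C1c_imp_C1[OF test_function_C1c])

text \<open>The gradient of the conjugate function inside \<open>inner_H1\<close> is a choice
  independent of \<open>wgrad \<Omega> u\<close>; it agrees with the conjugated gradient almost
  everywhere, so the bilinear \<open>cdot\<close> yields a squared norm.\<close>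

lemma norm_H1_eq:
  assumes "u \<in> H1 \<Omega>"
  shows "norm_H1 \<Omega> u = norm (sob u)"
proof -
  note L = H1_L2D[OF assms]
  have c: "has_weak_gradient \<Omega> (\<lambda>x. cnj (u x)) (\<lambda>x. cnj_vec (wgrad \<Omega> u x))"
    by (rule has_weak_gradient_cnj[OF wgrad[OF assms]])
  note Lc = H1_L2D[OF has_weak_gradient_H1[OF c]] has_weak_gradientD(2)[OF c]
  have sq: "cdot z (cnj_vec z) = complex_of_real ((norm z)\<^sup>2)" for z :: "complex^'n"
    by (simp add: cdot_def cnj_vec_def norm_vec_def L2_set_def sum_nonneg complex_norm_square del: of_real_power)
  have "(LINT x|lebesgue_on \<Omega>. cdot (wgrad \<Omega> u x) (wgrad \<Omega> (\<lambda>y. cnj (u y)) x)) =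
      (LINT x|lebesgue_on \<Omega>. cdot (wgrad \<Omega> u x) (cnj_vec (wgrad \<Omega> u x)))"
  proof (rule integral_cong_AE)
    show "AE x in lebesgue_on \<Omega>. cdot (wgrad \<Omega> u x) (wgrad \<Omega> (\<lambda>y. cnj (u y)) x) = cdot (wgrad \<Omega> u x) (cnj_vec (wgrad \<Omega> u x))"
      using wgrad_AE_eq[OF open_domain c] by eventually_elim simp
  qed (intro borel_measurable_integrable cdot_integrable L Lc)+
  also have "\<dots> = complex_of_real ((norm (E (wgrad \<Omega> u)))\<^sup>2)"
    unfolding sq by (simp only: integral_complex_of_real E_norm[OF L(2)])
  finally have 1: "(LINT x|lebesgue_on \<Omega>. cdot (wgrad \<Omega> u x) (wgrad \<Omega> (\<lambda>y. cnj (u y)) x)) =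
      complex_of_real ((norm (E (wgrad \<Omega> u)))\<^sup>2)" .
  have 2: "(LINT x|lebesgue_on \<Omega>. u x * cnj (u x)) = complex_of_real ((norm (E u))\<^sup>2)"
    unfolding complex_norm_square[symmetric] E_norm[OF L(1)] by (rule integral_complex_of_real)
  have "inner_H1 \<Omega> u u = complex_of_real ((norm (E u))\<^sup>2 + (norm (E (wgrad \<Omega> u)))\<^sup>2)"
    unfolding inner_H1_def 1 2 by simp
  then show ?thesis by (simp add: norm_H1_def sob_def norm_Pair)
qed

section \<open>The closed subspace corresponding to functions with zero boundary values\<close>

text \<open>The image of \<open>H10 \<Omega>\<close> under \<open>sob\<close>. As a closure it is
  complete by construction; that its elements come from functions with a weak gradient is the
  content of \<open>V_representative\<close>.\<close>

definition V :: "((real^'n, complex) l2 \<times> (real^'n, complex^'n) l2) set" where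
  "V = closure (sob ` test_functions \<Omega>)"

lemma closed_V: "closed V" by (simp add: V_def)

lemma subspace_V: "subspace V"
  unfolding V_def
proof (rule subspace_closure, rule subspaceI)
  have "sob (\<lambda>x. 0) = 0"
    using sob_scaleR[OF C1_H1[OF test_C1[OF test_function_zero]], of 0] by simp
  then show "0 \<in> sob ` test_functions \<Omega>" using test_function_zero by (metis imageI)
next
  fix x y assume "x \<in> sob ` test_functions \<Omega>" "y \<in> sob ` test_functions \<Omega>"
  then obtain \<phi> \<psi> where t: "\<phi> \<in> test_functions \<Omega>" "\<psi> \<in> test_functions \<Omega>" and "x = sob \<phi>" "y = sob \<psi>" by blast
  then have "x + y = sob (\<lambda>x. \<phi> x + \<psi> x)" by (simp add: sob_add C1_H1 test_C1)
  then show "x + y \<in> sob ` test_functions \<Omega>" using test_function_add[OF t] by blast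
next
  fix c x assume "x \<in> sob ` test_functions \<Omega>"
  then obtain \<phi> where t: "\<phi> \<in> test_functions \<Omega>" and "x = sob \<phi>" by blast
  then have "c *\<^sub>R x = sob (\<lambda>x. c *\<^sub>R \<phi> x)" by (simp add: sob_scaleR C1_H1 test_C1)
  then show "c *\<^sub>R x \<in> sob ` test_functions \<Omega>" using test_function_scaleR[OF t] by blast
qed

lemma H10_iff: "u \<in> H10 \<Omega> \<longleftrightarrow> u \<in> H1 \<Omega> \<and> sob u \<in> V"
proof (cases "u \<in> H1 \<Omega>")
  case True
  have "norm_H1 \<Omega> (\<lambda>x. u x - \<phi> x) = dist (sob \<phi>) (sob u)" if "\<phi> \<in> test_functions \<Omega>" for \<phi>
    using True C1_H1[OF test_C1[OF that]]
    by (simp add: norm_H1_eq H1_diff sob_diff dist_norm norm_minus_commute)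
  then show ?thesis using True unfolding H10_def V_def closure_approachable by auto
qed (simp add: H10_def)

lemma H10_H1: "u \<in> H10 \<Omega> \<Longrightarrow> u \<in> H1 \<Omega>"
  by (simp add: H10_def)

lemma V_induct:
  assumes "v \<in> V" "closed {v. P v}" "\<And>\<phi>. \<phi> \<in> test_functions \<Omega> \<Longrightarrow> P (sob \<phi>)"
  shows "P v"
proof -
  have "V \<subseteq> {v. P v}" unfolding V_def by (rule closure_minimal) (use assms in auto)
  then show ?thesis using assms(1) by blast
qed

text \<open>The hypothesis says that \<open>a\<close> has no part outside \<open>\<Omega>\<close>.
  Expressed through inner products it is a closed condition, so it passes from test functions to
  \<open>V\<close>.\<close>

lemma E_rep_l2:
  fixes a :: "(real^'n, 'b::euclidean_space) l2"
  assumes "\<And>z. z \<in> L2 lebesgue \<Longrightarrow> a \<bullet> to_l2 (zero_ext (- \<Omega>) z) = 0"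
  shows "E (rep_l2 a) = a"
proof -
  let ?w = "rep_l2 a" and ?d = "to_l2 (zero_ext (- \<Omega>) (rep_l2 a))"
  note w = rep_l2(1)[of a]
  have c: "- \<Omega> \<in> sets lebesgue" using sets.compl_sets[OF domain_sets] by (simp add: Compl_eq_Diff_UNIV)
  note z = L2_zero_ext[OF w domain_sets] L2_zero_ext[OF w c]
  have "zero_ext \<Omega> ?w x + zero_ext (- \<Omega>) ?w x = ?w x" for x by (auto simp: zero_ext_def indicator_def)
  then have s: "E ?w + ?d = a" unfolding E_def using to_l2_add[OF z] rep_l2(2)[of a] by simp
  have "zero_ext \<Omega> ?w x \<bullet> zero_ext (- \<Omega>) ?w x = 0" for x by (auto simp: zero_ext_def indicator_def)
  then have "E ?w \<bullet> ?d = 0" unfolding E_def using to_l2_inner[OF z] by simp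
  moreover have "a \<bullet> ?d = 0" by (rule assms[OF w])
  moreover have "a \<bullet> ?d = E ?w \<bullet> ?d + ?d \<bullet> ?d" using s by (metis inner_add_left)
  ultimately have "?d \<bullet> ?d = 0" by simp
  then show ?thesis using s by simp
qed

lemma E_orthogonal:
  fixes u z :: "real^'n \<Rightarrow> 'b::euclidean_space"
  assumes "u \<in> L2D" "z \<in> L2 lebesgue"
  shows "E u \<bullet> to_l2 (zero_ext (- \<Omega>) z) = 0"
proof -
  have c: "- \<Omega> \<in> sets lebesgue" using sets.compl_sets[OF domain_sets] by (simp add: Compl_eq_Diff_UNIV)
  have "zero_ext \<Omega> u x \<bullet> zero_ext (- \<Omega>) z x = 0" for x by (auto simp: zero_ext_def indicator_def)
  then show ?thesis unfolding E_def using to_l2_inner[OF zero_ext_L2D[OF assms(1)] L2_zero_ext[OF assms(2) c]] by simp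
qed

text \<open>The real part of the identity defining a weak gradient becomes a continuous function of
  the two classes and so survives the passage to the closure. \<open>axis i\<close> selects the
  component, and the conjugates undo the one in the real inner product.\<close>

lemma weak_gradient_real_form:
  assumes u: "u \<in> L2D" and G: "G \<in> L2D" and \<psi>: "\<psi> \<in> test_functions \<Omega>"
  shows "E u \<bullet> E (\<lambda>x. cnj (partial i \<psi> x)) + E G \<bullet> E (\<lambda>x. axis i (cnj (\<psi> x))) =
    Re ((LINT x|lebesgue_on \<Omega>. u x * partial i \<psi> x) + (LINT x|lebesgue_on \<Omega>. G x $ i * \<psi> x))"
proof -
  note t = test_function_L2(4,5)[OF \<psi> domain_sets]
  have m: "(\<lambda>x. cnj (f x)) \<in> borel_measurable (lebesgue_on \<Omega>)" if "f \<in> L2D" for f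
    using borel_measurable_continuous_on[OF _ L2_measurable[OF that], of cnj] by (simp add: continuous_intros)
  have 1: "(\<lambda>x. cnj (partial i \<psi> x)) \<in> L2D" by (rule L2_dominated[OF t(2)[of i] m[OF t(2)]]) simp
  have "continuous_on UNIV (\<lambda>c :: complex. axis i c :: complex^'n)"
    unfolding axis_def
  proof (rule continuous_on_vec_lambda)
    show "continuous_on UNIV (\<lambda>c :: complex. if j = i then c else 0)" for j by (cases "j = i") auto
  qed
  then have "(\<lambda>x. axis i (cnj (\<psi> x)) :: complex^'n) \<in> borel_measurable (lebesgue_on \<Omega>)"
    by (rule borel_measurable_continuous_on[OF _ m[OF t(1)]])
  then have 2: "(\<lambda>x. axis i (cnj (\<psi> x)) :: complex^'n) \<in> L2D"
    by (rule L2_dominated[OF t(1)]) (simp add: norm_vec_def L2_set_def axis_def if_distrib[of norm] if_distrib[of "\<lambda>t. t\<^sup>2"] cong: if_cong)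
  have "E u \<bullet> E (\<lambda>x. cnj (partial i \<psi> x)) = Re (LINT x|lebesgue_on \<Omega>. u x * partial i \<psi> x)"
    unfolding E_inner[OF u 1] Re_mult_inner[symmetric] by (rule integral_Re[OF L2_mult_integrable[OF u t(2)]])
  moreover have "E G \<bullet> E (\<lambda>x. axis i (cnj (\<psi> x))) = Re (LINT x|lebesgue_on \<Omega>. G x $ i * \<psi> x)"
    unfolding E_inner[OF G 2] inner_axis Re_mult_inner[symmetric]
    by (rule integral_Re[OF L2_mult_integrable[OF L2_vec_nth[OF G] t(1)]])
  ultimately show ?thesis by simp
qed

text \<open>This is closedness of the weak gradient: a limit of pairs in \<open>sob\<close> is again
  a function with its weak gradient. Both components are orthogonal to everything outside
  \<open>\<Omega>\<close>, and the defining identity is inherited from test functions by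
  continuity.\<close>

lemma V_representative:
  assumes "v \<in> V"
  shows "\<exists>w\<in>H10 \<Omega>. sob w = v"
proof -
  define w where "w = rep_l2 (fst v)"
  define G where "G = rep_l2 (snd v)"
  have fst: "E w = fst v" unfolding w_def
  proof (rule E_rep_l2)
    fix z :: "real^'n \<Rightarrow> complex" assume z: "z \<in> L2 lebesgue"
    show "fst v \<bullet> to_l2 (zero_ext (- \<Omega>) z) = 0"
      by (rule V_induct[OF assms])
         (auto intro!: closed_Collect_eq continuous_intros simp: sob_def E_orthogonal[OF _ z] H1_L2D C1_H1 test_C1)
  qed
  have snd: "E G = snd v" unfolding G_def
  proof (rule E_rep_l2)
    fix z :: "real^'n \<Rightarrow> complex^'n" assume z: "z \<in> L2 lebesgue"
    show "snd v \<bullet> to_l2 (zero_ext (- \<Omega>) z) = 0"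
      by (rule V_induct[OF assms])
         (auto intro!: closed_Collect_eq continuous_intros simp: sob_def E_orthogonal[OF _ z] H1_L2D C1_H1 test_C1)
  qed
  have wL: "w \<in> L2D" and GL: "G \<in> L2D" by (auto simp: w_def G_def intro!: L2_lebesgue_on rep_l2)
  define S where "S \<psi> i = (LINT x|lebesgue_on \<Omega>. w x * partial i \<psi> x) + (LINT x|lebesgue_on \<Omega>. G x $ i * \<psi> x)" for \<psi> i
  have Re0: "Re (S \<psi> i) = 0" if \<psi>: "\<psi> \<in> test_functions \<Omega>" for \<psi> i
  proof -
    have "fst v \<bullet> E (\<lambda>x. cnj (partial i \<psi> x)) + snd v \<bullet> E (\<lambda>x. axis i (cnj (\<psi> x))) = 0"
    proof (rule V_induct[OF assms])
      show "closed {v :: (real^'n, complex) l2 \<times> (real^'n, complex^'n) l2.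
          fst v \<bullet> E (\<lambda>x. cnj (partial i \<psi> x)) + snd v \<bullet> E (\<lambda>x. axis i (cnj (\<psi> x))) = 0}"
        by (intro closed_Collect_eq continuous_intros)
      fix \<phi> assume "\<phi> \<in> test_functions \<Omega>"
      then have h: "\<phi> \<in> H1 \<Omega>" by (intro C1_H1 test_C1)
      show "fst (sob \<phi>) \<bullet> E (\<lambda>x. cnj (partial i \<psi> x)) + snd (sob \<phi>) \<bullet> E (\<lambda>x. axis i (cnj (\<psi> x))) = 0"
        using weak_gradient_real_form[OF H1_L2D[OF h] \<psi>, of i] has_weak_gradientD(3)[OF wgrad[OF h] \<psi>, of i]
        by (simp add: sob_def)
    qed
    then show ?thesis
      using weak_gradient_real_form[OF wL GL \<psi>, of i] unfolding fst snd S_def by simp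
  qed
  have S0: "S \<psi> i = 0" if \<psi>: "\<psi> \<in> test_functions \<Omega>" for \<psi> i
  proof -
    have t: "(\<lambda>x. \<i> * \<psi> x) \<in> test_functions \<Omega>"
      by (rule test_function_bounded_linear[OF bounded_linear_mult_right _ \<psi>]) (auto simp: inj_def)
    have p: "partial i (\<lambda>x. \<i> * \<psi> x) x = \<i> * partial i \<psi> x" for x
      by (rule partial_bounded_linear[OF bounded_linear_mult_right C1_differentiable[OF test_C1[OF \<psi>]]])
    \<comment> \<open>The real part of this is minus the imaginary part of
      \<open>S \<psi> i\<close>.\<close>
    have "S (\<lambda>x. \<i> * \<psi> x) i = \<i> * S \<psi> i"
      unfolding S_def p by (simp add: distrib_left mult.left_commute[of _ \<i>])
    then show ?thesis using Re0[OF \<psi>, of i] Re0[OF t, of i] by (simp add: complex_eq_iff)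
  qed
  have hw: "has_weak_gradient \<Omega> w G"
    unfolding has_weak_gradient_def using wL GL S0 by (auto simp: S_def add_eq_0_iff2)
  then have "sob w = v" using sob_eq[OF hw] fst snd by (simp add: prod_eq_iff)
  moreover have "w \<in> H10 \<Omega>" using has_weak_gradient_H1[OF hw] \<open>sob w = v\<close> assms by (simp add: H10_iff)
  ultimately show ?thesis by blast
qed

section \<open>Conjugation, multiplication by \<open>\<i>\<close> and the real weak form\<close>

lemma norm_H1_cnj: "u \<in> H1 \<Omega> \<Longrightarrow> (\<lambda>x. cnj (u x)) \<in> H1 \<Omega> \<and> norm_H1 \<Omega> (\<lambda>x. cnj (u x)) = norm_H1 \<Omega> u"
proof
  assume u: "u \<in> H1 \<Omega>"
  have c: "has_weak_gradient \<Omega> (\<lambda>x. cnj (u x)) (\<lambda>x. cnj_vec (wgrad \<Omega> u x))"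
    by (rule has_weak_gradient_cnj[OF wgrad[OF u]])
  show h: "(\<lambda>x. cnj (u x)) \<in> H1 \<Omega>" by (rule has_weak_gradient_H1[OF c])
  have "norm (E (\<lambda>x. cnj (u x))) = norm (E u)" by (intro E_norm_cong has_weak_gradientD[OF c] H1_L2D u) simp
  moreover have "norm (E (\<lambda>x. cnj_vec (wgrad \<Omega> u x))) = norm (E (wgrad \<Omega> u))"
    by (intro E_norm_cong has_weak_gradientD[OF c] H1_L2D u) simp
  ultimately show "norm_H1 \<Omega> (\<lambda>x. cnj (u x)) = norm_H1 \<Omega> u"
    by (simp add: norm_H1_eq h u sob_eq[OF c] norm_Pair) (simp add: sob_def norm_Pair)
qed

lemma norm_H1_imaginary: "u \<in> H1 \<Omega> \<Longrightarrow> norm_H1 \<Omega> (\<lambda>x. \<i> * u x) = norm_H1 \<Omega> u"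
proof -
  assume u: "u \<in> H1 \<Omega>"
  have c: "has_weak_gradient \<Omega> (\<lambda>x. \<i> * u x) (\<lambda>x. \<i> *s wgrad \<Omega> u x)"
    by (rule has_weak_gradient_scale[OF wgrad[OF u]])
  note h = has_weak_gradient_H1[OF c]
  have "norm (E (\<lambda>x. \<i> * u x)) = norm (E u)"
    by (intro E_norm_cong has_weak_gradientD[OF c] H1_L2D u) (simp add: norm_mult)
  moreover have "norm (E (\<lambda>x. \<i> *s wgrad \<Omega> u x)) = norm (E (wgrad \<Omega> u))"
    by (intro E_norm_cong has_weak_gradientD[OF c] H1_L2D u) (simp add: norm_vector_scalar_mult)
  ultimately show "norm_H1 \<Omega> (\<lambda>x. \<i> * u x) = norm_H1 \<Omega> u"
    by (simp add: norm_H1_eq h u sob_eq[OF c] norm_Pair) (simp add: sob_def norm_Pair)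
qed

lemma H10_cnj:
  assumes "u \<in> H10 \<Omega>"
  shows "(\<lambda>x. cnj (u x)) \<in> H10 \<Omega>"
  unfolding H10_def
proof (intro CollectI conjI allI impI)
  show "(\<lambda>x. cnj (u x)) \<in> H1 \<Omega>" using norm_H1_cnj[OF H10_H1[OF assms]] by blast
  fix \<epsilon> :: real assume "\<epsilon> > 0"
  then obtain \<phi> where \<phi>: "\<phi> \<in> test_functions \<Omega>" "norm_H1 \<Omega> (\<lambda>x. u x - \<phi> x) < \<epsilon>"
    using assms by (auto simp: H10_def)
  have "norm_H1 \<Omega> (\<lambda>x. cnj (u x) - cnj (\<phi> x)) < \<epsilon>"
    using norm_H1_cnj[OF H1_diff[OF H10_H1[OF assms] C1_H1[OF test_C1[OF \<phi>(1)]]]] \<phi>(2) by simp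
  moreover have "(\<lambda>x. cnj (\<phi> x)) \<in> test_functions \<Omega>"
    by (rule test_function_bounded_linear[OF bounded_linear_cnj _ \<phi>(1)]) (auto simp: inj_def)
  ultimately show "\<exists>\<phi>\<in>test_functions \<Omega>. norm_H1 \<Omega> (\<lambda>x. cnj (u x) - \<phi> x) < \<epsilon>"
    by (intro bexI[of _ "\<lambda>x. cnj (\<phi> x)"])
qed

lemma H10_imaginary:
  assumes "u \<in> H10 \<Omega>"
  shows "(\<lambda>x. \<i> * u x) \<in> H10 \<Omega>"
  unfolding H10_def
proof (intro CollectI conjI allI impI)
  show "(\<lambda>x. \<i> * u x) \<in> H1 \<Omega>" by (rule H1_scale[OF H10_H1[OF assms]])
  fix \<epsilon> :: real assume "\<epsilon> > 0"
  then obtain \<phi> where \<phi>: "\<phi> \<in> test_functions \<Omega>" "norm_H1 \<Omega> (\<lambda>x. u x - \<phi> x) < \<epsilon>"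
    using assms by (auto simp: H10_def)
  have "norm_H1 \<Omega> (\<lambda>x. \<i> * u x - \<i> * \<phi> x) < \<epsilon>"
    using norm_H1_imaginary[OF H1_diff[OF H10_H1[OF assms] C1_H1[OF test_C1[OF \<phi>(1)]]]] \<phi>(2)
    by (simp add: right_diff_distrib)
  moreover have "(\<lambda>x. \<i> * \<phi> x) \<in> test_functions \<Omega>"
    by (rule test_function_bounded_linear[OF bounded_linear_mult_right _ \<phi>(1)]) (auto simp: inj_def)
  ultimately show "\<exists>\<phi>\<in>test_functions \<Omega>. norm_H1 \<Omega> (\<lambda>x. \<i> * u x - \<phi> x) < \<epsilon>"
    by (intro bexI[of _ "\<lambda>x. \<i> * \<phi> x"])
qed

text \<open>Replacing \<open>v\<close> by its conjugate turns the real part of the bilinear form into the real inner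
  product; replacing \<open>v\<close> by \<open>\<i> * v\<close> recovers the imaginary part.\<close>

lemma weak_form_iff_real_form:
  assumes p: "p \<in> L2D" and P: "P \<in> L2D"
  shows "(\<forall>v\<in>H10 \<Omega>. (LINT x|lebesgue_on \<Omega>. cdot (P x) (wgrad \<Omega> v x)) + (LINT x|lebesgue_on \<Omega>. p x * v x) = 0)
    \<longleftrightarrow> (\<forall>z\<in>V. E P \<bullet> snd z + E p \<bullet> fst z = 0)"
proof -
  define S where "S v = (LINT x|lebesgue_on \<Omega>. cdot (P x) (wgrad \<Omega> v x)) + (LINT x|lebesgue_on \<Omega>. p x * v x)" for v
  have ReS: "Re (S v) = E P \<bullet> snd (sob (\<lambda>x. cnj (v x))) + E p \<bullet> fst (sob (\<lambda>x. cnj (v x)))" if v: "v \<in> H10 \<Omega>" for v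
  proof -
    have h: "v \<in> H1 \<Omega>" using v by (rule H10_H1)
    have c: "has_weak_gradient \<Omega> (\<lambda>x. cnj (v x)) (\<lambda>x. cnj_vec (wgrad \<Omega> v x))"
      by (rule has_weak_gradient_cnj[OF wgrad[OF h]])
    have "Re (LINT x|lebesgue_on \<Omega>. cdot (P x) (wgrad \<Omega> v x)) = E P \<bullet> E (\<lambda>x. cnj_vec (wgrad \<Omega> v x))"
      using cdot_integrable[OF P H1_L2D(2)[OF h]]
      by (simp add: E_inner[OF P has_weak_gradientD(2)[OF c]] Re_cdot_inner[symmetric])
    moreover have "Re (LINT x|lebesgue_on \<Omega>. p x * v x) = E p \<bullet> E (\<lambda>x. cnj (v x))"
      unfolding E_inner[OF p has_weak_gradientD(1)[OF c]] Re_mult_inner[symmetric]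
      by (rule integral_Re[OF L2_mult_integrable[OF p H1_L2D(1)[OF h]], symmetric])
    ultimately show ?thesis by (simp add: S_def sob_eq[OF c])
  qed
  have Si: "S (\<lambda>x. \<i> * v x) = \<i> * S v" if v: "v \<in> H10 \<Omega>" for v
  proof -
    have h: "v \<in> H1 \<Omega>" using v by (rule H10_H1)
    have c: "has_weak_gradient \<Omega> (\<lambda>x. \<i> * v x) (\<lambda>x. \<i> *s wgrad \<Omega> v x)"
      by (rule has_weak_gradient_scale[OF wgrad[OF h]])
    have "(LINT x|lebesgue_on \<Omega>. cdot (P x) (wgrad \<Omega> (\<lambda>x. \<i> * v x) x)) = (LINT x|lebesgue_on \<Omega>. cdot (P x) (\<i> *s wgrad \<Omega> v x))"
    proof (rule integral_cong_AE)
      show "AE x in lebesgue_on \<Omega>. cdot (P x) (wgrad \<Omega> (\<lambda>x. \<i> * v x) x) = cdot (P x) (\<i> *s wgrad \<Omega> v x)"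
        using wgrad_AE_eq[OF open_domain c] by eventually_elim simp
    qed (intro borel_measurable_integrable cdot_integrable P H1_L2D(2) has_weak_gradient_H1[OF c] has_weak_gradientD(2)[OF c])+
    also have "\<dots> = (LINT x|lebesgue_on \<Omega>. \<i> * cdot (P x) (wgrad \<Omega> v x))"
      by (simp add: cdot_def sum_distrib_left mult.left_commute)
    finally show ?thesis
      unfolding S_def by (simp add: distrib_left mult.left_commute[of _ \<i>])
  qed
  show ?thesis unfolding S_def[symmetric]
  proof
    assume a: "\<forall>v\<in>H10 \<Omega>. S v = 0"
    show "\<forall>z\<in>V. E P \<bullet> snd z + E p \<bullet> fst z = 0"
    proof
      fix z assume "z \<in> V"
      then obtain w where w: "w \<in> H10 \<Omega>" "sob w = z" using V_representative by blast
      show "E P \<bullet> snd z + E p \<bullet> fst z = 0"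
        \<comment> \<open>The conjugate of \<open>w\<close> is tested, so that the conjugation in
          \<open>ReS\<close> gives back \<open>w\<close>.\<close>
        using ReS[OF H10_cnj[OF w(1)]] a H10_cnj[OF w(1)] w(2) by simp
    qed
  next
    assume a: "\<forall>z\<in>V. E P \<bullet> snd z + E p \<bullet> fst z = 0"
    have Re0: "Re (S v) = 0" if v: "v \<in> H10 \<Omega>" for v
      using ReS[OF v] a H10_cnj[OF v] by (simp add: H10_iff)
    show "\<forall>v\<in>H10 \<Omega>. S v = 0"
    proof
      fix v assume v: "v \<in> H10 \<Omega>"
      show "S v = 0" using Re0[OF v] Re0[OF H10_imaginary[OF v]] Si[OF v] by (simp add: complex_eq_iff)
    qed
  qed
qed

section \<open>Compactness of the embedding into square-integrable functions\<close>

text \<open>Each \<open>x k\<close> is replaced by a test function within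
  \<open>inverse (real (Suc k))\<close>, to which Rellich's theorem applies; the test functions have
  norm at most \<open>M + 1\<close>. The errors vanish along the subsequence because
  \<open>k \<le> r k\<close>.\<close>

lemma V_compact:
  assumes x: "\<And>k::nat. x k \<in> V" and M: "\<And>k. norm (x k) \<le> M"
  shows "\<exists>r. strict_mono r \<and> Cauchy (\<lambda>k. fst (x (r k)))"
proof -
  have "\<exists>\<phi>\<in>test_functions \<Omega>. dist (sob \<phi>) (x k) < inverse (real (Suc k))" for k
    using x[of k] unfolding V_def closure_approachable by (auto dest!: spec[of _ "inverse (real (Suc k))"])
  then obtain \<phi> where t: "\<And>k. \<phi> k \<in> test_functions \<Omega>" and d: "\<And>k. dist (sob (\<phi> k)) (x k) < inverse (real (Suc k))" by metis
  have sobt: "sob (\<phi> k) = (E (\<phi> k), E (grad (\<phi> k)))" for k by (intro sob_C1 test_C1 t)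
  have bd: "norm (sob (\<phi> k)) \<le> M + 1" for k
  proof -
    have "inverse (real (Suc k)) \<le> 1" by (simp add: divide_simps)
    then show ?thesis using norm_triangle_sub[of "sob (\<phi> k)" "x k"] d[of k] M[of k] by (simp add: dist_norm)
  qed
  have nE: "(norm (E f))\<^sup>2 = (LINT x|lborel. (norm (f x))\<^sup>2)"
    if "\<And>x. x \<notin> \<Omega> \<Longrightarrow> f x = 0" "f \<in> L2 lebesgue" "f \<in> borel_measurable borel" for f :: "real^'n \<Rightarrow> 'b::euclidean_space"
  proof -
    have "zero_ext \<Omega> f = f" using that(1) by (auto simp: zero_ext_def indicator_def)
    then show ?thesis using that(2,3) unfolding E_def
      by (simp add: to_l2_norm norm_L2_def integral_completion)
  qed
  have meas: "\<phi> k \<in> borel_measurable borel" "grad (\<phi> k) \<in> borel_measurable borel" for k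
    by (intro borel_measurable_continuous_onI C1_continuous C1_continuous_grad test_C1 t)+
  have n1: "(LINT x|lborel. (norm (\<phi> k x))\<^sup>2) \<le> (M + 1)\<^sup>2" for k
  proof -
    have "norm (E (\<phi> k)) \<le> M + 1" using norm_fst_le[of "E (\<phi> k)" "E (grad (\<phi> k))"] bd[of k] by (simp add: sobt)
    then have "(norm (E (\<phi> k)))\<^sup>2 \<le> (M + 1)\<^sup>2" by (intro power_mono) auto
    then show ?thesis using nE[OF _ test_function_L2(1)[OF t] meas(1)] test_function_outside[OF t] by simp
  qed
  have n2: "(LINT x|lborel. (norm (grad (\<phi> k) x))\<^sup>2) \<le> (M + 1)\<^sup>2" for k
  proof -
    have "norm (E (grad (\<phi> k))) \<le> M + 1" using norm_snd_le[of "E (grad (\<phi> k))" "E (\<phi> k)"] bd[of k] by (simp add: sobt)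
    then have "(norm (E (grad (\<phi> k))))\<^sup>2 \<le> (M + 1)\<^sup>2" by (intro power_mono) auto
    then show ?thesis using nE[OF _ test_function_L2(2)[OF t] meas(2)] test_function_outside[OF t] by simp
  qed
  obtain R where R: "\<And>x. x \<in> \<Omega> \<Longrightarrow> norm x \<le> R" using bounded_domain by (auto simp: bounded_iff)
  have "\<exists>r :: nat \<Rightarrow> nat. strict_mono r \<and> (\<forall>\<epsilon>>0. \<exists>N. \<forall>k\<ge>N. \<forall>l\<ge>N. (LINT x|lborel. (norm (\<phi> (r k) x - \<phi> (r l) x))\<^sup>2) < \<epsilon>)"
  proof (rule C1c_Rellich[OF test_function_C1c[OF t] _ n1 n2])
    show "norm x \<le> R" if "\<phi> k x \<noteq> 0" for k x using test_function_outside[OF t, of x k] that R by blast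
  qed
  then obtain r :: "nat \<Rightarrow> nat" where r: "strict_mono r"
    and cau: "\<And>\<epsilon>. \<epsilon> > 0 \<Longrightarrow> \<exists>N. \<forall>k\<ge>N. \<forall>l\<ge>N. (LINT x|lborel. (norm (\<phi> (r k) x - \<phi> (r l) x))\<^sup>2) < \<epsilon>" by blast
  have "Cauchy (\<lambda>k. fst (x (r k)))"
  proof (rule CauchyI)
    fix e :: real assume e: "e > 0"
    obtain N1 where N1: "\<And>k l. k \<ge> N1 \<Longrightarrow> l \<ge> N1 \<Longrightarrow> (LINT x|lborel. (norm (\<phi> (r k) x - \<phi> (r l) x))\<^sup>2) < (e / 3)\<^sup>2"
      using cau[of "(e / 3)\<^sup>2"] e by auto
    obtain N2 where N2: "inverse (real (Suc N2)) < e / 3" using reals_Archimedean[of "e / 3"] e by auto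
    have small: "norm (E (\<phi> (r k)) - fst (x (r k))) < e / 3" if "k \<ge> N2" for k
    proof -
      have "norm (E (\<phi> (r k)) - fst (x (r k))) \<le> dist (sob (\<phi> (r k))) (x (r k))"
      proof -
        have "norm (fst (sob (\<phi> (r k)) - x (r k))) \<le> norm (sob (\<phi> (r k)) - x (r k))"
          by (metis norm_fst_le prod.collapse)
        then show ?thesis by (simp add: sobt dist_norm)
      qed
      also have "\<dots> < inverse (real (Suc (r k)))" by (rule d)
      also have "\<dots> \<le> inverse (real (Suc N2))"
        using seq_suble[OF r, of k] that by (intro le_imp_inverse_le) auto
      finally show ?thesis using N2 by simp
    qed
    have diff: "norm (E (\<phi> (r k)) - E (\<phi> (r l))) < e / 3" if "k \<ge> N1" "l \<ge> N1" for k l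
    proof -
      have L: "\<phi> k \<in> L2D" for k by (rule test_function_L2(4)[OF t domain_sets])
      have "(norm (E (\<phi> (r k)) - E (\<phi> (r l))))\<^sup>2 = (norm (E (\<lambda>x. \<phi> (r k) x - \<phi> (r l) x)))\<^sup>2"
        by (simp add: E_diff L)
      also have "\<dots> = (LINT x|lborel. (norm (\<phi> (r k) x - \<phi> (r l) x))\<^sup>2)"
        using test_function_outside[OF t] meas
        by (intro nE L2_diff test_function_L2(1)[OF t]) auto
      also have "\<dots> < (e / 3)\<^sup>2" by (rule N1[OF that])
      finally show ?thesis by (rule power_less_imp_less_base) (use e in simp)
    qed
    show "\<exists>M. \<forall>m\<ge>M. \<forall>n\<ge>M. norm (fst (x (r m)) - fst (x (r n))) < e"
    proof (intro exI[of _ "max N1 N2"] allI impI)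
      fix k l assume kl: "max N1 N2 \<le> k" "max N1 N2 \<le> l"
      let ?a = "E (\<phi> (r k)) - E (\<phi> (r l))" and ?b = "E (\<phi> (r k)) - fst (x (r k))" and ?c = "E (\<phi> (r l)) - fst (x (r l))"
      have "fst (x (r k)) - fst (x (r l)) = (?a - ?b) + ?c" by simp
      then have "norm (fst (x (r k)) - fst (x (r l))) \<le> norm ?a + norm ?b + norm ?c"
        using norm_triangle_ineq[of "?a - ?b" ?c] norm_triangle_ineq4[of ?a ?b] by simp
      then show "norm (fst (x (r k)) - fst (x (r l))) < e"
        using small[of k] small[of l] diff[of k l] kl by simp
    qed
  qed
  then show ?thesis using r by blast
qed

section \<open>The semilinear problem\<close>

lemma Poincare_inequality:
  assumes "0 < \<nu>" "smallest_dirichlet_eigenvalue \<Omega> \<nu>" "v \<in> V"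
  shows "norm (fst v) \<le> \<nu> powr (- 1 / 2) * norm (snd v)"
proof -
  \<comment> \<open>An eigenfunction ensures that \<open>V\<close> has an element with nonzero
    function part, so the infimum of the Rayleigh quotient is over a nonempty set.\<close>
  obtain w0 where w0: "w0 \<in> H10 \<Omega>" "\<not> (AE x in lebesgue_on \<Omega>. w0 x = 0)"
    using assms(2) unfolding smallest_dirichlet_eigenvalue_def dirichlet_eigenvalue_def by blast
  have Enz: "fst (sob w) \<noteq> 0 \<longleftrightarrow> \<not> (AE x in lebesgue_on \<Omega>. w x = 0)" if "w \<in> H10 \<Omega>" for w
  proof -
    have "E (\<lambda>x. 0 :: complex) = 0" using E_scaleR[OF L2_zero, of 0] by simp
    then have "E w = 0 \<longleftrightarrow> (AE x in lebesgue_on \<Omega>. w x = 0)"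
      using E_eq_iff[OF H1_L2D(1)[OF H10_H1[OF that]] L2_zero] by simp
    then show ?thesis by (simp add: sob_def)
  qed
  have w0V: "sob w0 \<in> V" "fst (sob w0) \<noteq> 0" using w0 Enz by (auto simp: H10_iff)
  have "\<exists>\<mu>. \<exists>u\<in>V. fst u \<noteq> 0 \<and> 0 \<le> \<mu> \<and> (\<forall>v\<in>V. snd u \<bullet> snd v = \<mu> * (fst u \<bullet> fst v)) \<and>
     (\<forall>v\<in>V. \<mu> * (norm (fst v))\<^sup>2 \<le> (norm (snd v))\<^sup>2)"
    by (rule rayleigh_minimizer[OF subspace_V closed_V _ w0V]) (rule V_compact)
  then obtain \<mu> u where u: "u \<in> V" "fst u \<noteq> 0" and eq: "\<And>z. z \<in> V \<Longrightarrow> snd u \<bullet> snd z = \<mu> * (fst u \<bullet> fst z)"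
    and ineq: "\<And>z. z \<in> V \<Longrightarrow> \<mu> * (norm (fst z))\<^sup>2 \<le> (norm (snd z))\<^sup>2" by blast
  obtain w where w: "w \<in> H10 \<Omega>" "sob w = u" using V_representative[OF u(1)] by blast
  note L = H1_L2D[OF H10_H1[OF w(1)]]
  have "dirichlet_eigenvalue \<Omega> \<mu>"
    unfolding dirichlet_eigenvalue_def
  proof (intro bexI[OF _ w(1)] conjI)
    show "\<not> (AE x in lebesgue_on \<Omega>. w x = 0)" using Enz[OF w(1)] u(2) w(2) by simp
    \<comment> \<open>The real eigenvalue equation is a weak form with right-hand part
      \<open>- \<mu>\<close> times \<open>w\<close>, so \<open>weak_form_iff_real_form\<close> makes
      it the complex equation required of a Dirichlet eigenvalue.\<close>
    have p: "(\<lambda>x. (- \<mu>) *\<^sub>R w x) \<in> L2D" by (intro L2_scaleR L)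
    have "\<forall>z\<in>V. E (wgrad \<Omega> w) \<bullet> snd z + E (\<lambda>x. (- \<mu>) *\<^sub>R w x) \<bullet> fst z = 0"
      unfolding E_scaleR[OF L(1)] using eq w(2)[symmetric] by (auto simp: sob_def)
    then have "\<forall>v\<in>H10 \<Omega>. (LINT x|lebesgue_on \<Omega>. cdot (wgrad \<Omega> w x) (wgrad \<Omega> v x)) + (LINT x|lebesgue_on \<Omega>. (- \<mu>) *\<^sub>R w x * v x) = 0"
      unfolding weak_form_iff_real_form[OF p L(2)] .
    moreover have "(LINT x|lebesgue_on \<Omega>. (- \<mu>) *\<^sub>R w x * v x) = - (complex_of_real \<mu> * (LINT x|lebesgue_on \<Omega>. w x * v x))" for v
      by (simp add: scaleR_conv_of_real mult.assoc)
    ultimately show "\<forall>v\<in>H10 \<Omega>. (LINT x|lebesgue_on \<Omega>. cdot (wgrad \<Omega> w x) (wgrad \<Omega> v x)) = complex_of_real \<mu> * (LINT x|lebesgue_on \<Omega>. w x * v x)"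
      by simp
  qed
  then have "\<nu> \<le> \<mu>" using assms(2) by (simp add: smallest_dirichlet_eigenvalue_def)
  then have "\<nu> * (norm (fst v))\<^sup>2 \<le> (norm (snd v))\<^sup>2"
    using ineq[OF assms(3)] by (meson mult_right_mono order_trans zero_le_power2)
  moreover have sq: "(\<nu> powr (- 1 / 2))\<^sup>2 = 1 / \<nu>"
    using assms(1) by (simp add: power2_eq_square powr_add[symmetric] powr_minus_divide)
  ultimately have "(norm (fst v))\<^sup>2 \<le> (\<nu> powr (- 1 / 2) * norm (snd v))\<^sup>2"
    using assms(1) unfolding power_mult_distrib sq by (simp add: field_simps)
  then show ?thesis by (rule power2_le_imp_le) simp
qed

section \<open>The nonlinearity as a Lipschitz map between Hilbert spaces\<close>

text \<open>A Lipschitz function grows at most linearly, and the constant \<open>norm (F 0)\<close>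
  is square integrable because \<open>\<Omega>\<close> is bounded.\<close>

lemma lipschitz_L2D:
  fixes F :: "'b::euclidean_space \<Rightarrow> complex"
  assumes F: "K-lipschitz_on UNIV F" and u: "u \<in> L2D"
  shows "(\<lambda>x. F (u x)) \<in> L2D"
proof -
  have c: "(\<lambda>x. norm (F 0)) \<in> L2D" by (intro L2_bounded_continuous continuous_intros bounded_domain domain_sets)
  have b: "(\<lambda>x. norm (F 0) + K *\<^sub>R norm (u x)) \<in> L2D" by (intro L2_add L2_scaleR c L2_norm u)
  show ?thesis
  proof (rule L2_dominated[OF b])
    show "(\<lambda>x. F (u x)) \<in> borel_measurable (lebesgue_on \<Omega>)"
      by (rule borel_measurable_continuous_on[OF lipschitz_on_continuous_on[OF F] L2_measurable[OF u]])
    show "AE x in lebesgue_on \<Omega>. norm (F (u x)) \<le> norm (norm (F 0) + K *\<^sub>R norm (u x))"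
    proof (rule AE_I2)
      fix x
      have "norm (F (u x) - F 0) \<le> K * norm (u x)" using lipschitz_onD[OF F, of "u x" 0] by (simp add: dist_norm)
      then show "norm (F (u x)) \<le> norm (norm (F 0) + K *\<^sub>R norm (u x))"
        using norm_triangle_sub[of "F (u x)" "F 0"] by simp
    qed
  qed
qed

text \<open>The superposition operator on classes. It is defined through representatives on the
  whole product, not only on pairs coming from functions on \<open>\<Omega>\<close>, because
  \<open>semilinear_solution\<close> asks for the Lipschitz bound at all pairs;
  \<open>E_rep_zero_ext\<close> identifies its terms for genuine functions.\<close>

definition nonlin :: "(complex \<Rightarrow> complex) \<Rightarrow> (complex^'n \<Rightarrow> complex) \<Rightarrow>
    (real^'n, complex) l2 \<times> (real^'n, complex^'n) l2 \<Rightarrow> (real^'n, complex) l2" where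
  "nonlin F1 F2 p = E (\<lambda>x. F1 (rep_l2 (fst p) x)) + E (\<lambda>x. F2 (rep_l2 (snd p) x))"

lemma E_lipschitz:
  fixes F :: "'b::euclidean_space \<Rightarrow> complex"
  assumes F: "K-lipschitz_on UNIV F"
  shows "norm (E (\<lambda>x. F (rep_l2 a x)) - E (\<lambda>x. F (rep_l2 b x))) \<le> K * norm (a - b)"
proof -
  note L = lipschitz_L2D[OF F L2_lebesgue_on[OF rep_l2(1) domain_sets]]
  have "norm (E (\<lambda>x. F (rep_l2 a x) - F (rep_l2 b x))) \<le> K * norm (to_l2 (\<lambda>x. rep_l2 a x - rep_l2 b x))"
  proof (rule E_norm_le)
    show "norm (F (rep_l2 a x) - F (rep_l2 b x)) \<le> K * norm (rep_l2 a x - rep_l2 b x)" for x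
      using lipschitz_onD[OF F, of "rep_l2 a x" "rep_l2 b x"] by (simp add: dist_norm)
  qed (intro L2_diff L rep_l2 lipschitz_on_nonneg[OF F])+
  then show ?thesis by (simp add: E_diff[OF L L] to_l2_diff[OF rep_l2(1) rep_l2(1), symmetric] rep_l2(2))
qed

lemma nonlin_lipschitz:
  assumes "C1-lipschitz_on UNIV F1" "C2-lipschitz_on UNIV F2"
  shows "norm (nonlin F1 F2 p - nonlin F1 F2 q) \<le> C1 * norm (fst p - fst q) + C2 * norm (snd p - snd q)"
  unfolding nonlin_def add_diff_add
  by (intro order_trans[OF norm_triangle_ineq] add_mono E_lipschitz assms)

lemma E_rep_zero_ext:
  fixes F :: "'b::euclidean_space \<Rightarrow> complex"
  assumes F: "K-lipschitz_on UNIV F" and u: "u \<in> L2D"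
  shows "E (\<lambda>x. F (rep_l2 (E u) x)) = E (\<lambda>x. F (u x))"
proof -
  have "AE x in lebesgue. rep_l2 (E u) x = zero_ext \<Omega> u x"
    unfolding E_def by (rule rep_to_l2[OF zero_ext_L2D[OF u]])
  then have "AE x in lebesgue. x \<in> \<Omega> \<longrightarrow> rep_l2 (E u) x = u x"
    by eventually_elim (simp add: zero_ext_def)
  then have "AE x in lebesgue_on \<Omega>. rep_l2 (E u) x = u x" by (subst AE_restrict_space_iff) auto
  then have "AE x in lebesgue_on \<Omega>. F (rep_l2 (E u) x) = F (u x)" by eventually_elim simp
  then show ?thesis
    by (subst E_eq_iff) (auto intro!: lipschitz_L2D[OF F] u L2_lebesgue_on rep_l2)
qed

text \<open>Moving \<open>f\<close> to the left makes the weak equation homogeneous with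
  zeroth-order part \<open>F1 (u x) + F2 (wgrad \<Omega> u x) - f x\<close>, to which
  \<open>weak_form_iff_real_form\<close> applies.\<close>

lemma weak_solution_iff:
  assumes F1: "C1-lipschitz_on UNIV F1" and F2: "C2-lipschitz_on UNIV F2" and f: "f \<in> L2D"
  shows "weak_solution \<Omega> F1 F2 f gt u \<longleftrightarrow> u \<in> H1 \<Omega> \<and> (\<lambda>x. u x - gt x) \<in> H10 \<Omega> \<and>
     (\<forall>z\<in>V. snd (sob u) \<bullet> snd z + nonlin F1 F2 (sob u) \<bullet> fst z = E f \<bullet> fst z)"
proof (cases "u \<in> H1 \<Omega>")
  case True
  note L = H1_L2D[OF True]
  note F = lipschitz_L2D[OF F1 L(1)] lipschitz_L2D[OF F2 L(2)]
  note p = L2_diff[OF L2_add[OF F] f]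
  have "(LINT x|lebesgue_on \<Omega>. (F1 (u x) + F2 (wgrad \<Omega> u x) - f x) * v x) =
     (LINT x|lebesgue_on \<Omega>. (F1 (u x) + F2 (wgrad \<Omega> u x)) * v x) - (LINT x|lebesgue_on \<Omega>. f x * v x)" if "v \<in> H10 \<Omega>" for v
    using L2_mult_integrable[OF L2_add[OF F] H1_L2D(1)[OF H10_H1[OF that]]] L2_mult_integrable[OF f H1_L2D(1)[OF H10_H1[OF that]]]
    by (simp add: left_diff_distrib)
  then have "(\<forall>v \<in> H10 \<Omega>. (LINT x|lebesgue_on \<Omega>. cdot (wgrad \<Omega> u x) (wgrad \<Omega> v x)) +
        (LINT x|lebesgue_on \<Omega>. (F1 (u x) + F2 (wgrad \<Omega> u x)) * v x) = (LINT x|lebesgue_on \<Omega>. f x * v x)) \<longleftrightarrow>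
     (\<forall>v \<in> H10 \<Omega>. (LINT x|lebesgue_on \<Omega>. cdot (wgrad \<Omega> u x) (wgrad \<Omega> v x)) +
        (LINT x|lebesgue_on \<Omega>. (F1 (u x) + F2 (wgrad \<Omega> u x) - f x) * v x) = 0)"
    by (intro ball_cong refl) (simp only: diff_0_right add_diff_eq right_minus_eq)
  also have "\<dots> \<longleftrightarrow> (\<forall>z\<in>V. E (wgrad \<Omega> u) \<bullet> snd z + E (\<lambda>x. F1 (u x) + F2 (wgrad \<Omega> u x) - f x) \<bullet> fst z = 0)"
    by (rule weak_form_iff_real_form[OF p L(2)])
  also have "E (\<lambda>x. F1 (u x) + F2 (wgrad \<Omega> u x) - f x) = nonlin F1 F2 (sob u) - E f"
    by (simp add: E_diff[OF L2_add[OF F] f] E_add[OF F] nonlin_def sob_def E_rep_zero_ext[OF F1 L(1)] E_rep_zero_ext[OF F2 L(2)])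
  also have "(\<forall>z\<in>V. E (wgrad \<Omega> u) \<bullet> snd z + (nonlin F1 F2 (sob u) - E f) \<bullet> fst z = 0) \<longleftrightarrow>
     (\<forall>z\<in>V. snd (sob u) \<bullet> snd z + nonlin F1 F2 (sob u) \<bullet> fst z = E f \<bullet> fst z)"
    by (simp add: sob_def inner_diff_left algebra_simps)
  finally show ?thesis using True by (simp add: weak_solution_def)
qed (simp add: weak_solution_def)

section \<open>Boundary values\<close>

lemma space_surface_measure: "space (surface_measure \<Omega>) = frontier \<Omega>"
  by (simp add: surface_measure_def hausdorff_measure_def space_restrict_space space_measure_of_conv)

text \<open>Adding to the smooth approximations of \<open>gt\<close> test functions that approximate
  \<open>w\<close> changes nothing on the boundary, where test functions vanish.\<close>

lemma has_trace_add_H10: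
  assumes gt: "has_trace \<Omega> gt g" and w: "w \<in> H10 \<Omega>"
  shows "has_trace \<Omega> (\<lambda>x. gt x + w x) g"
proof -
  obtain \<phi> where \<phi>: "\<And>k. smooth (\<phi> k)" "(\<lambda>k. norm_H1 \<Omega> (\<lambda>x. \<phi> k x - gt x)) \<longlonglongrightarrow> 0"
    "(\<lambda>k. norm_L2 (surface_measure \<Omega>) (\<lambda>x. \<phi> k x - g x)) \<longlonglongrightarrow> 0"
    and gH: "gt \<in> H1 \<Omega>" and g: "g \<in> L2 (surface_measure \<Omega>)"
    using gt unfolding has_trace_def by blast
  have wH: "w \<in> H1 \<Omega>" using w by (rule H10_H1)
  have "\<exists>\<psi>\<in>test_functions \<Omega>. norm_H1 \<Omega> (\<lambda>x. w x - \<psi> x) < inverse (real (Suc k))" for k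
    using w by (auto simp: H10_def)
  then obtain \<psi> where \<psi>: "\<And>k. \<psi> k \<in> test_functions \<Omega>" "\<And>k. norm_H1 \<Omega> (\<lambda>x. w x - \<psi> k x) < inverse (real (Suc k))" by metis
  have H: "\<phi> k \<in> H1 \<Omega>" "\<psi> k \<in> H1 \<Omega>" for k
    using \<phi>(1) \<psi>(1) by (auto intro: C1_H1 smooth_imp_C1 test_C1)
  have le: "norm_H1 \<Omega> (\<lambda>x. (\<phi> k x + \<psi> k x) - (gt x + w x)) \<le> norm_H1 \<Omega> (\<lambda>x. \<phi> k x - gt x) + 1 * inverse (real (Suc k))" for k
  proof -
    have "sob (\<lambda>x. (\<phi> k x + \<psi> k x) - (gt x + w x)) = (sob (\<phi> k) + sob (\<psi> k)) - (sob gt + sob w)"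
      by (simp only: sob_diff[OF H1_add[OF H] H1_add[OF gH wH]] sob_add[OF H] sob_add[OF gH wH])
    then have "sob (\<lambda>x. (\<phi> k x + \<psi> k x) - (gt x + w x)) = (sob (\<phi> k) - sob gt) - (sob w - sob (\<psi> k))"
      by simp
    then have "norm (sob (\<lambda>x. (\<phi> k x + \<psi> k x) - (gt x + w x))) \<le> norm (sob (\<phi> k) - sob gt) + norm (sob w - sob (\<psi> k))"
      using norm_triangle_ineq4[of "sob (\<phi> k) - sob gt" "sob w - sob (\<psi> k)"] by (simp only:)
    then show ?thesis
      using \<psi>(2)[of k] by (simp add: norm_H1_eq H1_diff H1_add H gH wH sob_diff)
  qed
  have ge: "0 \<le> norm_H1 \<Omega> (\<lambda>x. (\<phi> k x + \<psi> k x) - (gt x + w x))" for k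
    by (simp add: norm_H1_eq H1_diff H1_add H gH wH)
  have "(\<lambda>k. norm_H1 \<Omega> (\<lambda>x. \<phi> k x - gt x) + 1 * inverse (real (Suc k))) \<longlonglongrightarrow> 0 + 0"
    by (intro tendsto_add \<phi> inverse_Suc_LIMSEQ)
  then have lim: "(\<lambda>k. norm_H1 \<Omega> (\<lambda>x. (\<phi> k x + \<psi> k x) - (gt x + w x))) \<longlonglongrightarrow> 0"
    by (intro tendsto_sandwich[OF always_eventually[OF allI[OF ge]] always_eventually[OF allI[OF le]] tendsto_const]) simp
  have "norm_L2 (surface_measure \<Omega>) (\<lambda>x. (\<phi> k x + \<psi> k x) - g x) = norm_L2 (surface_measure \<Omega>) (\<lambda>x. \<phi> k x - g x)" for k
  proof -
    have "\<psi> k x = 0" if "x \<in> frontier \<Omega>" for x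
      using that open_domain test_function_outside[OF \<psi>(1), of x k] by (auto simp: frontier_def interior_open)
    then show ?thesis
      unfolding norm_L2_def
      by (intro arg_cong[of _ _ sqrt] Bochner_Integration.integral_cong) (auto simp: space_surface_measure)
  qed
  then have "(\<lambda>k. norm_L2 (surface_measure \<Omega>) (\<lambda>x. (\<phi> k x + \<psi> k x) - g x)) \<longlonglongrightarrow> 0" using \<phi>(3) by simp
  moreover have "smooth (\<lambda>x. \<phi> k x + \<psi> k x)" for k
    using \<phi>(1)[of k] test_function_smooth[OF \<psi>(1)[of k]] by (auto simp: smooth_def intro: Ck_add)
  ultimately show ?thesis
    unfolding has_trace_def using lim H1_add[OF gH wH] g by (intro conjI exI[of _ "\<lambda>k x. \<phi> k x + \<psi> k x"]) auto
qed

end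

theorem corollary2p1:
  fixes \<Omega> :: "(real^'n::finite) set"
    and lambda1 C C1 C2 :: real
    and F1 :: "complex \<Rightarrow> complex"
    and F2 :: "complex^'n \<Rightarrow> complex"
    and f g gt :: "real^'n \<Rightarrow> complex"
  assumes "open \<Omega>" and "bounded \<Omega>" and "connected \<Omega>" and "C1_boundary \<Omega>"
    and "0 < lambda1" and "smallest_dirichlet_eigenvalue \<Omega> lambda1"
    and "C = lambda1 powr (- 1 / 2)"
    and "C1-lipschitz_on UNIV F1" and "C2-lipschitz_on UNIV F2"
    and "C1 * C\<^sup>2 + C2 * C < 1"
    and "f \<in> L2 (lebesgue_on \<Omega>)"
    and "g \<in> L2 (surface_measure \<Omega>)" and "gt \<in> H1 \<Omega>" and "has_trace \<Omega> gt g"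
  shows "\<exists>u. weak_solution \<Omega> F1 F2 f gt u \<and> has_trace \<Omega> u g \<and>
           (\<forall>u'. weak_solution \<Omega> F1 F2 f gt u' \<longrightarrow> (AE x in lebesgue_on \<Omega>. u' x = u x))"
proof -
  interpret bounded_open \<Omega> by unfold_locales (fact assms)+
  note F = \<open>C1-lipschitz_on UNIV F1\<close> \<open>C2-lipschitz_on UNIV F2\<close>
  note weak_iff = weak_solution_iff[OF F \<open>f \<in> L2 (lebesgue_on \<Omega>)\<close>, of gt]
  note gt = \<open>gt \<in> H1 \<Omega>\<close>
  have "\<exists>!v. v \<in> V \<and> (\<forall>z\<in>V. snd (sob gt + v) \<bullet> snd z + nonlin F1 F2 (sob gt + v) \<bullet> fst z = E f \<bullet> fst z)"
  proof (rule semilinear_solution[OF subspace_V closed_V])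
    show "norm (fst v) \<le> C * norm (snd v)" if "v \<in> V" for v
      unfolding \<open>C = lambda1 powr (- 1 / 2)\<close> by (rule Poincare_inequality[OF assms(5,6) that])
    show "norm (nonlin F1 F2 p - nonlin F1 F2 q) \<le> C1 * norm (fst p - fst q) + C2 * norm (snd p - snd q)" for p q
      by (rule nonlin_lipschitz[OF F])
  qed (use assms lipschitz_on_nonneg[OF F(1)] lipschitz_on_nonneg[OF F(2)] in auto)
  then obtain v where v: "v \<in> V" "\<forall>z\<in>V. snd (sob gt + v) \<bullet> snd z + nonlin F1 F2 (sob gt + v) \<bullet> fst z = E f \<bullet> fst z"
    and unique: "\<And>v'. v' \<in> V \<Longrightarrow> \<forall>z\<in>V. snd (sob gt + v') \<bullet> snd z + nonlin F1 F2 (sob gt + v') \<bullet> fst z = E f \<bullet> fst z \<Longrightarrow> v' = v"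
    by metis
  obtain w where w: "w \<in> H10 \<Omega>" "sob w = v" using V_representative[OF v(1)] by blast
  note wH = H10_H1[OF w(1)]
  define u where "u x = gt x + w x" for x
  have u: "u \<in> H1 \<Omega>" "sob u = sob gt + v"
    unfolding u_def using H1_add[OF gt wH] sob_add[OF gt wH] w(2) by auto
  have "weak_solution \<Omega> F1 F2 f gt u"
    unfolding weak_iff u(2) using u(1) w(1) v(2) by (simp add: u_def)
  moreover have "has_trace \<Omega> u g"
    unfolding u_def using has_trace_add_H10[OF \<open>has_trace \<Omega> gt g\<close> w(1)] .
  moreover have "AE x in lebesgue_on \<Omega>. u' x = u x" if "weak_solution \<Omega> F1 F2 f gt u'" for u'
  proof -
    from that have u': "u' \<in> H1 \<Omega>" "(\<lambda>x. u' x - gt x) \<in> H10 \<Omega>"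
      and eq: "\<forall>z\<in>V. snd (sob u') \<bullet> snd z + nonlin F1 F2 (sob u') \<bullet> fst z = E f \<bullet> fst z"
      unfolding weak_iff by auto
    \<comment> \<open>Any solution is \<open>gt\<close> plus an element of
      \<open>H10 \<Omega>\<close>, whose image in \<open>V\<close> solves the same abstract
      problem.\<close>
    have s: "sob u' = sob gt + sob (\<lambda>x. u' x - gt x)" by (simp add: sob_diff[OF u'(1) gt])
    have "sob (\<lambda>x. u' x - gt x) = v" by (rule unique) (use u'(2) eq s in \<open>auto simp: H10_iff\<close>)
    then have "sob u' = sob u" using s u(2) by simp
    then have "E u' = E u" by (simp add: sob_def)
    then show ?thesis by (simp add: E_eq_iff H1_L2D u'(1) u(1))
  qed
  ultimately show ?thesis by blast
qed

thm_deps corollary2p1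

end
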